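(* Let $H$ be a finite group containing a normal subgroup $C$ such that $C$ coincides with its centraliser in $H$, $C$ does not decompose into a direct product of nontrivial subgroups normal in $H$, and $|C|$ is coprime to $|H/C|$. Then $H$ is a retract of every finite group $G\supseteq H$ satisfying all identities of $H$. In particular, $H$ is strongly verbally closed.
   Context: A subgroup $H$ of $G$ is a retract of $G$ if there is an endomorphism $\rho$ of $G$ with $\rho\circ\rho=\rho$ and $\rho(G)=H$. A subgroup $H$ of $G$ is verbally closed if every equation $w(x_1,\dots,x_n)=h$ with $w$ in a free group and $h\in H$ solvable in $G$ is solvable in $H$; algebraically closed if every finite system of equations with coefficients from $H$ solvable in $G$ is solvable in $H$. A group is strongly verbally closed if it is algebraically closed in every group containing it as a verbally closed subgroup. *)

theory Defs
  imports "HOL-Algebra.Algebra"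
begin

definition centraliser :: "('a, 'b) monoid_scheme \<Rightarrow> 'a set \<Rightarrow> 'a set" where
  "centraliser G S = {g \<in> carrier G. \<forall>s\<in>S. g \<otimes>\<^bsub>G\<^esub> s = s \<otimes>\<^bsub>G\<^esub> g}"

definition H_normal_decomposable :: "('a, 'b) monoid_scheme \<Rightarrow> 'a set \<Rightarrow> bool" where
  "H_normal_decomposable H C \<longleftrightarrow>
     (\<exists>A B. A \<lhd> H \<and> B \<lhd> H \<and> A \<subseteq> C \<and> B \<subseteq> C \<and>
            A \<noteq> {\<one>\<^bsub>H\<^esub>} \<and> B \<noteq> {\<one>\<^bsub>H\<^esub>} \<and>
            A \<inter> B = {\<one>\<^bsub>H\<^esub>} \<and> A <#>\<^bsub>H\<^esub> B = C)"

text \<open>A word of the free group on variables x_0, x_1, ... is a list of letters (i, e):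
  e = True means x_i, e = False means x_i inverse. Evaluation under an assignment.\<close>
type_synonym fword = "(nat \<times> bool) list"

fun eval_fword :: "('a, 'b) monoid_scheme \<Rightarrow> (nat \<Rightarrow> 'a) \<Rightarrow> fword \<Rightarrow> 'a" where
  "eval_fword G f [] = \<one>\<^bsub>G\<^esub>"
| "eval_fword G f ((i, e) # w) =
     (if e then f i else inv\<^bsub>G\<^esub> (f i)) \<otimes>\<^bsub>G\<^esub> eval_fword G f w"

datatype 'c cletter = Var nat bool | Const 'c

type_synonym 'c cword = "'c cletter list"

fun eval_cword :: "('a, 'b) monoid_scheme \<Rightarrow> ('c \<Rightarrow> 'a) \<Rightarrow> (nat \<Rightarrow> 'a) \<Rightarrow> 'c cword \<Rightarrow> 'a" where
  "eval_cword G \<phi> f [] = \<one>\<^bsub>G\<^esub>"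
| "eval_cword G \<phi> f (Var i e # w) =
     (if e then f i else inv\<^bsub>G\<^esub> (f i)) \<otimes>\<^bsub>G\<^esub> eval_cword G \<phi> f w"
| "eval_cword G \<phi> f (Const c # w) = \<phi> c \<otimes>\<^bsub>G\<^esub> eval_cword G \<phi> f w"

definition satisfies_identities_of ::
  "('a, 'b) monoid_scheme \<Rightarrow> ('c, 'd) monoid_scheme \<Rightarrow> bool" where
  "satisfies_identities_of G H \<longleftrightarrow>
     (\<forall>w::fword. (\<forall>f. f \<in> UNIV \<rightarrow> carrier H \<longrightarrow> eval_fword H f w = \<one>\<^bsub>H\<^esub>)
        \<longrightarrow> (\<forall>f. f \<in> UNIV \<rightarrow> carrier G \<longrightarrow> eval_fword G f w = \<one>\<^bsub>G\<^esub>))"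

definition retract :: "'a set \<Rightarrow> ('a, 'b) monoid_scheme \<Rightarrow> bool" where
  "retract K G \<longleftrightarrow>
     (\<exists>\<rho> \<in> hom G G. (\<forall>g \<in> carrier G. \<rho> (\<rho> g) = \<rho> g) \<and> \<rho> ` carrier G = K)"

definition verbally_closed :: "'a set \<Rightarrow> ('a, 'b) monoid_scheme \<Rightarrow> bool" where
  "verbally_closed K G \<longleftrightarrow>
     (\<forall>w::fword. \<forall>h \<in> K.
        (\<exists>f. f \<in> UNIV \<rightarrow> carrier G \<and> eval_fword G f w = h) \<longrightarrow>
        (\<exists>f. f \<in> UNIV \<rightarrow> K \<and> eval_fword G f w = h))"

definition algebraically_closed :: "'a set \<Rightarrow> ('a, 'b) monoid_scheme \<Rightarrow> bool" where
  "algebraically_closed K G \<longleftrightarrow>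
     (\<forall>S::'a cword list. (\<forall>u \<in> set S. set u \<inter> range Const \<subseteq> Const ` K) \<longrightarrow>
        (\<exists>f. f \<in> UNIV \<rightarrow> carrier G \<and> (\<forall>u \<in> set S. eval_cword G id f u = \<one>\<^bsub>G\<^esub>)) \<longrightarrow>
        (\<exists>f. f \<in> UNIV \<rightarrow> K \<and> (\<forall>u \<in> set S. eval_cword G id f u = \<one>\<^bsub>G\<^esub>)))"

end

theory Submission
  imports Defs
begin

text \<open>
  A finite group \<open>G\<close> satisfying the identities of \<open>H\<close> is a quotient of a subgroup \<open>K\<close> of a finite power
  of \<open>H\<close>. Replacing \<open>G\<close> by \<open>G/N\<close>, where \<open>N\<close> is a maximal normal subgroup with \<open>N \<inter> C = 1\<close> (whence
  \<open>N \<inter> H = 1\<close>, because \<open>C\<close> is self-centralising), every nontrivial normal subgroup of \<open>G\<close> meets \<open>C\<close>,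
  and it is enough to prove \<open>|G| \<le> |H|\<close>.

  Coprimeness and indecomposability make \<open>C\<close> a homocyclic \<open>p\<close>-group whose \<open>p\<close>-torsion \<open>C[p]\<close> is contained in
  every nontrivial \<open>H\<close>-normal subgroup of \<open>C\<close>. The elements of \<open>K\<close> with all coordinates in \<open>C\<close> yield a normal
  abelian subgroup \<open>P\<close> of \<open>G\<close> of index prime to \<open>p\<close> and of exponent at most that of \<open>C\<close>. By Maschke's
  argument \<open>M = P[p]\<close> is a minimal normal subgroup of \<open>G\<close>; as it is a section of one coordinate of \<open>K\<close>,
  \<open>|M| \<le> |C[p]|\<close>, hence \<open>M = C[p]\<close> and \<open>P = C\<close>, because \<open>C\<close> is homocyclic. The centraliser of \<open>M\<close> in
  \<open>G\<close> centralises \<open>P\<close>, and by transfer it equals \<open>P\<close>. Since \<open>G\<close> acts on \<open>M\<close> through one coordinate of \<open>K\<close>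
  modulo \<open>C\<close>, \<open>|G : P| \<le> |H : C|\<close>.

  For strong verbal closedness, the subgroup generated by \<open>H\<close> and a solution of the system, divided by
  the values of the identities of \<open>H\<close>, is finite and still contains \<open>H\<close>; a retraction of this quotient
  onto \<open>H\<close> carries the solution into \<open>H\<close>.
\<close>

section \<open>Homocyclic subgroups of abelian groups\<close>

lemma (in group) subgroup_nat_pow_closed:
  assumes "subgroup E G" "x \<in> E"
  shows "x [^] (n::nat) \<in> E"
  using assms by (induct n) (auto simp: subgroup.one_closed subgroup.m_closed)

text \<open>Bezout: with \<open>u * a + v * b = 1\<close>, \<open>x\<close> is the product of the
  \<open>u\<close>-th power of \<open>x [^] a\<close> and the \<open>v\<close>-th power of
  \<open>x [^] b\<close>.\<close>

lemma (in group) subgroup_coprime_pow: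
  assumes E: "subgroup E G" and x: "x \<in> carrier G"
    and "x [^] (a::nat) \<in> E" "x [^] (b::nat) \<in> E" "coprime a b"
  shows "x \<in> E"
proof -
  obtain u v where uv: "u * int a + v * int b = 1"
    using \<open>coprime a b\<close> bezout_int[of "int a" "int b"] by auto
  have pow: "y [^] (k::int) \<in> E" if "y \<in> E" for y k
  proof (cases "k < 0")
    case True
    have "inv (y [^] nat (- k)) \<in> E"
      using subgroup.m_inv_closed[OF E subgroup_nat_pow_closed[OF E that]] .
    then show ?thesis using True by (simp only: int_pow_def2 if_True)
  next
    case False
    then show ?thesis using subgroup_nat_pow_closed[OF E that] by (simp only: int_pow_def2 if_False)
  qed
  have "int a * u + int b * v = 1" using uv by (simp only: mult.commute)
  then have "x = x [^] (int a * u + int b * v)"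
    using x by (simp only: int_pow_1)
  also have "\<dots> = (x [^] a) [^] u \<otimes> (x [^] b) [^] v"
    unfolding int_pow_mult[OF x] int_pow_pow[OF x, symmetric] int_pow_int ..
  also have "\<dots> \<in> E"
    using assms pow E by (simp add: subgroup.m_closed)
  finally show ?thesis .
qed

lemma (in group) coprime_pow_eq_one:
  assumes "x \<in> carrier G" "x [^] (a::nat) = \<one>" "x [^] (b::nat) = \<one>" "coprime a b"
  shows "x = \<one>"
  using subgroup_coprime_pow[OF triv_subgroup, of x a b] assms by simp

text \<open>This is the subgroup generated by \<open>L\<close> and \<open>y\<close>. Natural
  exponents suffice because in a finite group \<open>y [^] (j * (order G - 1))\<close> is inverse to
  \<open>y [^] j\<close>.\<close>

lemma (in comm_group) subgroup_adjoin:
  assumes fin: "finite (carrier G)" and L: "subgroup L G" and y: "y \<in> carrier G"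
  shows "subgroup {x \<otimes> y [^] j | x (j::nat). x \<in> L} G" (is "subgroup ?Z G")
proof (rule subgroupI)
  have Xc: "x \<in> carrier G" if "x \<in> L" for x
    using that L by (meson subgroup.mem_carrier)
  show "?Z \<subseteq> carrier G" using Xc y by auto
  show "?Z \<noteq> {}" using L subgroup.one_closed by fastforce
  show "inv z \<in> ?Z" if "z \<in> ?Z" for z
  proof -
    from that obtain x and j :: nat where z: "z = x \<otimes> y [^] j" "x \<in> L" by auto
    have o: "order G > 0" using fin order_gt_0_iff_finite by blast
    have "y [^] (j * (order G - 1)) \<otimes> y [^] j = y [^] (order G * j)"
      using y o by (simp add: nat_pow_mult algebra_simps)
    also have "\<dots> = \<one>"
      using y by (simp add: nat_pow_pow[symmetric] pow_order_eq_1)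
    finally have "inv (y [^] j) = y [^] (j * (order G - 1))"
      using y by (simp add: inv_equality)
    then have "inv z = inv x \<otimes> y [^] (j * (order G - 1))"
      using z Xc y by (simp add: inv_mult)
    then show ?thesis using z L by (auto intro: subgroup.m_inv_closed)
  qed
  show "z \<otimes> w \<in> ?Z" if "z \<in> ?Z" "w \<in> ?Z" for z w
  proof -
    from that obtain x x' and j j' :: nat
      where z: "z = x \<otimes> y [^] j" "x \<in> L" "w = x' \<otimes> y [^] j'" "x' \<in> L" by auto
    have "z \<otimes> w = (x \<otimes> x') \<otimes> y [^] (j + j')"
      using z Xc y by (simp add: m_ac nat_pow_mult[symmetric])
    then show ?thesis using z L by (blast intro: subgroup.m_closed)
  qed
qed

lemma (in group) set_mult_absorbs_left:
  assumes "A \<subseteq> carrier G" "subgroup B G"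
  shows "A \<subseteq> A <#> B"
proof
  fix a assume "a \<in> A"
  then have "a = a \<otimes> \<one>" using assms by auto
  then show "a \<in> A <#> B"
    using \<open>a \<in> A\<close> subgroup.one_closed[OF assms(2)] unfolding set_mult_def by blast
qed

lemma (in group) set_mult_absorbs_right:
  assumes "subgroup A G" "B \<subseteq> carrier G"
  shows "B \<subseteq> A <#> B"
proof
  fix b assume "b \<in> B"
  then have "b = \<one> \<otimes> b" using assms by auto
  then show "b \<in> A <#> B"
    using \<open>b \<in> B\<close> subgroup.one_closed[OF assms(1)] unfolding set_mult_def by blast
qed

lemma ex_maximal_superset:
  assumes "finite U" "P A" "\<And>B. P B \<Longrightarrow> B \<subseteq> U"
  obtains M where "P M" "A \<subseteq> M" "\<And>B. P B \<Longrightarrow> M \<subseteq> B \<Longrightarrow> B = M"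
proof -
  have "finite {B. P B \<and> A \<subseteq> B}"
    by (rule finite_subset[of _ "Pow U"]) (use assms in auto)
  then obtain M where "M \<in> {B. P B \<and> A \<subseteq> B}" "A \<subseteq> M"
      "\<forall>B\<in>{B. P B \<and> A \<subseteq> B}. M \<subseteq> B \<longrightarrow> M = B"
    using finite_has_maximal2[of "{B. P B \<and> A \<subseteq> B}" A] assms(2) by auto
  then show ?thesis using that by (metis (mono_tags, lifting) mem_Collect_eq order_trans)
qed

text \<open>Modulo \<open>D\<close> the group is elementary abelian, so the complement is found as
  in linear algebra: \<open>L\<close> is maximal among the subgroups above \<open>D\<close> that
  meet \<open>S\<close> trivially.\<close>

lemma (in comm_group) complement_of_mod_p:
  assumes fin: "finite (carrier G)" and p: "Factorial_Ring.prime (p::nat)"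
    and S: "subgroup S G" and D: "subgroup D G" and SD: "D \<inter> S = {\<one>}"
    and pow: "\<And>x. x \<in> carrier G \<Longrightarrow> x [^] p \<in> D"
  obtains L where "subgroup L G" "D \<subseteq> L" "L \<inter> S = {\<one>}" "L <#> S = carrier G"
proof -
  obtain L where L: "subgroup L G" "L \<inter> S = {\<one>}" "D \<subseteq> L"
    and max: "\<And>B. subgroup B G \<and> B \<inter> S = {\<one>} \<Longrightarrow> L \<subseteq> B \<Longrightarrow> B = L"
    using ex_maximal_superset[of "carrier G" "\<lambda>L. subgroup L G \<and> L \<inter> S = {\<one>}" D] assms
    by (metis subgroup.subset)
  have sub: "subgroup (L <#> S) G" using L(1) S by (rule mult_subgroups)
  have X_le: "L \<subseteq> L <#> S"
    using set_mult_absorbs_left[OF subgroup.subset[OF L(1)] S] .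
  have "y \<in> L <#> S" if y: "y \<in> carrier G" for y
  proof (rule ccontr)
    assume ny: "y \<notin> L <#> S"
    \<comment> \<open>If \<open>y\<close> were outside \<open>L <#> S\<close>, then \<open>L\<close>
      enlarged by \<open>y\<close> would still meet \<open>S\<close> trivially, against
      maximality.\<close>
    let ?Z = "{x \<otimes> y [^] j | x (j::nat). x \<in> L}"
    have Xc: "x \<in> carrier G" if "x \<in> L" for x
      using that L(1) by (meson subgroup.mem_carrier)
    have Z: "subgroup ?Z G" using subgroup_adjoin[OF fin L(1) y] .
    have XZ: "L \<subseteq> ?Z" using Xc by (force intro: exI[of _ "0::nat"])
    have yZ: "y \<in> ?Z"
      using L(1) y by (force intro: exI[of _ "1::nat"] exI[of _ "\<one>"] subgroup.one_closed)
    have yp: "y [^] p \<in> L" using pow[OF y] L(3) by auto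
    have "z = \<one>" if z: "z \<in> ?Z" "z \<in> S" for z
    proof -
      obtain x j where zj: "z = x \<otimes> y [^] (j::nat)" "x \<in> L" using z by auto
      have yj: "y [^] j = inv x \<otimes> z" using zj Xc y by (simp add: m_assoc[symmetric])
      \<comment> \<open>Otherwise \<open>j\<close> and \<open>p\<close> are coprime exponents that
        both bring \<open>y\<close> into \<open>L <#> S\<close>, and \<open>y\<close> itself would
        lie there.\<close>
      have "p dvd j"
      proof (rule ccontr)
        assume "\<not> p dvd j"
        then have "coprime j p" using p by (metis prime_imp_coprime coprime_commute)
        moreover have "y [^] j \<in> L <#> S"
          unfolding yj set_mult_def using zj z L(1) by (auto intro: subgroup.m_inv_closed)
        ultimately show False
          using subgroup_coprime_pow[OF sub y, of j p] yp X_le ny by auto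
      qed
      then obtain i where "j = p * i" by auto
      then have "y [^] j \<in> L"
        using yp y L(1) subgroup_nat_pow_closed by (metis nat_pow_pow)
      then have "z \<in> L" using zj L(1) subgroup.m_closed by metis
      then show ?thesis using z L(2) by auto
    qed
    then have "?Z \<inter> S = {\<one>}" using Z S subgroup.one_closed by blast
    then have "?Z = L" using max Z XZ by blast
    then show False using yZ X_le ny by auto
  qed
  moreover have "L <#> S \<subseteq> carrier G" using sub by (rule subgroup.subset)
  ultimately show ?thesis using that L by blast
qed

text \<open>Here \<open>E\<close> is a direct product of cyclic groups of order
  \<open>p ^ Suc m\<close> with socle \<open>S\<close>. It is chosen maximal among the subgroups
  whose \<open>p\<close>-torsion lies in \<open>S\<close> and consists of \<open>p ^ m\<close>-th
  powers taken inside the subgroup. If some \<open>s\<close> in \<open>S\<close> were missing, a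
  \<open>p ^ m\<close>-th root of it could be adjoined.\<close>

lemma (in comm_group) homocyclic_lift:
  assumes fin: "finite (carrier G)" and p: "Factorial_Ring.prime (p::nat)"
    and exp: "\<And>x. x \<in> carrier G \<Longrightarrow> x [^] (p ^ Suc m) = \<one>"
    and S: "subgroup S G" and div: "\<And>s. s \<in> S \<Longrightarrow> \<exists>x\<in>carrier G. s = x [^] (p ^ m)"
  obtains E where "subgroup E G" "S \<subseteq> E"
    "\<And>x. x \<in> E \<Longrightarrow> x [^] p = \<one> \<Longrightarrow> x \<in> S"
    "\<And>x. x \<in> E \<Longrightarrow> x [^] p = \<one> \<Longrightarrow> \<exists>y\<in>E. x = y [^] (p ^ m)"
proof -
  let ?P = "\<lambda>E. subgroup E G \<and> (\<forall>x\<in>E. x [^] p = \<one> \<longrightarrow> x \<in> S \<and> (\<exists>y\<in>E. x = y [^] (p ^ m)))"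
  have "?P {\<one>}" using triv_subgroup S by (auto intro: subgroup.one_closed)
  then obtain E where E: "?P E" and max: "\<And>B. ?P B \<Longrightarrow> E \<subseteq> B \<Longrightarrow> B = E"
    by (rule ex_maximal_superset[where P = ?P, OF fin]) (auto dest: subgroup.subset)
  have Esub: "subgroup E G" using E by auto
  have Ec: "x \<in> carrier G" if "x \<in> E" for x
    using that Esub by (meson subgroup.mem_carrier)
  have "s \<in> E" if s: "s \<in> S" for s
  proof (rule ccontr)
    assume ns: "s \<notin> E"
    obtain x where x: "x \<in> carrier G" "s = x [^] (p ^ m)" using div s by blast
    have sc: "s \<in> carrier G" using x by simp
    have sp: "s [^] p = \<one>" using x exp[of x] by (simp add: nat_pow_pow mult.commute)
    \<comment> \<open>The powers of \<open>x\<close> meet \<open>E\<close> trivially: from a power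
      in \<open>E\<close> whose exponent is not divisible by \<open>p ^ Suc m\<close>, raising to a
      suitable power of \<open>p\<close> gives \<open>s [^] u\<close> in \<open>E\<close> with
      \<open>u\<close> prime to \<open>p\<close>, hence \<open>s\<close> in
      \<open>E\<close>.\<close>
    have dvd: "p ^ Suc m dvd i" if i: "x [^] (i::nat) \<in> E" for i
    proof (rule ccontr)
      assume nd: "\<not> p ^ Suc m dvd i"
      then have i0: "i \<noteq> 0" by (metis dvd_0_right)
      obtain u where u: "i = p ^ multiplicity p i * u" "\<not> p dvd u"
        using multiplicity_decompose'[of i p] i0 p by (metis not_prime_unit)
      have a: "multiplicity p i \<le> m"
        using nd i0 p by (metis Suc_leI not_le multiplicity_dvd')
      have "s [^] u = (x [^] i) [^] (p ^ (m - multiplicity p i))"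
      proof -
        have "p ^ m * u = i * p ^ (m - multiplicity p i)"
          using a by (subst (1) u(1)) (simp add: power_add[symmetric] mult.commute mult.left_commute mult.assoc)
        then show ?thesis using x by (simp add: nat_pow_pow)
      qed
      then have "s [^] u \<in> E" using i Esub subgroup_nat_pow_closed by metis
      moreover have "s [^] p \<in> E" using sp Esub by (simp add: subgroup.one_closed)
      moreover have "coprime u p" using u p by (metis prime_imp_coprime coprime_commute)
      ultimately show False using subgroup_coprime_pow[OF Esub sc] ns by blast
    qed
    let ?Z = "{e \<otimes> x [^] j | e (j::nat). e \<in> E}"
    have Z: "subgroup ?Z G" using subgroup_adjoin[OF fin Esub x(1)] .
    have EZ: "E \<subseteq> ?Z" using Ec by (force intro: exI[of _ "0::nat"])
    have xZ: "x \<in> ?Z"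
      using Esub x by (force intro: exI[of _ "1::nat"] exI[of _ "\<one>"] subgroup.one_closed)
    have "z \<in> S \<and> (\<exists>y\<in>?Z. z = y [^] (p ^ m))" if z: "z \<in> ?Z" "z [^] p = \<one>" for z
    proof -
      obtain e j where zj: "z = e \<otimes> x [^] (j::nat)" "e \<in> E" using z by auto
      \<comment> \<open>The trivial intersection splits \<open>z [^] p = \<one>\<close> into its two
        factors. Hence \<open>p ^ m\<close> divides \<open>j\<close>, and \<open>e\<close> and
        \<open>x [^] j\<close> are both \<open>p ^ m\<close>-th powers lying in
        \<open>S\<close>.\<close>
      have ep: "e [^] p \<otimes> x [^] (j * p) = \<one>"
        using z zj Ec x by (simp add: nat_pow_distrib nat_pow_pow)
      then have "x [^] (j * p) = inv (e [^] p)"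
        using zj(2) Ec x(1) inv_equality inv_comm by (metis inv_inv nat_pow_closed)
      then have "x [^] (j * p) \<in> E"
        using zj(2) Esub subgroup_nat_pow_closed by (simp add: subgroup.m_inv_closed)
      then have pj: "p ^ Suc m dvd j * p" by (rule dvd)
      then have "x [^] (j * p) = \<one>" using exp[OF x(1)] x(1) by (metis dvdE nat_pow_pow nat_pow_one)
      then have "e [^] p = \<one>" using ep zj Ec by simp
      then obtain y where y: "e \<in> S" "y \<in> E" "e = y [^] (p ^ m)" using E zj by blast
      obtain j' where j': "j = p ^ m * j'" using pj p by (auto simp: prime_gt_0_nat elim: dvdE)
      have xj: "x [^] j = s [^] j'" using x j' by (simp add: nat_pow_pow)
      then have "z \<in> S" using zj y s S subgroup_nat_pow_closed subgroup.m_closed by metis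
      moreover have "z = (y \<otimes> x [^] j') [^] (p ^ m)"
        using zj y x Ec j' by (simp add: nat_pow_distrib nat_pow_pow mult.commute)
      ultimately show ?thesis using y by blast
    qed
    then have "?Z = E" using max[of ?Z] Z EZ by blast
    then have "s \<in> E" using xZ x Esub subgroup_nat_pow_closed by metis
    then show False using ns by simp
  qed
  then show ?thesis using that E by blast
qed

text \<open>Induction on \<open>i\<close>: \<open>e\<close> is divided by a
  \<open>p ^ (m - i)\<close>-th power \<open>w\<close> with the same \<open>p ^ i\<close>-th power.
  The quotient is killed by \<open>p ^ i\<close>, and the induction hypothesis presents it as a
  \<open>p ^ (Suc m - i)\<close>-th power, which is more than is required.\<close>

lemma (in comm_group) homocyclic_divisible:
  assumes E: "subgroup E G"
    and div: "\<And>x. x \<in> E \<Longrightarrow> x [^] (p::nat) = \<one> \<Longrightarrow> \<exists>y\<in>E. x = y [^] (p ^ m)"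
  shows "i \<le> m \<Longrightarrow> e \<in> E \<Longrightarrow> e [^] (p ^ i) = \<one> \<Longrightarrow> \<exists>y\<in>E. e = y [^] (p ^ (Suc m - i))"
proof (induct i arbitrary: e)
  case 0
  then show ?case using E subgroup.mem_carrier by (intro bexI[of _ "\<one>"]) (force simp: subgroup.one_closed)+
next
  case (Suc i)
  have Ec: "x \<in> carrier G" if "x \<in> E" for x
    using that E by (meson subgroup.mem_carrier)
  have "(e [^] (p ^ i)) [^] p = \<one>" using Suc Ec by (simp add: nat_pow_pow mult.commute)
  then obtain y where y: "y \<in> E" "e [^] (p ^ i) = y [^] (p ^ m)"
    using div Suc E subgroup_nat_pow_closed by metis
  define w where "w = y [^] (p ^ (m - i))"
  have wE: "w \<in> E" using y E subgroup_nat_pow_closed w_def by auto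
  have wp: "w [^] (p ^ i) = y [^] (p ^ m)"
    using y Ec Suc by (simp add: w_def nat_pow_pow power_add[symmetric])
  have "(e \<otimes> inv w) [^] (p ^ i) = \<one>"
    using y wp wE Ec Suc by (simp add: nat_pow_distrib nat_pow_inv)
  moreover have "e \<otimes> inv w \<in> E" using Suc wE E by (simp add: subgroup.m_closed subgroup.m_inv_closed)
  ultimately obtain z where z: "z \<in> E" "e \<otimes> inv w = z [^] (p ^ (Suc m - i))"
    using Suc by auto
  have "e = z [^] (p ^ (Suc m - i)) \<otimes> w"
    using z Ec Suc wE by (metis inv_closed inv_solve_right nat_pow_closed inv_inv)
  also have "\<dots> = (z [^] p \<otimes> y) [^] (p ^ (m - i))"
    using z y Ec Suc by (simp add: w_def nat_pow_distrib nat_pow_pow Suc_diff_le)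
  finally have "e = (z [^] p \<otimes> y) [^] (p ^ (Suc m - Suc i))" by simp
  moreover have "z [^] p \<otimes> y \<in> E" using z y E subgroup_nat_pow_closed by (simp add: subgroup.m_closed)
  ultimately show ?case by blast
qed

text \<open>The product \<open>D <#> E\<close> is closed under \<open>p\<close>-th roots: after
  dividing off a root taken in \<open>E\<close>, the \<open>p\<close>-th power lies in
  \<open>D\<close> and \<open>soc\<close> applies. Since every element has trivial
  \<open>p ^ Suc m\<close>-th power, repeated extraction of roots reaches the whole group.\<close>

lemma (in comm_group) homocyclic_complement:
  assumes exp: "\<And>x. x \<in> carrier G \<Longrightarrow> x [^] ((p::nat) ^ Suc m) = \<one>"
    and E: "subgroup E G" and D: "subgroup D G" and DE: "D \<inter> E = {\<one>}"
    and div: "\<And>x. x \<in> E \<Longrightarrow> x [^] p = \<one> \<Longrightarrow> \<exists>y\<in>E. x = y [^] (p ^ m)"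
    and soc: "\<And>x. x \<in> carrier G \<Longrightarrow> x [^] p \<in> D \<Longrightarrow> x \<in> D <#> E"
  shows "D <#> E = carrier G"
proof -
  have sub: "subgroup (D <#> E) G" using D E by (rule mult_subgroups)
  have E_le: "E \<subseteq> D <#> E"
    using set_mult_absorbs_right[OF D subgroup.subset[OF E]] .
  have step: "x \<in> D <#> E" if x: "x \<in> carrier G" "x [^] p \<in> D <#> E" for x
  proof -
    obtain d e where de: "x [^] p = d \<otimes> e" "d \<in> D" "e \<in> E"
      using x by (auto simp: set_mult_def)
    have c: "d \<in> carrier G" "e \<in> carrier G" using de D E by (meson subgroup.mem_carrier)+
    \<comment> \<open>Raising \<open>x [^] p = d \<otimes> e\<close> to the power
      \<open>p ^ m\<close> kills the left side, so \<open>e [^] (p ^ m)\<close> lies in both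
      \<open>D\<close> and \<open>E\<close> and is trivial. Divisibility inside \<open>E\<close>
      then gives \<open>e\<close> a \<open>p\<close>-th root there.\<close>
    have "d [^] (p ^ m) \<otimes> e [^] (p ^ m) = \<one>"
      using exp[OF x(1)] de(1) c x by (metis nat_pow_distrib nat_pow_pow power_Suc)
    then have "inv (e [^] (p ^ m)) = d [^] (p ^ m)" using c by (simp add: inv_equality)
    moreover have "inv (e [^] (p ^ m)) \<in> E"
      using de E subgroup_nat_pow_closed by (simp add: subgroup.m_inv_closed)
    moreover have "d [^] (p ^ m) \<in> D"
      using de D subgroup_nat_pow_closed by simp
    ultimately have "inv (e [^] (p ^ m)) \<in> D \<inter> E" by simp
    then have "e [^] (p ^ m) = \<one>" using DE c by simp
    then obtain e' where e': "e' \<in> E" "e = e' [^] p"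
      using homocyclic_divisible[OF E div, of m e] de by auto
    have e'c: "e' \<in> carrier G" using e' E by (meson subgroup.mem_carrier)
    have "(x \<otimes> inv e') [^] p = d"
      using x e'c c de e' by (simp add: nat_pow_distrib nat_pow_inv m_assoc)
    then have "x \<otimes> inv e' \<in> D <#> E" using soc de x e'c by simp
    moreover have "e' \<in> D <#> E" using e' E_le by auto
    ultimately have "(x \<otimes> inv e') \<otimes> e' \<in> D <#> E" using sub by (simp add: subgroup.m_closed)
    then show ?thesis using x e'c by (simp add: m_assoc)
  qed
  have root: "x \<in> D <#> E" if "x \<in> carrier G" "x [^] (p ^ i) \<in> D <#> E" for x i
    using that
  proof (induct i arbitrary: x)
    case (Suc i)
    then have "(x [^] p) [^] (p ^ i) \<in> D <#> E" by (simp add: nat_pow_pow)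
    then have "x [^] p \<in> D <#> E" using Suc.hyps[OF nat_pow_closed[OF Suc.prems(1)]] by metis
    then show ?case by (rule step[OF Suc.prems(1)])
  next
    case 0
    then show ?case by simp
  qed
  have "x \<in> D <#> E" if "x \<in> carrier G" for x
    using root[OF that, of "Suc m"] exp[OF that] sub by (simp add: subgroup.one_closed)
  then have "carrier G \<subseteq> D <#> E" by blast
  then show ?thesis using sub subgroup.subset by blast
qed

section \<open>Transfer and averaging\<close>

lemma (in group) rcosets_translate_bij:
  assumes R: "subgroup R G" and h: "h \<in> carrier G"
  shows "bij_betw (\<lambda>C. C #> h) (rcosets R) (rcosets R)"
proof (rule bij_betw_byWitness[where f' = "\<lambda>C. C #> inv h"])
  have C: "C \<subseteq> carrier G" if "C \<in> rcosets R" for C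
    using that R by (simp add: subgroup.rcosets_carrier)
  show "\<forall>C\<in>rcosets R. (C #> h) #> inv h = C" "\<forall>C\<in>rcosets R. (C #> inv h) #> h = C"
    using C h by (simp_all add: coset_mult_assoc)
  have "C #> g \<in> rcosets R" if "g \<in> carrier G" "C \<in> rcosets R" for C g
    using that R by (auto simp: RCOSETS_def coset_mult_assoc subgroup.subset)
  then show "(\<lambda>C. C #> h) ` (rcosets R) \<subseteq> rcosets R" "(\<lambda>C. C #> inv h) ` (rcosets R) \<subseteq> rcosets R"
    using h by auto
qed

lemma (in group) finprod_rcosets_translate:
  assumes "comm_group A" and R: "subgroup R G" and h: "h \<in> carrier G"
    and f: "f \<in> (rcosets R) \<rightarrow> carrier A"
  shows "finprod A (\<lambda>C. f (C #> h)) (rcosets R) = finprod A f (rcosets R)"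
proof -
  interpret A: comm_group A by fact
  note b = rcosets_translate_bij[OF R h]
  have "finprod A f ((\<lambda>C. C #> h) ` (rcosets R)) = finprod A (\<lambda>C. f (C #> h)) (rcosets R)"
    by (rule A.finprod_reindex) (use b f in \<open>auto simp: bij_betw_def\<close>)
  then show ?thesis using b by (simp add: bij_betw_def)
qed

lemma (in group) rcosets_transversal:
  assumes R: "subgroup R G"
  obtains t where "\<And>C. C \<in> rcosets R \<Longrightarrow> t C \<in> carrier G" "\<And>C. C \<in> rcosets R \<Longrightarrow> R #> t C = C"
proof -
  have "\<forall>C\<in>rcosets R. \<exists>g. g \<in> carrier G \<and> R #> g = C" by (auto simp: RCOSETS_def)
  then show ?thesis using that by metis
qed

lemma (in group) subgroup_comm_group:
  assumes "subgroup S G" "\<And>x y. x \<in> S \<Longrightarrow> y \<in> S \<Longrightarrow> x \<otimes> y = y \<otimes> x"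
  shows "comm_group (G\<lparr>carrier := S\<rparr>)"
  using subgroup_imp_group[OF assms(1)] assms(2) by (intro group.group_comm_groupI) auto

text \<open>This is the transfer into a central subgroup: \<open>\<tau> z\<close> is the product,
  over the right cosets \<open>C\<close> of \<open>P\<close>, of
  \<open>t C \<otimes> z \<otimes> inv (t (C #> z))\<close> for a transversal
  \<open>t\<close>.\<close>

lemma (in group) central_transfer:
  assumes P: "subgroup P G"
    and central: "\<And>u z. u \<in> P \<Longrightarrow> z \<in> carrier G \<Longrightarrow> u \<otimes> z = z \<otimes> u"
  obtains \<tau> where "\<And>z. z \<in> carrier G \<Longrightarrow> \<tau> z \<in> P"
    "\<And>z w. z \<in> carrier G \<Longrightarrow> w \<in> carrier G \<Longrightarrow> \<tau> (z \<otimes> w) = \<tau> z \<otimes> \<tau> w"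
    "\<And>u. u \<in> P \<Longrightarrow> \<tau> u = u [^] card (rcosets P)"
proof -
  have Pc: "x \<in> carrier G" if "x \<in> P" for x using that P by (meson subgroup.mem_carrier)
  interpret PG: comm_group "G\<lparr>carrier := P\<rparr>"
    by (rule subgroup_comm_group[OF P]) (use central Pc in auto)
  obtain t where t: "\<And>C. C \<in> rcosets P \<Longrightarrow> t C \<in> carrier G" "\<And>C. C \<in> rcosets P \<Longrightarrow> P #> t C = C"
    using rcosets_transversal[OF P] by blast
  have closed: "C #> z \<in> rcosets P" if "C \<in> rcosets P" "z \<in> carrier G" for C z
    using rcosets_translate_bij[OF P that(2)] that(1) by (auto simp: bij_betw_def)
  define c where "c z C = t C \<otimes> z \<otimes> inv (t (C #> z))" for z C
  have cP: "c z C \<in> P" if C: "C \<in> rcosets P" and z: "z \<in> carrier G" for z C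
  proof -
    have "P #> (t C \<otimes> z) = C #> z"
      using t[OF C] z P by (metis coset_mult_assoc subgroup.subset)
    also have "\<dots> = P #> t (C #> z)" using t(2)[OF closed[OF C z]] by simp
    finally have "t C \<otimes> z \<in> P #> t (C #> z)"
      using t[OF C] z P by (metis m_closed rcos_self)
    then show ?thesis
      using subgroup.rcos_module_imp[OF P is_group] t(1)[OF closed[OF C z]] by (simp add: c_def)
  qed
  define \<tau> where "\<tau> z = finprod (G\<lparr>carrier := P\<rparr>) (c z) (rcosets P)" for z
  show ?thesis
  proof
    show "\<tau> z \<in> P" if "z \<in> carrier G" for z
      using PG.finprod_closed[of "c z" "rcosets P"] cP that by (auto simp: \<tau>_def)
    show "\<tau> (z \<otimes> w) = \<tau> z \<otimes> \<tau> w" if z: "z \<in> carrier G" and w: "w \<in> carrier G" for z w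
    proof -
      \<comment> \<open>The cocycle identity holds factor by factor. The second family of factors is
        then reindexed along the permutation \<open>C #> z\<close> of the cosets.\<close>
      have "\<tau> (z \<otimes> w) = finprod (G\<lparr>carrier := P\<rparr>) (\<lambda>C. c z C \<otimes> c w (C #> z)) (rcosets P)"
        unfolding \<tau>_def
      proof (rule PG.finprod_cong')
        show "c (z \<otimes> w) C = c z C \<otimes> c w (C #> z)" if C: "C \<in> rcosets P" for C
        proof -
          have C': "C \<subseteq> carrier G" using C P is_group by (simp add: subgroup.rcosets_carrier)
          have eq: "C #> (z \<otimes> w) = C #> z #> w" using z w C' by (simp add: coset_mult_assoc)
          have cc: "t C \<in> carrier G" "t (C #> z) \<in> carrier G" "t (C #> z #> w) \<in> carrier G"
            using t(1) closed C z w by auto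
          have "inv (t (C #> z)) \<otimes> (t (C #> z) \<otimes> y) = y" if "y \<in> carrier G" for y
            using cc that by (simp add: m_assoc[symmetric])
          then show ?thesis using cc z w by (simp add: c_def eq m_assoc)
        qed
      qed (use cP z w closed P in \<open>auto intro!: subgroup.m_closed\<close>)
      also have "\<dots> = \<tau> z \<otimes> finprod (G\<lparr>carrier := P\<rparr>) (\<lambda>C. c w (C #> z)) (rcosets P)"
        unfolding \<tau>_def using PG.finprod_multf[of "c z" "rcosets P" "\<lambda>C. c w (C #> z)"] cP z w closed
        by (auto simp: Pi_def)
      also have "finprod (G\<lparr>carrier := P\<rparr>) (\<lambda>C. c w (C #> z)) (rcosets P) = \<tau> w"
        unfolding \<tau>_def
        by (rule finprod_rcosets_translate[OF PG.comm_group_axioms P z]) (use cP w in auto)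
      finally show ?thesis .
    qed
    show "\<tau> u = u [^] card (rcosets P)" if u: "u \<in> P" for u
    proof -
      \<comment> \<open>A central \<open>u\<close> in \<open>P\<close> fixes every coset, so its
        cocycle is constant.\<close>
      have "c u C = u" if C: "C \<in> rcosets P" for C
      proof -
        have uc: "u \<in> carrier G" using u Pc by auto
        have "C #> u = P #> (t C \<otimes> u)"
          using t[OF C] uc P by (metis coset_mult_assoc subgroup.subset)
        also have "\<dots> = P #> (u \<otimes> t C)" by (simp only: central[OF u t(1)[OF C]])
        also have "\<dots> = P #> u #> t C"
          using t[OF C] uc P by (metis coset_mult_assoc subgroup.subset)
        also have "P #> u = P" using u P uc by (simp add: coset_join2)
        finally have "C #> u = C" using t(2)[OF C] by simp
        then have "c u C = (u \<otimes> t C) \<otimes> inv (t C)"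
          by (simp only: c_def central[OF u t(1)[OF C]])
        then show ?thesis using t(1)[OF C] uc by (simp add: m_assoc)
      qed
      then have "\<tau> u = finprod (G\<lparr>carrier := P\<rparr>) (\<lambda>C. u) (rcosets P)"
        unfolding \<tau>_def by (intro PG.finprod_cong') (use u in auto)
      also have "\<dots> = u [^] card (rcosets P)"
        using PG.finprod_const[of u "rcosets P"] u by (simp add: nat_pow_consistent[symmetric])
      finally show ?thesis .
    qed
  qed
qed

text \<open>The set is the kernel of the transfer into \<open>P\<close>. If
  \<open>\<tau> z = \<one>\<close>, then \<open>z [^] n\<close> is killed by the index of
  \<open>P\<close> and by \<open>q\<close>; conversely, if \<open>z [^] n = \<one>\<close>, then
  \<open>\<tau> z\<close> is killed by \<open>n\<close> and by \<open>q\<close>. A trivial kernel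
  makes the transfer an embedding into \<open>P\<close>.\<close>

lemma (in group) central_coprime_index:
  assumes fin: "finite (carrier G)" and P: "subgroup P G"
    and central: "\<And>u z. u \<in> P \<Longrightarrow> z \<in> carrier G \<Longrightarrow> u \<otimes> z = z \<otimes> u"
    and q: "\<And>u. u \<in> P \<Longrightarrow> u [^] (q::nat) = \<one>" and cop: "coprime (card (rcosets P)) q"
    and n: "\<And>z. z \<in> carrier G \<Longrightarrow> z [^] (n::nat) \<in> P" and nq: "coprime n q"
  shows "subgroup {z \<in> carrier G. z [^] n = \<one>} G" (is ?sub)
    and "{z \<in> carrier G. z [^] n = \<one>} = {\<one>} \<Longrightarrow> carrier G = P"
proof -
  have Pc: "x \<in> carrier G" if "x \<in> P" for x using that P by (meson subgroup.mem_carrier)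
  obtain \<tau> where tP: "\<And>z. z \<in> carrier G \<Longrightarrow> \<tau> z \<in> P"
    and tm: "\<And>z w. z \<in> carrier G \<Longrightarrow> w \<in> carrier G \<Longrightarrow> \<tau> (z \<otimes> w) = \<tau> z \<otimes> \<tau> w"
    and tu: "\<And>u. u \<in> P \<Longrightarrow> \<tau> u = u [^] card (rcosets P)"
    using central_transfer[OF P central] by blast
  interpret t: group_hom G G \<tau>
    by unfold_locales (use tP tm Pc in \<open>auto simp: hom_def\<close>)
  have ker: "kernel G G \<tau> = {z \<in> carrier G. z [^] n = \<one>}"
  proof (intro subset_antisym subsetI)
    fix z assume z: "z \<in> kernel G G \<tau>"
    then have zc: "z \<in> carrier G" "\<tau> z = \<one>" by (auto simp: kernel_def)
    have zn: "z [^] n \<in> P" using n zc by auto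
    have "\<tau> (z [^] n) = \<one>" using zc by (simp add: t.hom_nat_pow)
    then have "(z [^] n) [^] card (rcosets P) = \<one>" using tu zn by simp
    then have "z [^] n = \<one>" using coprime_pow_eq_one[of "z [^] n"] q[OF zn] cop zc by auto
    then show "z \<in> {z \<in> carrier G. z [^] n = \<one>}" using zc by auto
  next
    fix z assume z: "z \<in> {z \<in> carrier G. z [^] n = \<one>}"
    then have "\<tau> z [^] n = \<one>" by (simp add: t.hom_nat_pow[symmetric])
    then have "\<tau> z = \<one>" using coprime_pow_eq_one[of "\<tau> z" n q] z q[OF tP] nq by auto
    then show "z \<in> kernel G G \<tau>" using z by (auto simp: kernel_def)
  qed
  show ?sub using t.subgroup_kernel ker by simp
  assume "{z \<in> carrier G. z [^] n = \<one>} = {\<one>}"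
  then have inj: "inj_on \<tau> (carrier G)" using t.trivial_ker_imp_inj ker by simp
  have "card (carrier G) \<le> card P"
    using card_inj_on_le[OF inj] tP fin P by (meson finite_subset image_subsetI subgroup.subset)
  then show "carrier G = P"
    using P fin by (metis card_seteq subgroup.subset)
qed

text \<open>If \<open>p\<close> divided the index, Sylow's theorem with exponent 1, that is Cauchy's
  theorem, would give \<open>G Mod P\<close> a nontrivial element killed by \<open>p\<close>; it is
  also killed by \<open>n\<close>, which is prime to \<open>p\<close>.\<close>

lemma (in group) coprime_index_of_pow_mem:
  assumes fin: "finite (carrier G)" and P: "P \<lhd> G" and p: "Factorial_Ring.prime (p::nat)"
    and n: "\<And>z. z \<in> carrier G \<Longrightarrow> z [^] (n::nat) \<in> P" and np: "\<not> p dvd n"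
  shows "\<not> p dvd card (rcosets P)"
proof
  assume "p dvd card (rcosets P)"
  then obtain m where m: "order (G Mod P) = p ^ 1 * m"
    by (auto simp: order_def FactGroup_def)
  interpret P: normal P G by fact
  interpret Q: group "G Mod P" by (rule P.factorgroup_is_group)
  have finQ: "finite (carrier (G Mod P))" using fin by (simp add: carrier_FactGroup)
  obtain T where T: "subgroup T (G Mod P)" "card T = p ^ 1"
    using sylow_thm[OF p Q.is_group m finQ] by auto
  have "card T > 1" using T p prime_gt_1_nat by simp
  then obtain x where x: "x \<in> T" "x \<noteq> \<one>\<^bsub>G Mod P\<^esub>"
    by (metis One_nat_def card.empty card_insert_disjoint card_mono empty_iff finite.emptyI
        finite_insert insertI1 leD subsetI)
  have xc: "x \<in> carrier (G Mod P)" using x T subgroup.mem_carrier by metis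
  interpret T: group "(G Mod P)\<lparr>carrier := T\<rparr>" using T Q.subgroup_imp_group by simp
  have "x [^]\<^bsub>(G Mod P)\<lparr>carrier := T\<rparr>\<^esub> order ((G Mod P)\<lparr>carrier := T\<rparr>) = \<one>\<^bsub>(G Mod P)\<lparr>carrier := T\<rparr>\<^esub>"
    by (rule T.pow_order_eq_1) (use x in auto)
  then have "x [^]\<^bsub>G Mod P\<^esub> p = \<one>\<^bsub>G Mod P\<^esub>"
    using T by (simp add: order_def Q.nat_pow_consistent[symmetric])
  moreover have "x [^]\<^bsub>G Mod P\<^esub> n = \<one>\<^bsub>G Mod P\<^esub>"
  proof -
    obtain g where g: "g \<in> carrier G" "x = P #> g" using xc by (auto simp: carrier_FactGroup)
    then have "x [^]\<^bsub>G Mod P\<^esub> n = P #> (g [^] n)" using P.FactGroup_pow by simp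
    also have "\<dots> = P" using n[OF g(1)] g P.subgroup_axioms by (simp add: coset_join2)
    finally show ?thesis by simp
  qed
  moreover have "coprime p n" using p np by (rule prime_imp_coprime)
  ultimately show False using Q.coprime_pow_eq_one xc x by blast
qed

section \<open>Averaging a projection over cosets\<close>

text \<open>Maschke's argument: the projection onto \<open>S\<close> along \<open>L\<close> is averaged over the cosets of the
  subgroup \<open>R\<close>, which acts trivially on \<open>M\<close>; the kernel of the average is the normal complement.\<close>

lemma (in group) normal_complement_of_complement:
  assumes fin: "finite (carrier G)" and M: "M \<lhd> G"
    and comm: "\<And>x y. x \<in> M \<Longrightarrow> y \<in> M \<Longrightarrow> x \<otimes> y = y \<otimes> x"
    and R: "R \<lhd> G" and cent: "\<And>r x. r \<in> R \<Longrightarrow> x \<in> M \<Longrightarrow> r \<otimes> x = x \<otimes> r"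
    and S: "S \<lhd> G" and L: "subgroup L G" and LS: "L \<inter> S = {\<one>}" "L <#> S = M"
    and q: "\<And>x. x \<in> S \<Longrightarrow> x [^] (q::nat) = \<one>" and cop: "coprime (card (rcosets R)) q"
  obtains E where "E \<lhd> G" "E \<inter> S = {\<one>}" "E <#> S = M" "\<And>D. D \<lhd> G \<Longrightarrow> D \<subseteq> L \<Longrightarrow> D \<subseteq> E"
proof -
  interpret M: normal M G by fact
  interpret R: normal R G by fact
  interpret S: normal S G by fact
  interpret L: subgroup L G by fact
  have LM: "L \<subseteq> M" using set_mult_absorbs_left[OF L.subset S.subgroup_axioms] LS(2) by simp
  have SM: "S \<subseteq> M" using set_mult_absorbs_right[OF L S.subset] LS(2) by simp
  interpret SG: comm_group "G\<lparr>carrier := S\<rparr>"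
    by (rule subgroup_comm_group[OF S.subgroup_axioms]) (use comm SM in auto)
  have "\<forall>x\<in>M. \<exists>s. s \<in> S \<and> (\<exists>l\<in>L. x = l \<otimes> s)" using LS(2) unfolding set_mult_def by auto
  \<comment> \<open>The map \<open>\<theta>\<close> is the projection of \<open>M\<close> onto
    \<open>S\<close> along \<open>L\<close>. It is unique because \<open>L\<close> and
    \<open>S\<close> meet trivially, and multiplicative because \<open>M\<close> is abelian.\<close>
  then obtain \<theta> where \<theta>: "\<And>x. x \<in> M \<Longrightarrow> \<theta> x \<in> S" "\<And>x. x \<in> M \<Longrightarrow> \<exists>l\<in>L. x = l \<otimes> \<theta> x"
    by metis
  have \<theta>_eq: "\<theta> x = s" if x: "x = l \<otimes> s" and l: "l \<in> L" and s: "s \<in> S" for x l s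
  proof -
    have "x \<in> M" using x l s LM SM by auto
    then obtain l' where l': "l' \<in> L" "x = l' \<otimes> \<theta> x" and sx: "\<theta> x \<in> S" using \<theta>(1) \<theta>(2)[of x] by blast
    have "inv a \<otimes> b = d \<otimes> inv e"
      if "b \<otimes> e = a \<otimes> d" "a \<in> carrier G" "b \<in> carrier G" "d \<in> carrier G" "e \<in> carrier G" for a b d e
      using that by (metis inv_closed inv_solve_left inv_solve_right m_assoc m_closed)
    from this[of l s l' "\<theta> x"] have "inv l' \<otimes> l = \<theta> x \<otimes> inv s"
      using x l l' s sx by simp
    moreover have "inv l' \<otimes> l \<in> L" using l l' by simp
    moreover have "\<theta> x \<otimes> inv s \<in> S" using s sx by simp
    ultimately have "\<theta> x \<otimes> inv s = \<one>" using LS(1) by auto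
    then show ?thesis using s sx by (metis S.mem_carrier inv_equality inv_inv inv_closed)
  qed
  have \<theta>_mult: "\<theta> (x \<otimes> y) = \<theta> x \<otimes> \<theta> y" if "x \<in> M" "y \<in> M" for x y
  proof -
    obtain l l' where l: "l \<in> L" "x = l \<otimes> \<theta> x" "l' \<in> L" "y = l' \<otimes> \<theta> y" using \<theta>(2)[OF \<open>x \<in> M\<close>] \<theta>(2)[OF \<open>y \<in> M\<close>] by blast
    have s: "\<theta> x \<in> S" "\<theta> y \<in> S" using \<theta>(1) that by auto
    have "(l \<otimes> \<theta> x) \<otimes> (l' \<otimes> \<theta> y) = l \<otimes> (\<theta> x \<otimes> l') \<otimes> \<theta> y"
      using l(1,3) s by (simp add: m_assoc)
    then have "x \<otimes> y = l \<otimes> (\<theta> x \<otimes> l') \<otimes> \<theta> y"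
      by (simp only: l(2,4)[symmetric])
    also have "\<theta> x \<otimes> l' = l' \<otimes> \<theta> x" using comm l s LM SM by blast
    also have "l \<otimes> (l' \<otimes> \<theta> x) \<otimes> \<theta> y = (l \<otimes> l') \<otimes> (\<theta> x \<otimes> \<theta> y)"
      using l(1,3) s by (simp add: m_assoc)
    finally show ?thesis by (rule \<theta>_eq) (use l(1,3) s in auto)
  qed
  have \<theta>_S: "\<theta> s = s" if "s \<in> S" for s
    using \<theta>_eq[of s \<one> s] that by simp
  have \<theta>_L: "\<theta> l = \<one>" if "l \<in> L" for l
    using \<theta>_eq[of l l \<one>] that by simp
  obtain t where t: "\<And>C. C \<in> rcosets R \<Longrightarrow> t C \<in> carrier G" "\<And>C. C \<in> rcosets R \<Longrightarrow> R #> t C = C"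
    using rcosets_transversal[OF R.subgroup_axioms] by blast
  have closed: "C #> z \<in> rcosets R" if "C \<in> rcosets R" "z \<in> carrier G" for C z
    using rcosets_translate_bij[OF R.subgroup_axioms that(2)] that(1) by (auto simp: bij_betw_def)
  \<comment> \<open>The projection conjugated by \<open>g\<close>; its values stay in
    \<open>S\<close> because \<open>S\<close> is normal.\<close>
  define c where "c g x = inv g \<otimes> \<theta> (g \<otimes> x \<otimes> inv g) \<otimes> g" for g x
  have conjM: "g \<otimes> x \<otimes> inv g \<in> M" if "g \<in> carrier G" "x \<in> M" for g x
    using that M.inv_op_closed2 by auto
  have cS: "c g x \<in> S" if "g \<in> carrier G" "x \<in> M" for g x
    using that \<theta>(1)[OF conjM] S.inv_op_closed1 by (auto simp: c_def)
  have c_mult: "c g (x \<otimes> y) = c g x \<otimes> c g y" if g: "g \<in> carrier G" and x: "x \<in> M" and y: "y \<in> M" for g x y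
  proof -
    have xc: "x \<in> carrier G" "y \<in> carrier G" using x y by auto
    have "g \<otimes> (x \<otimes> y) \<otimes> inv g = (g \<otimes> x \<otimes> inv g) \<otimes> (g \<otimes> y \<otimes> inv g)"
      using g xc by (simp add: m_assoc inv_solve_left)
    then have "\<theta> (g \<otimes> (x \<otimes> y) \<otimes> inv g) = \<theta> (g \<otimes> x \<otimes> inv g) \<otimes> \<theta> (g \<otimes> y \<otimes> inv g)"
      using \<theta>_mult conjM g x y by simp
    moreover have "\<theta> (g \<otimes> x \<otimes> inv g) \<in> carrier G" "\<theta> (g \<otimes> y \<otimes> inv g) \<in> carrier G"
      using \<theta>(1) conjM g x y by auto
    moreover have "g \<otimes> (inv g \<otimes> z) = z" if "z \<in> carrier G" for z
      using g that by (simp add: m_assoc[symmetric])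
    ultimately show ?thesis using g by (simp add: c_def m_assoc)
  qed
  \<comment> \<open>Since \<open>R\<close> centralises \<open>M\<close>, the conjugated projection
    depends only on the coset of \<open>g\<close>, so that the product below does not depend on the
    transversal.\<close>
  have c_coset: "c g x = c g' x"
    if g: "g \<in> carrier G" "g' \<in> carrier G" "R #> g = R #> g'" and x: "x \<in> M" for g g' x
  proof -
    have "g \<in> R #> g'" using g rcos_self[of g R] R.subgroup_axioms by metis
    then obtain r where r: "r \<in> R" "g = r \<otimes> g'" by (auto simp: r_coset_def)
    define y where "y = g' \<otimes> x \<otimes> inv g'"
    have y: "y \<in> M" using conjM g x y_def by auto
    have rc: "r \<in> carrier G" using r by auto
    have swap: "r \<otimes> z \<otimes> inv r = z" "inv r \<otimes> z \<otimes> r = z" if "z \<in> M" for z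
      using cent[OF r(1) that] cent[of "inv r" z] r that rc by (simp_all add: m_assoc)
    have "g \<otimes> x \<otimes> inv g = r \<otimes> y \<otimes> inv r"
      using r rc g x by (simp add: y_def m_assoc inv_mult_group)
    then have e: "g \<otimes> x \<otimes> inv g = y" using swap y by simp
    have z: "\<theta> y \<in> M" using \<theta>(1)[OF y] SM by auto
    have "c g x = inv g' \<otimes> (inv r \<otimes> \<theta> y \<otimes> r) \<otimes> g'"
      unfolding c_def e using r rc g z by (simp add: m_assoc inv_mult_group)
    then show ?thesis using swap z by (simp add: c_def y_def)
  qed
  have c_conj: "c g (h \<otimes> x \<otimes> inv h) = h \<otimes> c (g \<otimes> h) x \<otimes> inv h"
    if g: "g \<in> carrier G" and h: "h \<in> carrier G" and x: "x \<in> M" for g h x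
  proof -
    have xc: "x \<in> carrier G" using x by auto
    have e: "g \<otimes> (h \<otimes> x \<otimes> inv h) \<otimes> inv g = (g \<otimes> h) \<otimes> x \<otimes> inv (g \<otimes> h)"
      using g h xc by (simp add: m_assoc inv_mult_group)
    define z where "z = \<theta> ((g \<otimes> h) \<otimes> x \<otimes> inv (g \<otimes> h))"
    have z: "z \<in> carrier G" using \<theta>(1) conjM[of "g \<otimes> h" x] g h x by (simp add: z_def)
    have a: "h \<otimes> (inv h \<otimes> w) = w" if "w \<in> carrier G" for w
      using h that by (simp add: m_assoc[symmetric])
    show ?thesis unfolding c_def e z_def[symmetric]
      using g h z a by (simp add: m_assoc inv_mult_group)
  qed
  \<comment> \<open>The average before division by the number of cosets. On \<open>S\<close> it is
    the power map with exponent \<open>card (rcosets R)\<close> instead of the identity; coprimality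
    to \<open>q\<close> makes this map invertible.\<close>
  define \<tau> where "\<tau> x = finprod (G\<lparr>carrier := S\<rparr>) (\<lambda>C. c (t C) x) (rcosets R)" for x
  have \<tau>S: "\<tau> x \<in> S" if "x \<in> M" for x
    using SG.finprod_closed[of "\<lambda>C. c (t C) x" "rcosets R"] cS t that by (auto simp: \<tau>_def)
  have \<tau>_mult: "\<tau> (x \<otimes> y) = \<tau> x \<otimes> \<tau> y" if x: "x \<in> M" and y: "y \<in> M" for x y
  proof -
    have "\<tau> (x \<otimes> y) = finprod (G\<lparr>carrier := S\<rparr>) (\<lambda>C. c (t C) x \<otimes> c (t C) y) (rcosets R)"
      unfolding \<tau>_def by (rule SG.finprod_cong') (use x y c_mult cS t in auto)
    then show ?thesis
      unfolding \<tau>_def using SG.finprod_multf[of "\<lambda>C. c (t C) x" "rcosets R" "\<lambda>C. c (t C) y"] cS t x y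
      by (simp add: Pi_def)
  qed
  have \<tau>_S: "\<tau> s = s [^] card (rcosets R)" if s: "s \<in> S" for s
  proof -
    have "c g s = s" if g: "g \<in> carrier G" for g
    proof -
      have "g \<otimes> s \<otimes> inv g \<in> S" using g s S.inv_op_closed2 by auto
      moreover have "inv g \<otimes> (g \<otimes> w) = w" if "w \<in> carrier G" for w
        using g that by (simp add: m_assoc[symmetric])
      ultimately show ?thesis using g s by (simp add: c_def \<theta>_S m_assoc)
    qed
    then have "\<tau> s = finprod (G\<lparr>carrier := S\<rparr>) (\<lambda>C. s) (rcosets R)"
      unfolding \<tau>_def by (intro SG.finprod_cong') (use s t in auto)
    also have "\<dots> = s [^] card (rcosets R)"
      using SG.finprod_const[of s "rcosets R"] s by (simp add: nat_pow_consistent[symmetric])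
    finally show ?thesis .
  qed
  have prod_conj: "finprod (G\<lparr>carrier := S\<rparr>) (\<lambda>C. h \<otimes> f C \<otimes> inv h) A = h \<otimes> finprod (G\<lparr>carrier := S\<rparr>) f A \<otimes> inv h"
    if h: "h \<in> carrier G" and "finite A" and "f \<in> A \<rightarrow> S" for h A and f :: "'a set \<Rightarrow> 'a"
    using that(2,3)
  proof (induct A rule: finite_induct)
    case empty
    then show ?case using h by simp
  next
    case (insert a A)
    have fa: "f a \<in> S" and fA: "f \<in> A \<rightarrow> S" using insert by auto
    have fp: "finprod (G\<lparr>carrier := S\<rparr>) f A \<in> S"
      using SG.finprod_closed[of f A] fA by auto
    have hS: "h \<otimes> s \<otimes> inv h \<in> S" if "s \<in> S" for s using that h S.inv_op_closed2 by auto
    have i: "inv h \<otimes> (h \<otimes> w) = w" if "w \<in> carrier G" for w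
      using h that by (simp add: m_assoc[symmetric])
    have "finprod (G\<lparr>carrier := S\<rparr>) (\<lambda>C. h \<otimes> f C \<otimes> inv h) (insert a A)
        = (h \<otimes> f a \<otimes> inv h) \<otimes> finprod (G\<lparr>carrier := S\<rparr>) (\<lambda>C. h \<otimes> f C \<otimes> inv h) A"
      using SG.finprod_insert[of A a "\<lambda>C. h \<otimes> f C \<otimes> inv h"] insert(1,2) fa fA hS by (auto simp: Pi_def)
    also have "\<dots> = (h \<otimes> f a \<otimes> inv h) \<otimes> (h \<otimes> finprod (G\<lparr>carrier := S\<rparr>) f A \<otimes> inv h)"
      using insert(3)[OF fA] by simp
    also have "\<dots> = h \<otimes> (f a \<otimes> finprod (G\<lparr>carrier := S\<rparr>) f A) \<otimes> inv h"
      using h fa fp i by (simp add: m_assoc)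
    also have "f a \<otimes> finprod (G\<lparr>carrier := S\<rparr>) f A = finprod (G\<lparr>carrier := S\<rparr>) f (insert a A)"
      using SG.finprod_insert[of A a f] insert(1,2) fa fA by (auto simp: Pi_def)
    finally show ?case .
  qed
  have finR: "finite (rcosets R)" using fin by (simp add: RCOSETS_def)
  \<comment> \<open>Translation by \<open>h\<close> permutes the cosets, so \<open>\<tau>\<close>
    commutes with conjugation, and its kernel will be normal in \<open>G\<close>.\<close>
  have \<tau>_conj: "\<tau> (h \<otimes> x \<otimes> inv h) = h \<otimes> \<tau> x \<otimes> inv h" if h: "h \<in> carrier G" and x: "x \<in> M" for h x
  proof -
    have "c (t C) (h \<otimes> x \<otimes> inv h) = h \<otimes> c (t (C #> h)) x \<otimes> inv h" if C: "C \<in> rcosets R" for C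
    proof -
      have "R #> (t C \<otimes> h) = C #> h" using t[OF C] h R.subset by (metis coset_mult_assoc)
      also have "\<dots> = R #> t (C #> h)" using t(2)[OF closed[OF C h]] by simp
      finally show ?thesis using c_conj[OF t(1)[OF C] h x] c_coset[of "t C \<otimes> h" "t (C #> h)" x] t(1)[OF C] h x
        t(1)[OF closed[OF C h]] by simp
    qed
    then have "\<tau> (h \<otimes> x \<otimes> inv h) = finprod (G\<lparr>carrier := S\<rparr>) (\<lambda>C. h \<otimes> c (t (C #> h)) x \<otimes> inv h) (rcosets R)"
      unfolding \<tau>_def
      by (intro SG.finprod_cong') (use cS t h x closed S.inv_op_closed2 in auto)
    also have "\<dots> = h \<otimes> finprod (G\<lparr>carrier := S\<rparr>) (\<lambda>C. c (t (C #> h)) x) (rcosets R) \<otimes> inv h"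
      by (rule prod_conj[OF h finR]) (use cS t h x closed in auto)
    also have "finprod (G\<lparr>carrier := S\<rparr>) (\<lambda>C. c (t (C #> h)) x) (rcosets R) = \<tau> x"
      unfolding \<tau>_def
      by (rule finprod_rcosets_translate[OF SG.comm_group_axioms R.subgroup_axioms h]) (use cS t x in auto)
    finally show ?thesis .
  qed
  define E where "E = {x \<in> M. \<tau> x = \<one>}"
  have \<tau>_one: "\<tau> \<one> = \<one>" using \<tau>_S[of \<one>] by simp
  have \<tau>_inv: "\<tau> (inv x) = inv (\<tau> x)" if x: "x \<in> M" for x
  proof -
    have "\<tau> (inv x) \<otimes> \<tau> x = \<one>" using \<tau>_mult[of "inv x" x] x \<tau>_one by simp
    then show ?thesis using \<tau>S x by (metis M.m_inv_closed S.mem_carrier inv_equality)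
  qed
  have Esub: "subgroup E G"
    by (rule subgroupI) (use \<tau>_one \<tau>_inv \<tau>_mult in \<open>auto simp: E_def intro!: exI[of _ \<one>]\<close>)
  have EN: "E \<lhd> G"
    unfolding normal_inv_iff using Esub \<tau>_conj conjM by (auto simp: E_def)
  have ES: "E \<inter> S = {\<one>}"
  proof -
    have "x = \<one>" if "x \<in> E" "x \<in> S" for x
      using coprime_pow_eq_one[of x "card (rcosets R)" q] that \<tau>_S q cop by (auto simp: E_def)
    then show ?thesis using Esub subgroup.one_closed by fastforce
  qed
  have "M \<subseteq> E <#> S"
  proof
    fix x assume x: "x \<in> M"
    let ?k = "card (rcosets R)"
    \<comment> \<open>By coprimality \<open>\<tau> x\<close> has a \<open>?k\<close>-th root
      \<open>s\<close> in \<open>S\<close>. Then \<open>\<tau> s = \<tau> x\<close>, and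
      \<open>x \<otimes> inv s\<close> lies in the kernel \<open>E\<close>.\<close>
    let ?T = "{y \<in> S. \<exists>s\<in>S. y = s [^] ?k}"
    have dist: "(s \<otimes> s') [^] ?k = s [^] ?k \<otimes> s' [^] ?k" if "s \<in> S" "s' \<in> S" for s s'
    proof (rule pow_mult_distrib)
      show "s \<otimes> s' = s' \<otimes> s" using that comm SM by blast
    qed (use that in auto)
    have "subgroup ?T G"
    proof (rule subgroupI)
      show "?T \<noteq> {}" using S.one_closed by (auto intro!: exI[of _ \<one>] bexI[of _ \<one>])
      show "inv y \<in> ?T" if "y \<in> ?T" for y
      proof -
        obtain s where "y \<in> S" "s \<in> S" "y = s [^] ?k" using \<open>y \<in> ?T\<close> by auto
        then show ?thesis by (auto simp: nat_pow_inv intro!: bexI[of _ "inv s"])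
      qed
      show "y \<otimes> z \<in> ?T" if "y \<in> ?T" "z \<in> ?T" for y z
      proof -
        obtain s s' where "y \<in> S" "s \<in> S" "y = s [^] ?k" "z \<in> S" "s' \<in> S" "z = s' [^] ?k"
          using \<open>y \<in> ?T\<close> \<open>z \<in> ?T\<close> by auto
        then show ?thesis by (auto simp: dist intro!: bexI[of _ "s \<otimes> s'"])
      qed
    qed auto
    moreover have "\<tau> x [^] ?k \<in> ?T"
      using \<tau>S[OF x] subgroup_nat_pow_closed[OF S.subgroup_axioms] by auto
    moreover have "\<tau> x [^] q \<in> ?T"
      using \<tau>S[OF x] q by (auto intro!: bexI[of _ \<one>])
    ultimately have "\<tau> x \<in> ?T"
      using subgroup_coprime_pow[of ?T "\<tau> x" ?k q] \<tau>S[OF x] cop by auto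
    then obtain s where s: "s \<in> S" "\<tau> x = s [^] ?k" by auto
    have sM: "s \<in> M" using s SM by auto
    have "\<tau> (x \<otimes> inv s) = \<tau> x \<otimes> inv (\<tau> s)"
      using \<tau>_mult[of x "inv s"] \<tau>_inv x sM by simp
    also have "\<dots> = \<one>" using \<tau>_S s \<tau>S[OF x] by simp
    finally have "x \<otimes> inv s \<in> E" using x sM by (simp add: E_def)
    moreover have "x = (x \<otimes> inv s) \<otimes> s" using x sM by (simp add: m_assoc)
    ultimately show "x \<in> E <#> S" using s unfolding set_mult_def by blast
  qed
  moreover have "E <#> S \<subseteq> M" using SM unfolding E_def set_mult_def by auto
  ultimately have EM: "E <#> S = M" by blast
  \<comment> \<open>All conjugates of an element of \<open>D\<close> stay in \<open>L\<close>, so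
    every conjugated projection kills it.\<close>
  have "D \<subseteq> E" if D: "D \<lhd> G" "D \<subseteq> L" for D
  proof
    fix x assume x: "x \<in> D"
    have xM: "x \<in> M" using x D LM by auto
    have "c g x = \<one>" if g: "g \<in> carrier G" for g
    proof -
      have "g \<otimes> x \<otimes> inv g \<in> L" using normal.inv_op_closed2[OF D(1) g x] D(2) by auto
      then show ?thesis using g \<theta>_L by (simp add: c_def)
    qed
    then have "\<tau> x = \<one>" unfolding \<tau>_def using SG.finprod_one_eqI[of "rcosets R" "\<lambda>C. c (t C) x"] t by simp
    then show "x \<in> E" using xM by (simp add: E_def)
  qed
  then show ?thesis using that[OF EN ES EM] by blast
qed

section \<open>The socle of an indecomposable normal subgroup\<close>

lemma (in group) set_mult_one_left: "B \<subseteq> carrier G \<Longrightarrow> {\<one>} <#> B = B"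
  using set_mult_absorbs_right[OF triv_subgroup, of B] by (auto simp: set_mult_def subset_iff)

lemma (in group) set_mult_one_right: "B \<subseteq> carrier G \<Longrightarrow> B <#> {\<one>} = B"
  using set_mult_absorbs_left[OF _ triv_subgroup, of B] by (auto simp: set_mult_def subset_iff)

text \<open>Linear algebra modulo \<open>D\<close> gives a complement \<open>L\<close> of
  \<open>S\<close> in \<open>M\<close> above \<open>D\<close>, and averaging over the cosets of
  \<open>R\<close> turns it into a normal one. The subgroup \<open>D\<close> survives the averaging
  because it is normal and contained in \<open>L\<close>.\<close>

lemma (in group) normal_complement_mod_p:
  assumes fin: "finite (carrier G)" and p: "Factorial_Ring.prime (p::nat)" and M: "M \<lhd> G"
    and comm: "\<And>x y. x \<in> M \<Longrightarrow> y \<in> M \<Longrightarrow> x \<otimes> y = y \<otimes> x"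
    and R: "R \<lhd> G" and cent: "\<And>r x. r \<in> R \<Longrightarrow> x \<in> M \<Longrightarrow> r \<otimes> x = x \<otimes> r"
    and ndvd: "\<not> p dvd card (rcosets R)"
    and S: "S \<lhd> G" "S \<subseteq> M" and D: "D \<lhd> G" "D \<subseteq> M" and DS: "D \<inter> S = {\<one>}"
    and pow: "\<And>x. x \<in> M \<Longrightarrow> x [^] p \<in> D"
  obtains E where "E \<lhd> G" "D \<subseteq> E" "E \<inter> S = {\<one>}" "E <#> S = M"
proof -
  have Msub: "subgroup M G" and Ssub: "subgroup S G" and Dsub: "subgroup D G"
    using M S D normal_imp_subgroup by auto
  interpret MG: comm_group "G\<lparr>carrier := M\<rparr>"
    by (rule subgroup_comm_group[OF Msub]) (use comm in auto)
  have finM: "finite M" using fin Msub by (meson finite_subset subgroup.subset)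
  obtain L where L: "subgroup L (G\<lparr>carrier := M\<rparr>)" "D \<subseteq> L" "L \<inter> S = {\<one>}" "L <#> S = M"
    using MG.complement_of_mod_p[of p S D] finM p subgroup_incl[OF Ssub Msub S(2)]
      subgroup_incl[OF Dsub Msub D(2)] DS pow by (auto simp: nat_pow_consistent[symmetric])
  have q: "x [^] p = \<one>" if "x \<in> S" for x
    using pow[of x] that S(2) DS subgroup_nat_pow_closed[OF Ssub that, of p] by auto
  have cop: "coprime (card (rcosets R)) p"
    using p ndvd by (metis prime_imp_coprime coprime_commute)
  show ?thesis
    using normal_complement_of_complement[OF fin M comm R cent S(1) incl_subgroup[OF Msub L(1)] L(3,4) q cop]
      that D(1) L(2) by metis
qed

lemma (in group) conjugation_pow:
  assumes g: "g \<in> carrier G" and x: "x \<in> carrier G"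
  shows "(g \<otimes> x \<otimes> inv g) [^] (k::nat) = g \<otimes> x [^] k \<otimes> inv g"
proof (induct k)
  case 0
  then show ?case using g by simp
next
  case (Suc k)
  have "inv g \<otimes> (g \<otimes> y) = y" if "y \<in> carrier G" for y
    using g that by (simp add: m_assoc[symmetric])
  then show ?case using Suc g x by (simp add: m_assoc)
qed

lemma (in group) normal_pow_preimage:
  assumes C: "C \<lhd> G" and comm: "\<And>x y. x \<in> C \<Longrightarrow> y \<in> C \<Longrightarrow> x \<otimes> y = y \<otimes> x" and D: "D \<lhd> G"
  shows "{x \<in> C. x [^] (k::nat) \<in> D} \<lhd> G"
proof -
  interpret C: normal C G by fact
  interpret D: normal D G by fact
  have dist: "(x \<otimes> y) [^] k = x [^] k \<otimes> y [^] k" if "x \<in> C" "y \<in> C" for x y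
  proof (rule pow_mult_distrib)
    show "x \<otimes> y = y \<otimes> x" using that by (rule comm)
  qed (use that in auto)
  have conj: "(g \<otimes> x \<otimes> inv g) [^] k = g \<otimes> x [^] k \<otimes> inv g" if "g \<in> carrier G" "x \<in> carrier G" for g x
    by (rule conjugation_pow) (use that in auto)
  show ?thesis
    unfolding normal_inv_iff
  proof (intro conjI ballI)
    show "subgroup {x \<in> C. x [^] k \<in> D} G"
      by (rule subgroupI) (auto simp: dist nat_pow_inv intro!: exI[of _ \<one>])
    show "g \<otimes> x \<otimes> inv g \<in> {x \<in> C. x [^] k \<in> D}" if "g \<in> carrier G" "x \<in> {x \<in> C. x [^] k \<in> D}" for g x
      using that C.inv_op_closed2 D.inv_op_closed2 conj by auto
  qed
qed

lemma (in group) normal_pow_image: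
  assumes C: "C \<lhd> G" and comm: "\<And>x y. x \<in> C \<Longrightarrow> y \<in> C \<Longrightarrow> x \<otimes> y = y \<otimes> x"
  shows "(\<lambda>x. x [^] (k::nat)) ` C \<lhd> G"
proof -
  interpret C: normal C G by fact
  have dist: "(x \<otimes> y) [^] k = x [^] k \<otimes> y [^] k" if "x \<in> C" "y \<in> C" for x y
  proof (rule pow_mult_distrib)
    show "x \<otimes> y = y \<otimes> x" using that by (rule comm)
  qed (use that in auto)
  have conj: "(g \<otimes> x \<otimes> inv g) [^] k = g \<otimes> x [^] k \<otimes> inv g" if "g \<in> carrier G" "x \<in> carrier G" for g x
    by (rule conjugation_pow) (use that in auto)
  show ?thesis
    unfolding normal_inv_iff
  proof (intro conjI ballI)
    show "subgroup ((\<lambda>x. x [^] k) ` C) G"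
    proof (rule subgroupI)
      show "inv y \<in> (\<lambda>x. x [^] k) ` C" if "y \<in> (\<lambda>x. x [^] k) ` C" for y
        using that by (auto simp: nat_pow_inv[symmetric])
      show "y \<otimes> z \<in> (\<lambda>x. x [^] k) ` C" if "y \<in> (\<lambda>x. x [^] k) ` C" "z \<in> (\<lambda>x. x [^] k) ` C" for y z
        using that by (auto simp: dist[symmetric])
      show "(\<lambda>x. x [^] k) ` C \<noteq> {}" using C.one_closed by (metis empty_iff image_is_empty)
    qed auto
    show "g \<otimes> y \<otimes> inv g \<in> (\<lambda>x. x [^] k) ` C" if "g \<in> carrier G" "y \<in> (\<lambda>x. x [^] k) ` C" for g y
      using that C.inv_op_closed2 by (auto simp: conj[symmetric])
  qed
qed

lemma (in group) ex_p_torsion_power: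
  assumes "x \<in> carrier G" "x \<noteq> \<one>" "x [^] ((p::nat) ^ k) = \<one>"
  shows "\<exists>j. x [^] (p ^ j) \<noteq> \<one> \<and> (x [^] (p ^ j)) [^] p = \<one>"
  using assms(3)
proof (induct k)
  case 0
  then show ?case using assms(1,2) by simp
next
  case (Suc k)
  then show ?case
  proof (cases "x [^] (p ^ k) = \<one>")
    case False
    then show ?thesis using Suc(2) assms(1)
      by (intro exI[of _ k]) (simp add: nat_pow_pow mult.commute)
  qed (use Suc in blast)
qed

text \<open>Write \<open>card C\<close> as \<open>p ^ k * b\<close> with \<open>b\<close> prime to
  \<open>p\<close>. The elements of \<open>C\<close> killed by \<open>p ^ k\<close> and those killed
  by \<open>b\<close> form normal subgroups of \<open>G\<close> whose direct product is
  \<open>C\<close>, so indecomposability makes one of them trivial.\<close>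

lemma (in group) indecomposable_imp_p_group:
  assumes fin: "finite (carrier G)" and C: "C \<lhd> G"
    and comm: "\<And>x y. x \<in> C \<Longrightarrow> y \<in> C \<Longrightarrow> x \<otimes> y = y \<otimes> x"
    and indec: "\<not> H_normal_decomposable G C"
    and p: "Factorial_Ring.prime (p::nat)" "p dvd card C"
  shows "\<exists>k. \<forall>x\<in>C. x [^] (p ^ k) = \<one>"
proof -
  interpret C: normal C G by fact
  interpret CG: comm_group "G\<lparr>carrier := C\<rparr>"
    by (rule subgroup_comm_group[OF C.subgroup_axioms]) (use comm in auto)
  have finC: "finite C" using fin C.subset by (rule rev_finite_subset)
  have "card C \<noteq> 0" using finC C.one_closed by (metis card_0_eq empty_iff)
  then obtain b where b: "card C = p ^ multiplicity p (card C) * b" "\<not> p dvd b"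
    using multiplicity_decompose'[of "card C" p] p by (metis not_prime_unit)
  define k where "k = multiplicity p (card C)"
  let ?A = "{x \<in> C. x [^] (p ^ k) \<in> {\<one>}}" and ?B = "{x \<in> C. x [^] b \<in> {\<one>}}"
  have A: "?A \<lhd> G" and B: "?B \<lhd> G"
    using normal_pow_preimage[OF C comm one_is_normal] by auto
  have cop: "coprime (p ^ k) b" using p b by (simp add: prime_imp_coprime)
  have AB: "?A \<inter> ?B = {\<one>}"
  proof -
    have "x = \<one>" if "x \<in> ?A" "x \<in> ?B" for x
      using coprime_pow_eq_one[of x "p ^ k" b] that cop by simp
    moreover have "\<one> \<in> ?A \<inter> ?B" by simp
    ultimately show ?thesis by blast
  qed
  have "subgroup (?A <#>\<^bsub>G\<lparr>carrier := C\<rparr>\<^esub> ?B) (G\<lparr>carrier := C\<rparr>)"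
    by (rule CG.mult_subgroups) (use subgroup_incl[OF normal_imp_subgroup[OF A] C.subgroup_axioms]
        subgroup_incl[OF normal_imp_subgroup[OF B] C.subgroup_axioms] in auto)
  then have AB_sub: "subgroup (?A <#> ?B) G" using incl_subgroup[OF C.subgroup_axioms] by simp
  have ABC: "?A <#> ?B = C"
  proof (intro subset_antisym subsetI)
    show "x \<in> C" if "x \<in> ?A <#> ?B" for x using that by (auto simp: set_mult_def)
    fix x assume x: "x \<in> C"
    have "x [^]\<^bsub>G\<lparr>carrier := C\<rparr>\<^esub> order (G\<lparr>carrier := C\<rparr>) = \<one>\<^bsub>G\<lparr>carrier := C\<rparr>\<^esub>"
      by (rule CG.pow_order_eq_1) (use x in auto)
    then have x1: "x [^] (p ^ k * b) = \<one>"
      using b by (simp add: order_def nat_pow_consistent[symmetric] k_def)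
    have "x [^] b \<in> ?A" using x x1 subgroup_nat_pow_closed[OF C.subgroup_axioms x]
      by (simp add: nat_pow_pow mult.commute)
    moreover have "x [^] (p ^ k) \<in> ?B" using x x1 subgroup_nat_pow_closed[OF C.subgroup_axioms x]
      by (simp add: nat_pow_pow)
    ultimately have "x [^] b \<in> ?A <#> ?B" "x [^] (p ^ k) \<in> ?A <#> ?B"
      using set_mult_absorbs_left[OF subgroup.subset[OF normal_imp_subgroup[OF A]] normal_imp_subgroup[OF B]]
        set_mult_absorbs_right[OF normal_imp_subgroup[OF A] subgroup.subset[OF normal_imp_subgroup[OF B]]]
      by auto
    then show "x \<in> ?A <#> ?B"
      using subgroup_coprime_pow[OF AB_sub, of x "p ^ k" b] x cop by auto
  qed
  \<comment> \<open>Otherwise \<open>C\<close> would be killed by \<open>b\<close>; its order, read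
    as the index of the trivial subgroup, would then be prime to \<open>p\<close>.\<close>
  have "?A \<noteq> {\<one>}"
  proof
    assume A1: "?A = {\<one>}"
    have "C = ?B"
      using ABC set_mult_one_left[OF subgroup.subset[OF normal_imp_subgroup[OF B]]] unfolding A1 by simp
    then have "z [^]\<^bsub>G\<lparr>carrier := C\<rparr>\<^esub> b \<in> {\<one>}" if "z \<in> C" for z
      using that by (auto simp: nat_pow_consistent[symmetric])
    then have "\<not> p dvd card (rcosets\<^bsub>G\<lparr>carrier := C\<rparr>\<^esub> {\<one>\<^bsub>G\<lparr>carrier := C\<rparr>\<^esub>})"
      using CG.coprime_index_of_pow_mem[OF _ CG.one_is_normal p(1), of b] b finC by simp
    then show False using p CG.card_rcosets_triv finC by (simp add: order_def)
  qed
  then have "?B = {\<one>}" using indec A B AB ABC unfolding H_normal_decomposable_def by blast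
  then have "C = ?A"
    using ABC set_mult_one_right[OF subgroup.subset[OF normal_imp_subgroup[OF A]]] by simp
  then show ?thesis by auto
qed

text \<open>A minimal nontrivial normal subgroup \<open>S\<close> of \<open>G\<close> inside the
  \<open>p ^ m\<close>-th powers of \<open>C\<close> lifts to a homocyclic \<open>F\<close> with
  socle \<open>S\<close>. If \<open>D\<close> is a maximal normal subgroup of \<open>G\<close> in
  \<open>C\<close> meeting \<open>S\<close> trivially, then \<open>F\<close> complements
  \<open>D\<close> in \<open>C\<close>, and averaging gives a normal complement. Indecomposability
  forces \<open>D\<close> to be trivial, so \<open>S\<close> is the whole \<open>p\<close>-torsion
  of \<open>C\<close>.\<close>

lemma (in group) indecomposable_socle:
  assumes fin: "finite (carrier G)" and C: "C \<lhd> G"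
    and comm: "\<And>x y. x \<in> C \<Longrightarrow> y \<in> C \<Longrightarrow> x \<otimes> y = y \<otimes> x"
    and indec: "\<not> H_normal_decomposable G C"
    and cop: "coprime (card C) (card (rcosets C))" and C1: "C \<noteq> {\<one>}"
  obtains p m where "Factorial_Ring.prime (p::nat)" "\<not> p dvd card (rcosets C)"
    "\<And>x. x \<in> C \<Longrightarrow> x [^] (p ^ Suc m) = \<one>"
    "\<And>x. x \<in> C \<Longrightarrow> x [^] p = \<one> \<Longrightarrow> \<exists>y\<in>C. x = y [^] (p ^ m)"
    "\<And>A x. A \<lhd> G \<Longrightarrow> A \<subseteq> C \<Longrightarrow> A \<noteq> {\<one>} \<Longrightarrow> x \<in> C \<Longrightarrow> x [^] p = \<one> \<Longrightarrow> x \<in> A"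
proof -
  interpret C: normal C G by fact
  interpret CG: comm_group "G\<lparr>carrier := C\<rparr>"
    by (rule subgroup_comm_group[OF C.subgroup_axioms]) (use comm in auto)
  have pow_CG: "x [^]\<^bsub>G\<lparr>carrier := C\<rparr>\<^esub> (k::nat) = x [^] k" for x k
    by (simp add: nat_pow_consistent[symmetric])
  have finC: "finite C" using fin C.subset by (rule rev_finite_subset)
  have "card C \<noteq> 1" using C1 C.one_closed by (metis card_1_singletonE singletonD)
  then obtain p where p: "Factorial_Ring.prime p" "p dvd card C"
    using prime_factor_nat by blast
  have ndvd: "\<not> p dvd card (rcosets C)"
    using cop p by (meson coprime_common_divisor_nat not_prime_1 coprime_common_divisor not_prime_unit)
  \<comment> \<open>The least exponent is taken so that the \<open>p ^ m\<close>-th powers, with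
    \<open>k = Suc m\<close>, form a nontrivial subgroup \<open>?W\<close>.\<close>
  define k where "k = (LEAST k. \<forall>x\<in>C. x [^] (p ^ k) = \<one>)"
  have expk: "\<forall>x\<in>C. x [^] (p ^ k) = \<one>"
    unfolding k_def using indecomposable_imp_p_group[OF fin C comm indec p] by (rule LeastI_ex)
  have "k \<noteq> 0"
  proof
    assume "k = 0"
    then have "C \<subseteq> {\<one>}" using expk by auto
    then show False using C1 C.one_closed by blast
  qed
  then obtain m where km: "k = Suc m" using not0_implies_Suc by blast
  have exp: "x [^] (p ^ Suc m) = \<one>" if "x \<in> C" for x using expk km that by blast
  have "m < k" using km by simp
  then obtain x0 where x0: "x0 \<in> C" "x0 [^] (p ^ m) \<noteq> \<one>"
    using not_less_Least[of m "\<lambda>k. \<forall>x\<in>C. x [^] (p ^ k) = \<one>"] unfolding k_def by blast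
  let ?W = "(\<lambda>x. x [^] (p ^ m)) ` C"
  have W: "?W \<lhd> G" using normal_pow_image[OF C comm] by blast
  have WC: "?W \<subseteq> C" using subgroup_nat_pow_closed[OF C.subgroup_axioms] by auto
  define \<S> where "\<S> = {S. S \<lhd> G \<and> S \<subseteq> ?W \<and> S \<noteq> {\<one>}}"
  have "finite \<S>" unfolding \<S>_def by (rule finite_subset[of _ "Pow C"]) ((use WC in blast), (use finC in simp))
  moreover have "?W \<in> \<S>" unfolding \<S>_def using W x0 by blast
  ultimately have "\<exists>S\<in>\<S>. \<forall>T\<in>\<S>. T \<subseteq> S \<longrightarrow> S = T"
    using finite_has_minimal[of \<S>] by blast
  then obtain S where S0: "S \<in> \<S>" and Smin: "\<And>T. T \<in> \<S> \<Longrightarrow> T \<subseteq> S \<Longrightarrow> S = T"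
    by blast
  have S: "S \<lhd> G" "S \<subseteq> ?W" "S \<noteq> {\<one>}" using S0 unfolding \<S>_def by blast+
  have SC: "S \<subseteq> C" using S WC by blast
  have Ssub: "subgroup S G" using S normal_imp_subgroup by auto
  have Sp: "s [^] p = \<one>" if "s \<in> S" for s
  proof -
    obtain x where "x \<in> C" "s = x [^] (p ^ m)" using \<open>s \<in> S\<close> S(2) by blast
    then show ?thesis using exp by (simp add: nat_pow_pow mult.commute)
  qed
  let ?P = "\<lambda>D. D \<lhd> G \<and> D \<subseteq> C \<and> D \<inter> S = {\<one>}"
  have "?P {\<one>}" using one_is_normal Ssub subgroup.one_closed by auto
  then obtain D where D0: "?P D" and Dmax: "\<And>B. ?P B \<Longrightarrow> D \<subseteq> B \<Longrightarrow> B = D"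
    by (rule ex_maximal_superset[where P = ?P, OF finC]) auto
  have D: "D \<lhd> G" "D \<subseteq> C" "D \<inter> S = {\<one>}" using D0 by auto
  have Dsub: "subgroup D G" using D normal_imp_subgroup by auto
  let ?Y = "{x \<in> C. x [^] p \<in> D}"
  have Y: "?Y \<lhd> G" using normal_pow_preimage[OF C comm D(1)] by auto
  have SY: "S \<subseteq> ?Y" using SC Sp Dsub subgroup.one_closed by fastforce
  have DY: "D \<subseteq> ?Y" using D subgroup_nat_pow_closed[OF Dsub] by auto
  obtain E where E: "E \<lhd> G" "D \<subseteq> E" "E \<inter> S = {\<one>}" "E <#> S = ?Y"
    by (rule normal_complement_mod_p[OF fin p(1) Y _ C _ ndvd S(1) SY D(1) DY D(3)]) (use comm in auto)
  have "E \<subseteq> ?Y"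
    using set_mult_absorbs_left[OF _ Ssub, of E] E normal_imp_subgroup[THEN subgroup.subset] by metis
  \<comment> \<open>The normal complement \<open>E\<close> of \<open>S\<close> in \<open>?Y\<close>
    contains \<open>D\<close> and meets \<open>S\<close> trivially, so maximality of
    \<open>D\<close> identifies the two.\<close>
  then have "E = D" using Dmax[of E] E by blast
  then have YD: "?Y = D <#> S" using E by simp
  obtain F where F: "subgroup F (G\<lparr>carrier := C\<rparr>)" "S \<subseteq> F"
    "\<And>x. x \<in> F \<Longrightarrow> x [^] p = \<one> \<Longrightarrow> x \<in> S"
    "\<And>x. x \<in> F \<Longrightarrow> x [^] p = \<one> \<Longrightarrow> \<exists>y\<in>F. x = y [^] (p ^ m)"
  proof (rule CG.homocyclic_lift[of p m S])
    show "subgroup S (G\<lparr>carrier := C\<rparr>)" using subgroup_incl[OF Ssub C.subgroup_axioms SC] .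
    show "\<exists>x\<in>carrier (G\<lparr>carrier := C\<rparr>). s = x [^]\<^bsub>G\<lparr>carrier := C\<rparr>\<^esub> (p ^ m)" if "s \<in> S" for s
      using \<open>s \<in> S\<close> S(2) unfolding pow_CG by auto
    show "x [^]\<^bsub>G\<lparr>carrier := C\<rparr>\<^esub> (p ^ Suc m) = \<one>\<^bsub>G\<lparr>carrier := C\<rparr>\<^esub>"
      if "x \<in> carrier (G\<lparr>carrier := C\<rparr>)" for x
      using that exp by (simp add: pow_CG)
  qed (use finC p pow_CG in auto)
  have Fsub: "subgroup F G" using incl_subgroup[OF C.subgroup_axioms F(1)] .
  have DF: "D \<inter> F = {\<one>}"
  proof -
    have "x = \<one>" if x: "x \<in> D" "x \<in> F" for x
    proof (rule ccontr)
      assume "x \<noteq> \<one>"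
      then obtain j where j: "x [^] (p ^ j) \<noteq> \<one>" "(x [^] (p ^ j)) [^] p = \<one>"
        using ex_p_torsion_power[OF _ _ exp, of x] x D(2) C.mem_carrier by blast
      have "x [^] (p ^ j) \<in> F" "x [^] (p ^ j) \<in> D"
        using x subgroup_nat_pow_closed[OF Dsub] subgroup_nat_pow_closed[OF Fsub] by auto
      then show False using F(3) j D by blast
    qed
    then show ?thesis using Dsub Fsub subgroup.one_closed by blast
  qed
  have "D <#>\<^bsub>G\<lparr>carrier := C\<rparr>\<^esub> F = carrier (G\<lparr>carrier := C\<rparr>)"
  proof (rule CG.homocyclic_complement[of p m])
    show "x [^]\<^bsub>G\<lparr>carrier := C\<rparr>\<^esub> (p ^ Suc m) = \<one>\<^bsub>G\<lparr>carrier := C\<rparr>\<^esub>"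
      if "x \<in> carrier (G\<lparr>carrier := C\<rparr>)" for x
      using that exp by (simp add: pow_CG)
    show "subgroup D (G\<lparr>carrier := C\<rparr>)" using subgroup_incl[OF Dsub C.subgroup_axioms D(2)] .
    show "x \<in> D <#>\<^bsub>G\<lparr>carrier := C\<rparr>\<^esub> F"
      if "x \<in> carrier (G\<lparr>carrier := C\<rparr>)" "x [^]\<^bsub>G\<lparr>carrier := C\<rparr>\<^esub> p \<in> D" for x
    proof -
      have "x \<in> ?Y" using that by (simp add: pow_CG)
      then show ?thesis using YD mono_set_mult[of D D S F G] F(2) by auto
    qed
  qed (use F DF in \<open>auto simp: pow_CG\<close>)
  then have "F <#> D = C"
    using commut_normal[OF Fsub D(1)] by simp
  have FD: "F \<inter> D = {\<one>}" using DF by auto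
  have copk: "coprime (card (rcosets C)) (p ^ Suc m)"
    using p ndvd by (metis prime_imp_coprime coprime_commute coprime_power_right_iff)
  \<comment> \<open>The averaging is applied with \<open>D\<close> as the target of the projection
    and \<open>F\<close> as the complement that need not be normal; \<open>C\<close> plays the part
    of the subgroup acting trivially.\<close>
  obtain K where K: "K \<lhd> G" "K \<inter> D = {\<one>}" "K <#> D = C"
    using normal_complement_of_complement[OF fin C comm C comm D(1) Fsub FD \<open>F <#> D = C\<close> _ copk] exp D(2)
    by blast
  have KC: "K \<subseteq> C"
    using set_mult_absorbs_left[OF _ Dsub, of K] K normal_imp_subgroup[THEN subgroup.subset] by metis
  have "D = {\<one>}"
  proof (rule ccontr)
    assume "D \<noteq> {\<one>}"
    then have "K = {\<one>}" using indec K D KC unfolding H_normal_decomposable_def by blast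
    then have "C \<subseteq> D" using K(3) set_mult_one_left[OF subgroup.subset[OF Dsub]] by simp
    then show False using SC D(3) S(3) by blast
  qed
  \<comment> \<open>For trivial \<open>D\<close>, the set \<open>?Y\<close> is the
    \<open>p\<close>-torsion of \<open>C\<close>, and \<open>?Y = D <#> S\<close> reduces to
    \<open>S\<close>.\<close>
  then have tors: "x \<in> S" if "x \<in> C" "x [^] p = \<one>" for x
    using YD that set_mult_one_left[OF subgroup.subset[OF Ssub]] by auto
  show ?thesis
  proof
    show "\<exists>y\<in>C. x = y [^] (p ^ m)" if "x \<in> C" "x [^] p = \<one>" for x
      using tors[OF that] S(2) by blast
    show "x \<in> A" if A: "A \<lhd> G" "A \<subseteq> C" "A \<noteq> {\<one>}" and x: "x \<in> C" "x [^] p = \<one>" for A x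
    proof -
      have Asub: "subgroup A G" using A normal_imp_subgroup by auto
      obtain a where a: "a \<in> A" "a \<noteq> \<one>" using A Asub subgroup.one_closed by blast
      obtain j where j: "a [^] (p ^ j) \<noteq> \<one>" "(a [^] (p ^ j)) [^] p = \<one>"
        using ex_p_torsion_power[OF _ _ exp, of a] a A(2) C.mem_carrier by blast
      have "a [^] (p ^ j) \<in> A" using a subgroup_nat_pow_closed[OF Asub] by auto
      then have "a [^] (p ^ j) \<in> A \<inter> S" using tors j A by auto
      then have "A \<inter> S \<noteq> {\<one>}" using j by blast
      then have "S = A \<inter> S"
        using Smin[of "A \<inter> S"] normal_subgroup_intersect[OF A(1) S(1)] S unfolding \<S>_def by blast
      then show ?thesis using tors[OF x] by blast
    qed
  qed (use p ndvd exp in auto)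
qed

section \<open>Self-centralising normal subgroups\<close>

lemma (in normal) pow_index_mem:
  assumes "finite (carrier G)" "x \<in> carrier G"
  shows "x [^] card (rcosets H) \<in> H"
proof -
  interpret Q: group "G Mod H" by (rule factorgroup_is_group)
  have "H #> x \<in> carrier (G Mod H)" using assms by (simp add: carrier_FactGroup)
  then have "(H #> x) [^]\<^bsub>G Mod H\<^esub> order (G Mod H) = \<one>\<^bsub>G Mod H\<^esub>"
    by (rule Q.pow_order_eq_1)
  moreover have "order (G Mod H) = card (rcosets H)" by (simp add: order_def FactGroup_def)
  ultimately have "H #> (x [^] card (rcosets H)) = H"
    using assms by (simp add: FactGroup_pow)
  then show ?thesis using assms by (metis is_subgroup nat_pow_closed rcos_self)
qed

lemma (in group_hom) card_image_kernel:
  assumes "finite (carrier G)"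
  shows "card (carrier G) = card (h ` carrier G) * card (kernel G H h)"
proof -
  interpret I: group_hom G "H\<lparr>carrier := h ` carrier G\<rparr>" h
    using H.subgroup_imp_group[OF img_is_subgroup] G.is_group
    by (simp add: group_hom_def group_hom_axioms_def hom_def)
  have "kernel G (H\<lparr>carrier := h ` carrier G\<rparr>) h = kernel G H h" by (simp add: kernel_def)
  then have "bij_betw (\<lambda>A. the_elem (h ` A)) (rcosets\<^bsub>G\<^esub> kernel G H h) (h ` carrier G)"
    using I.FactGroup_iso_set by (simp add: iso_def FactGroup_def)
  then have "card (rcosets\<^bsub>G\<^esub> kernel G H h) = card (h ` carrier G)" by (rule bij_betw_same_card)
  then show ?thesis using G.lagrange[OF subgroup_kernel] by (simp add: order_def)
qed

text \<open>The kernel of \<open>\<psi>\<close> contains all \<open>p\<close>-th powers, so the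
  image is at most as large as the index of the subgroup of \<open>p\<close>-th powers, which equals
  the number of elements killed by \<open>p\<close>.\<close>

lemma (in comm_group) card_elementary_image:
  assumes fin: "finite (carrier G)" and \<psi>: "group_hom G M \<psi>"
    and p: "\<And>x. x \<in> carrier G \<Longrightarrow> \<psi> (x [^] (p::nat)) = \<one>\<^bsub>M\<^esub>"
  shows "card (\<psi> ` carrier G) \<le> card {x \<in> carrier G. x [^] p = \<one>}"
proof -
  interpret \<psi>: group_hom G M \<psi> by fact
  interpret pow: group_hom G G "\<lambda>x. x [^] p"
    by unfold_locales (auto simp: hom_def nat_pow_distrib)
  have k: "kernel G G (\<lambda>x. x [^] p) = {x \<in> carrier G. x [^] p = \<one>}" by (simp add: kernel_def)
  have "(\<lambda>x. x [^] p) ` carrier G \<subseteq> kernel G M \<psi>" using p by (auto simp: kernel_def)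
  moreover have fk: "finite (kernel G M \<psi>)" using fin by (simp add: kernel_def)
  ultimately have le: "card ((\<lambda>x. x [^] p) ` carrier G) \<le> card (kernel G M \<psi>)"
    by (rule card_mono[rotated])
  have pos: "card ((\<lambda>x. x [^] p) ` carrier G) > 0" using fin by (simp add: card_gt_0_iff carrier_not_empty)
  have "card (\<psi> ` carrier G) * card ((\<lambda>x. x [^] p) ` carrier G) \<le> card (\<psi> ` carrier G) * card (kernel G M \<psi>)"
    using le by simp
  also have "\<dots> = card {x \<in> carrier G. x [^] p = \<one>} * card ((\<lambda>x. x [^] p) ` carrier G)"
    using \<psi>.card_image_kernel[OF fin] pow.card_image_kernel[OF fin] k by (simp add: mult.commute)
  finally show ?thesis using pos by simp
qed

text \<open>A coprime action that is trivial on the \<open>p\<close>-torsion is trivial on all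
  elements of \<open>p\<close>-power order. By induction \<open>z\<close> commutes with
  \<open>x [^] p\<close>, so the commutator \<open>y\<close> of \<open>z\<close> and
  \<open>x\<close> is killed by \<open>p\<close>. It is killed by \<open>n\<close> as well, hence
  trivial.\<close>

lemma (in group) coprime_centraliser:
  assumes P: "P \<lhd> G" and comm: "\<And>x y. x \<in> P \<Longrightarrow> y \<in> P \<Longrightarrow> x \<otimes> y = y \<otimes> x"
    and p: "Factorial_Ring.prime (p::nat)" and np: "\<not> p dvd n"
    and z: "z \<in> carrier G" "z [^] (n::nat) \<in> P"
    and fix_p: "\<And>y. y \<in> P \<Longrightarrow> y [^] p = \<one> \<Longrightarrow> z \<otimes> y = y \<otimes> z"
  shows "x \<in> P \<Longrightarrow> x [^] (p ^ k) = \<one> \<Longrightarrow> z \<otimes> x = x \<otimes> z"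
proof (induct k arbitrary: x)
  case 0
  then show ?case using z normal_imp_subgroup[OF P, THEN subgroup.mem_carrier, of x] by simp
next
  case (Suc k)
  interpret P: normal P G by fact
  have xP: "x \<in> P" and xc: "x \<in> carrier G" using Suc by auto
  have "(x [^] p) [^] (p ^ k) = \<one>" using Suc(3) xc by (simp add: nat_pow_pow)
  then have IH: "z \<otimes> x [^] p = x [^] p \<otimes> z"
    using Suc(1)[of "x [^] p"] subgroup_nat_pow_closed[OF P.subgroup_axioms xP] by blast
  define w where "w = z \<otimes> x \<otimes> inv z"
  define y where "y = w \<otimes> inv x"
  have w: "w \<in> P" using P.inv_op_closed2 z xP by (simp add: w_def)
  have y: "y \<in> P" using w xP by (simp add: y_def)
  have wy: "w = y \<otimes> x" using w xP by (simp add: y_def m_assoc)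
  have "w [^] p = (z \<otimes> x [^] p) \<otimes> inv z" using conjugation_pow[OF z(1) xc] by (simp add: w_def)
  then have "w [^] p = x [^] p" unfolding IH using z(1) xc by (simp add: m_assoc)
  moreover have "w [^] p = y [^] p \<otimes> x [^] p"
    unfolding wy by (rule pow_mult_distrib) (use comm y xP in auto)
  ultimately have yp: "y [^] p = \<one>" using y xP by simp
  have zy: "z \<otimes> y = y \<otimes> z" using fix_p y yp by blast
  have zyj: "z \<otimes> y [^] j = y [^] j \<otimes> z" for j :: nat
    using group_commutes_pow[OF zy[symmetric]] z y by simp
  \<comment> \<open>Since \<open>z\<close> commutes with \<open>y\<close>, each further factor
    \<open>z\<close> contributes one more \<open>y\<close>. At \<open>j = n\<close> the power of
    \<open>z\<close> lies in the abelian group \<open>P\<close> and commutes with \<open>x\<close>,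
    so \<open>y [^] n = \<one>\<close>.\<close>
  have "z [^] j \<otimes> x = y [^] j \<otimes> x \<otimes> z [^] j" for j :: nat
  proof (induct j)
    case 0
    then show ?case using xc by simp
  next
    case (Suc j)
    have zx: "z \<otimes> x = y \<otimes> x \<otimes> z" using wy z xc by (simp add: w_def inv_solve_right' y)
    have zS: "z [^] Suc j = z \<otimes> z [^] j" using z(1) by (rule nat_pow_Suc2)
    have "z [^] Suc j \<otimes> x = z \<otimes> (z [^] j \<otimes> x)"
      unfolding zS using z xc by (simp add: m_assoc)
    also have "\<dots> = (z \<otimes> y [^] j) \<otimes> x \<otimes> z [^] j" using Suc z xc y by (simp add: m_assoc)
    also have "\<dots> = y [^] j \<otimes> (z \<otimes> x) \<otimes> z [^] j" using zyj z xc y by (simp add: m_assoc)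
    also have "\<dots> = y [^] Suc j \<otimes> x \<otimes> (z \<otimes> z [^] j)" using zx z xc y by (simp add: m_assoc)
    also have "z \<otimes> z [^] j = z [^] Suc j" using zS by (rule sym)
    finally show ?case .
  qed
  then have "z [^] n \<otimes> x = y [^] n \<otimes> x \<otimes> z [^] n" .
  moreover have "z [^] n \<otimes> x = x \<otimes> z [^] n" using comm z xP by blast
  ultimately have "y [^] n = \<one>" using y xc z by (simp add: m_assoc)
  moreover have "coprime p n" using p np by (rule prime_imp_coprime)
  ultimately have "y = \<one>" using coprime_pow_eq_one yp y by auto
  then have "z \<otimes> x \<otimes> inv z = x" using wy xc by (simp add: w_def)
  then show ?case using z xc by (metis inv_solve_right' m_closed)
qed

text \<open>Let \<open>Z\<close> be the centraliser of \<open>P\<close>. It contains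
  \<open>P\<close> as a central subgroup of index prime to \<open>p\<close>, so by transfer the
  elements of \<open>Z\<close> killed by \<open>n\<close> form a subgroup \<open>T\<close>. It is
  normal in \<open>G\<close> and meets \<open>P\<close> trivially, hence is trivial by
  \<open>mono\<close>, and then \<open>Z = P\<close>. The coprime action argument places
  \<open>z\<close> in \<open>Z\<close>.\<close>

lemma (in group) monolithic_self_centralising:
  assumes fin: "finite (carrier G)" and P: "P \<lhd> G"
    and comm: "\<And>x y. x \<in> P \<Longrightarrow> y \<in> P \<Longrightarrow> x \<otimes> y = y \<otimes> x"
    and p: "Factorial_Ring.prime (p::nat)" and np: "\<not> p dvd n"
    and exp: "\<And>x. x \<in> P \<Longrightarrow> x [^] (p ^ k) = \<one>"
    and n: "\<And>z. z \<in> carrier G \<Longrightarrow> z [^] (n::nat) \<in> P"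
    and mono: "\<And>N. N \<lhd> G \<Longrightarrow> N \<inter> P = {\<one>} \<Longrightarrow> N = {\<one>}"
    and z: "z \<in> carrier G" "\<And>y. y \<in> P \<Longrightarrow> y [^] p = \<one> \<Longrightarrow> z \<otimes> y = y \<otimes> z"
  shows "z \<in> P"
proof -
  interpret P: normal P G by fact
  define Z where "Z = {g \<in> carrier G. \<forall>x\<in>P. g \<otimes> x = x \<otimes> g}"
  have Zc: "Z \<subseteq> carrier G" by (auto simp: Z_def)
  have Zsub: "subgroup Z G"
  proof (rule subgroupI)
    show "Z \<noteq> {}" by (auto simp: Z_def intro!: exI[of _ \<one>])
    show "inv a \<in> Z" if "a \<in> Z" for a
    proof -
      have "inv a \<otimes> x = x \<otimes> inv a" if "x \<in> P" for x
      proof -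
        have "a \<in> carrier G" "a \<otimes> x = x \<otimes> a" "x \<in> carrier G" using \<open>a \<in> Z\<close> that by (auto simp: Z_def)
        then show ?thesis by (metis inv_closed inv_solve_left inv_solve_right m_assoc m_closed)
      qed
      then show ?thesis using that by (auto simp: Z_def)
    qed
    show "a \<otimes> b \<in> Z" if "a \<in> Z" "b \<in> Z" for a b
    proof -
      have "a \<otimes> b \<otimes> x = x \<otimes> (a \<otimes> b)" if "x \<in> P" for x
      proof -
        have c: "a \<in> carrier G" "a \<otimes> x = x \<otimes> a" "x \<in> carrier G" "b \<in> carrier G" "b \<otimes> x = x \<otimes> b"
          using \<open>a \<in> Z\<close> \<open>b \<in> Z\<close> that by (auto simp: Z_def)
        then show ?thesis by (metis m_assoc)
      qed
      then show ?thesis using that by (auto simp: Z_def)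
    qed
  qed (use Zc in auto)
  have PZ: "P \<subseteq> Z" using comm by (auto simp: Z_def)
  interpret Z: group "G\<lparr>carrier := Z\<rparr>" using subgroup_imp_group[OF Zsub] .
  have finZ: "finite Z" using fin Zc by (rule rev_finite_subset)
  have PsubZ: "subgroup P (G\<lparr>carrier := Z\<rparr>)" using subgroup_incl[OF P.subgroup_axioms Zsub PZ] .
  have PnZ: "P \<lhd> G\<lparr>carrier := Z\<rparr>"
    using normal_restrict_supergroup[OF Zsub P PZ] .
  have powZ: "x [^]\<^bsub>G\<lparr>carrier := Z\<rparr>\<^esub> (j::nat) = x [^] j" for x j
    by (simp add: nat_pow_consistent[symmetric])
  have "\<not> p dvd card (rcosets\<^bsub>G\<lparr>carrier := Z\<rparr>\<^esub> P)"
    by (rule Z.coprime_index_of_pow_mem[of P p n]) (use PnZ p np finZ n Zc powZ in auto)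
  then have copi: "coprime (card (rcosets\<^bsub>G\<lparr>carrier := Z\<rparr>\<^esub> P)) (p ^ k)"
    using p by (metis prime_imp_coprime coprime_commute coprime_power_right_iff)
  have copn: "coprime n (p ^ k)"
    using p np by (metis prime_imp_coprime coprime_commute coprime_power_right_iff)
  define T where "T = {z \<in> Z. z [^] n = \<one>}"
  have central: "u \<otimes>\<^bsub>G\<lparr>carrier := Z\<rparr>\<^esub> z = z \<otimes>\<^bsub>G\<lparr>carrier := Z\<rparr>\<^esub> u"
    if "u \<in> P" "z \<in> carrier (G\<lparr>carrier := Z\<rparr>)" for u z
    using that by (auto simp: Z_def)
  have idx: "subgroup T (G\<lparr>carrier := Z\<rparr>)" "T = {\<one>} \<Longrightarrow> Z = P"
    using Z.central_coprime_index[OF _ PsubZ central _ copi _ copn] finZ exp n Zc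
    unfolding T_def powZ by (simp_all add: subset_iff)
  have Tsub: "subgroup T G" using incl_subgroup[OF Zsub idx(1)] .
  have conjZ: "g \<otimes> a \<otimes> inv g \<in> Z" if g: "g \<in> carrier G" and a: "a \<in> Z" for g a
  proof -
    have ac: "a \<in> carrier G" using a Zc by auto
    have "(g \<otimes> a \<otimes> inv g) \<otimes> x = x \<otimes> (g \<otimes> a \<otimes> inv g)" if x: "x \<in> P" for x
    proof -
      define y where "y = inv g \<otimes> x \<otimes> g"
      have y: "y \<in> P" using P.inv_op_closed1 g x by (simp add: y_def)
      have xy: "x = g \<otimes> y \<otimes> inv g"
      proof -
        have "g \<otimes> (inv g \<otimes> w) = w" if "w \<in> carrier G" for w
          using g that by (simp add: m_assoc[symmetric])
        then show ?thesis using g x by (simp add: y_def m_assoc)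
      qed
      have i: "inv g \<otimes> (g \<otimes> w) = w" if "w \<in> carrier G" for w
        using g that by (simp add: m_assoc[symmetric])
      have "(g \<otimes> a \<otimes> inv g) \<otimes> x = g \<otimes> (a \<otimes> y) \<otimes> inv g"
        unfolding xy using g ac y i by (simp add: m_assoc)
      also have "a \<otimes> y = y \<otimes> a" using a y by (auto simp: Z_def)
      also have "g \<otimes> (y \<otimes> a) \<otimes> inv g = x \<otimes> (g \<otimes> a \<otimes> inv g)"
        unfolding xy using g ac y i by (simp add: m_assoc)
      finally show ?thesis .
    qed
    then show ?thesis using g ac by (auto simp: Z_def)
  qed
  \<comment> \<open>Normality holds because \<open>Z\<close> is invariant under conjugation and so
    is the condition \<open>z [^] n = \<one>\<close>.\<close>
  have "T \<lhd> G"
    unfolding normal_inv_iff using Tsub conjZ Zc conjugation_pow by (auto simp: T_def)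
  moreover have "T \<inter> P = {\<one>}"
  proof -
    have "x = \<one>" if "x \<in> T" "x \<in> P" for x
      using coprime_pow_eq_one[OF _ _ exp copn, of x] that by (auto simp: T_def)
    then show ?thesis using Tsub P.one_closed subgroup.one_closed by blast
  qed
  ultimately have "T = {\<one>}" by (rule mono)
  then have "Z = P" by (rule idx(2))
  moreover have "z \<in> Z"
  proof -
    have "z \<otimes> x = x \<otimes> z" if "x \<in> P" for x
      by (rule coprime_centraliser[OF P comm p np z(1) n[OF z(1)] z(2) that exp[OF that]])
    then show ?thesis using z(1) by (auto simp: Z_def)
  qed
  ultimately show ?thesis by simp
qed

section \<open>Monolithic subquotients of powers\<close>

text \<open>Here \<open>G\<close> is presented as a quotient of a group \<open>K\<close> of tuples over \<open>H\<close>, with coordinates \<open>\<pi> f\<close>.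
  The minimal normal subgroup \<open>M\<close> of \<open>G\<close> is then a quotient of a section of \<open>C\<close> on which \<open>K\<close>
  acts through a single coordinate, which bounds both \<open>|M|\<close> and the index of its centraliser.\<close>

lemma monolithic_card_le:
  fixes H :: "('a, 'b) monoid_scheme" and G :: "('g, 'e) monoid_scheme" and K :: "('k, 'l) monoid_scheme"
    and \<pi> :: "'f \<Rightarrow> 'k \<Rightarrow> 'a"
  assumes H: "group H" and finH: "finite (carrier H)" and C: "C \<lhd> H"
    and comm: "\<And>x y. x \<in> C \<Longrightarrow> y \<in> C \<Longrightarrow> x \<otimes>\<^bsub>H\<^esub> y = y \<otimes>\<^bsub>H\<^esub> x" and C1: "C \<noteq> {\<one>\<^bsub>H\<^esub>}"
    and p: "Factorial_Ring.prime (p::nat)" and np: "\<not> p dvd card (rcosets\<^bsub>H\<^esub> C)"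
    and exp: "\<And>x. x \<in> C \<Longrightarrow> x [^]\<^bsub>H\<^esub> (p ^ Suc m) = \<one>\<^bsub>H\<^esub>"
    and div: "\<And>x. x \<in> C \<Longrightarrow> x [^]\<^bsub>H\<^esub> p = \<one>\<^bsub>H\<^esub> \<Longrightarrow> \<exists>y\<in>C. x = y [^]\<^bsub>H\<^esub> (p ^ m)"
    and soc: "\<And>A x. A \<lhd> H \<Longrightarrow> A \<subseteq> C \<Longrightarrow> A \<noteq> {\<one>\<^bsub>H\<^esub>} \<Longrightarrow> x \<in> C \<Longrightarrow> x [^]\<^bsub>H\<^esub> p = \<one>\<^bsub>H\<^esub> \<Longrightarrow> x \<in> A"
    and G: "group G" and finG: "finite (carrier G)"
    and \<phi>: "\<phi> \<in> hom H G" "inj_on \<phi> (carrier H)"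
    and mono: "\<And>N. N \<lhd> G \<Longrightarrow> N \<inter> \<phi> ` C = {\<one>\<^bsub>G\<^esub>} \<Longrightarrow> N = {\<one>\<^bsub>G\<^esub>}"
    and K: "group K" and \<epsilon>: "\<epsilon> \<in> hom K G" "\<epsilon> ` carrier K = carrier G"
    and F: "finite F" and \<pi>: "\<And>f. f \<in> F \<Longrightarrow> \<pi> f \<in> hom K H"
    and ker: "\<And>k. k \<in> carrier K \<Longrightarrow> (\<And>f. f \<in> F \<Longrightarrow> \<pi> f k = \<one>\<^bsub>H\<^esub>) \<Longrightarrow> \<epsilon> k = \<one>\<^bsub>G\<^esub>"
  shows "card (carrier G) \<le> card (carrier H)"
proof -
  interpret H: group H by fact
  interpret G: group G by fact
  interpret K: group K by fact
  interpret C: normal C H by fact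
  interpret \<phi>: group_hom H G \<phi> using \<phi> by unfold_locales
  interpret \<epsilon>: group_hom K G \<epsilon> using \<epsilon> by unfold_locales
  have \<pi>_hom: "group_hom K H (\<pi> f)" if "f \<in> F" for f
    using \<pi>[OF that] by unfold_locales
  note \<pi>_simps = group_hom.hom_mult[OF \<pi>_hom] group_hom.hom_inv[OF \<pi>_hom] group_hom.hom_one[OF \<pi>_hom]
    group_hom.hom_closed[OF \<pi>_hom] group_hom.hom_nat_pow[OF \<pi>_hom]
  define n where "n = card (rcosets\<^bsub>H\<^esub> C)"
  have finC: "finite C" using finH C.subset by (rule rev_finite_subset)

  have normal_image: "\<epsilon> ` B \<lhd> G" if "B \<lhd> K" for B
    using normal.surj_hom_normal_subgroup[OF that \<epsilon>.group_hom_axioms \<epsilon>(2)] .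
  have \<epsilon>_eq: "\<epsilon> k = \<epsilon> k'"
    if k: "k \<in> carrier K" "k' \<in> carrier K" and eq: "\<And>f. f \<in> F \<Longrightarrow> \<pi> f k = \<pi> f k'" for k k'
  proof -
    have "\<epsilon> (k \<otimes>\<^bsub>K\<^esub> inv\<^bsub>K\<^esub> k') = \<one>\<^bsub>G\<^esub>"
      by (rule ker) (use k eq in \<open>auto simp: \<pi>_simps\<close>)
    then have "\<epsilon> k \<otimes>\<^bsub>G\<^esub> inv\<^bsub>G\<^esub> (\<epsilon> k') = \<one>\<^bsub>G\<^esub>" using k by simp
    then show ?thesis using k by (metis G.inv_equality G.inv_inv \<epsilon>.hom_closed G.inv_closed)
  qed

  \<comment> \<open>The abelian normal subgroup of \<open>G\<close> coming from the tuples over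
    \<open>C\<close>\<close>
  define A where "A = {k \<in> carrier K. \<forall>f\<in>F. \<pi> f k \<in> C}"
  have AI: "k \<in> A" if "k \<in> carrier K" "\<And>f. f \<in> F \<Longrightarrow> \<pi> f k \<in> C" for k
    using that by (simp add: A_def)
  have AD: "\<pi> f k \<in> C" if "k \<in> A" "f \<in> F" for f k
    using that by (simp add: A_def)
  have AN: "A \<lhd> K"
    unfolding K.normal_inv_iff
  proof (intro conjI ballI)
    show "subgroup A K"
      by (rule K.subgroupI) (auto simp: A_def \<pi>_simps intro!: exI[of _ "\<one>\<^bsub>K\<^esub>"])
    show "k \<otimes>\<^bsub>K\<^esub> a \<otimes>\<^bsub>K\<^esub> inv\<^bsub>K\<^esub> k \<in> A" if "k \<in> carrier K" "a \<in> A" for k a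
      using that C.inv_op_closed2 by (auto simp: A_def \<pi>_simps)
  qed
  interpret A: normal A K by fact
  define P where "P = \<epsilon> ` A"
  have PN: "P \<lhd> G" unfolding P_def using AN by (rule normal_image)
  interpret P: normal P G by fact
  have Pcomm: "x \<otimes>\<^bsub>G\<^esub> y = y \<otimes>\<^bsub>G\<^esub> x" if "x \<in> P" "y \<in> P" for x y
  proof -
    obtain a b where ab: "a \<in> A" "x = \<epsilon> a" "b \<in> A" "y = \<epsilon> b" using \<open>x \<in> P\<close> \<open>y \<in> P\<close> by (auto simp: P_def)
    have "\<epsilon> (a \<otimes>\<^bsub>K\<^esub> b) = \<epsilon> (b \<otimes>\<^bsub>K\<^esub> a)"
    proof (rule \<epsilon>_eq)
      show "\<pi> f (a \<otimes>\<^bsub>K\<^esub> b) = \<pi> f (b \<otimes>\<^bsub>K\<^esub> a)" if "f \<in> F" for f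
      proof -
        have "\<pi> f a \<in> C" "\<pi> f b \<in> C" using ab(1,3) that AD by blast+
        from comm[OF this] show ?thesis using that A.mem_carrier[OF ab(1)] A.mem_carrier[OF ab(3)] by (simp only: \<pi>_simps)
      qed
    qed (use ab(1,3) in auto)
    then show ?thesis unfolding ab(2,4) using ab(1,3) by simp
  qed
  have Pexp: "x [^]\<^bsub>G\<^esub> (p ^ Suc m) = \<one>\<^bsub>G\<^esub>" if "x \<in> P" for x
  proof -
    obtain a where a: "a \<in> A" "x = \<epsilon> a" using \<open>x \<in> P\<close> by (auto simp: P_def)
    have "\<epsilon> (a [^]\<^bsub>K\<^esub> (p ^ Suc m)) = \<one>\<^bsub>G\<^esub>"
    proof (rule ker)
      show "\<pi> f (a [^]\<^bsub>K\<^esub> (p ^ Suc m)) = \<one>\<^bsub>H\<^esub>" if "f \<in> F" for f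
        using exp[OF AD[OF a(1) that]] that A.mem_carrier[OF a(1)] by (simp only: \<pi>_simps)
    qed (use a in auto)
    then show ?thesis unfolding a(2) using \<epsilon>.hom_nat_pow[OF A.mem_carrier[OF a(1)]] by metis
  qed
  have Pn: "g [^]\<^bsub>G\<^esub> n \<in> P" if "g \<in> carrier G" for g
  proof -
    obtain k where k: "k \<in> carrier K" "g = \<epsilon> k" using \<open>g \<in> carrier G\<close> \<epsilon>(2) by auto
    have "\<pi> f (k [^]\<^bsub>K\<^esub> n) \<in> C" if "f \<in> F" for f
      using C.pow_index_mem[OF finH, of "\<pi> f k"] k that by (simp add: \<pi>_simps n_def)
    then have "k [^]\<^bsub>K\<^esub> n \<in> A" using k by (intro AI) auto
    then have "\<epsilon> (k [^]\<^bsub>K\<^esub> n) \<in> P" unfolding P_def by (rule imageI)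
    then show ?thesis unfolding k(2) using \<epsilon>.hom_nat_pow[OF k(1)] by metis
  qed
  have npn: "\<not> p dvd n" using np n_def by simp
  have Pidx: "\<not> p dvd card (rcosets\<^bsub>G\<^esub> P)"
    using G.coprime_index_of_pow_mem[OF finG PN p Pn npn] .
  have copn: "coprime n (p ^ Suc m)"
    using p npn by (metis prime_imp_coprime coprime_commute coprime_power_right_iff)
  \<comment> \<open>The element \<open>\<phi> c\<close> is killed by \<open>p ^ Suc m\<close> and
    its \<open>n\<close>-th power lies in \<open>P\<close>; the two exponents are coprime.\<close>
  have CP: "\<phi> c \<in> P" if c: "c \<in> C" for c
  proof (rule G.subgroup_coprime_pow[OF P.subgroup_axioms _ _ _ copn])
    have "\<phi> c [^]\<^bsub>G\<^esub> (p ^ Suc m) = \<phi> (c [^]\<^bsub>H\<^esub> (p ^ Suc m))"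
      using c by (simp only: \<phi>.hom_nat_pow C.mem_carrier)
    then show "\<phi> c [^]\<^bsub>G\<^esub> (p ^ Suc m) \<in> P" using exp[OF c] by simp
  qed (use c Pn in auto)

  \<comment> \<open>The \<open>p\<close>-torsion of \<open>C\<close> inside the normal subgroups of
    \<open>G\<close>\<close>
  obtain c0 where c0: "c0 \<in> C" "c0 \<noteq> \<one>\<^bsub>H\<^esub>" "c0 [^]\<^bsub>H\<^esub> p = \<one>\<^bsub>H\<^esub>"
  proof -
    obtain c where c: "c \<in> C" "c \<noteq> \<one>\<^bsub>H\<^esub>" using C1 C.one_closed by blast
    obtain j where "c [^]\<^bsub>H\<^esub> (p ^ j) \<noteq> \<one>\<^bsub>H\<^esub>" "(c [^]\<^bsub>H\<^esub> (p ^ j)) [^]\<^bsub>H\<^esub> p = \<one>\<^bsub>H\<^esub>"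
      using H.ex_p_torsion_power[OF C.mem_carrier[OF c(1)] c(2) exp[OF c(1)]] by blast
    then show ?thesis using that H.subgroup_nat_pow_closed[OF C.subgroup_axioms c(1)] by blast
  qed
  have \<phi>c0: "\<phi> c0 \<noteq> \<one>\<^bsub>G\<^esub>"
    using \<phi>(2) c0 by (metis C.mem_carrier H.one_closed \<phi>.hom_one inj_onD)
  \<comment> \<open>By \<open>mono\<close>, a nontrivial normal \<open>N\<close> meets the image of
    \<open>C\<close>. The intersection pulls back to a nontrivial normal subgroup of
    \<open>H\<close> in \<open>C\<close>, which contains all the \<open>p\<close>-torsion of
    \<open>C\<close>.\<close>
  have soc': "\<phi> c \<in> N" if N: "N \<lhd> G" "N \<noteq> {\<one>\<^bsub>G\<^esub>}" and c: "c \<in> C" "c [^]\<^bsub>H\<^esub> p = \<one>\<^bsub>H\<^esub>" for N c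
  proof -
    interpret N: normal N G by fact
    define B where "B = {c \<in> C. \<phi> c \<in> N}"
    have "B \<lhd> H"
      unfolding H.normal_inv_iff
    proof (intro conjI ballI)
      show "subgroup B H"
        by (rule H.subgroupI) (auto simp: B_def intro!: exI[of _ "\<one>\<^bsub>H\<^esub>"])
      show "h \<otimes>\<^bsub>H\<^esub> b \<otimes>\<^bsub>H\<^esub> inv\<^bsub>H\<^esub> h \<in> B" if "h \<in> carrier H" "b \<in> B" for h b
        using that C.inv_op_closed2 N.inv_op_closed2 by (auto simp: B_def)
    qed
    moreover have "B \<noteq> {\<one>\<^bsub>H\<^esub>}"
    proof
      assume B1: "B = {\<one>\<^bsub>H\<^esub>}"
      have "N \<inter> \<phi> ` C \<subseteq> {\<one>\<^bsub>G\<^esub>}"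
      proof
        fix x assume "x \<in> N \<inter> \<phi> ` C"
        then obtain c where "c \<in> B" "x = \<phi> c" by (auto simp: B_def)
        then show "x \<in> {\<one>\<^bsub>G\<^esub>}" using B1 by simp
      qed
      moreover have "\<one>\<^bsub>G\<^esub> \<in> N \<inter> \<phi> ` C" using N.one_closed imageI[OF C.one_closed, of \<phi>] by simp
      ultimately show False using mono[OF N(1)] N(2) by blast
    qed
    ultimately have "c \<in> B" using soc[of B c] c unfolding B_def by blast
    then show ?thesis by (simp add: B_def)
  qed

  \<comment> \<open>Minimality of the \<open>p\<close>-torsion of \<open>P\<close>\<close>
  define M where "M = {x \<in> P. x [^]\<^bsub>G\<^esub> p \<in> {\<one>\<^bsub>G\<^esub>}}"
  have MN: "M \<lhd> G" unfolding M_def by (rule G.normal_pow_preimage[OF PN Pcomm G.one_is_normal])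
  have MP: "M \<subseteq> P" by (auto simp: M_def)
  have MI: "x \<in> M" if "x \<in> P" "x [^]\<^bsub>G\<^esub> p = \<one>\<^bsub>G\<^esub>" for x using that by (simp add: M_def)
  have MD: "x [^]\<^bsub>G\<^esub> p = \<one>\<^bsub>G\<^esub>" if "x \<in> M" for x using that by (simp add: M_def)
  interpret M: normal M G by fact
  have \<phi>M: "\<phi> c \<in> M" if "c \<in> C" "c [^]\<^bsub>H\<^esub> p = \<one>\<^bsub>H\<^esub>" for c
  proof -
    have "\<phi> c [^]\<^bsub>G\<^esub> p = \<phi> (c [^]\<^bsub>H\<^esub> p)" using \<phi>.hom_nat_pow[OF C.mem_carrier[OF that(1)]] by simp
    then show ?thesis using CP that by (intro MI) simp_all
  qed
  \<comment> \<open>Maschke gives \<open>N\<close> a normal complement \<open>E\<close> in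
    \<open>M\<close>. If \<open>E\<close> were nontrivial, both \<open>E\<close> and
    \<open>N\<close> would contain \<open>\<phi> c0\<close>.\<close>
  have Mmin: "N = M" if N: "N \<lhd> G" "N \<subseteq> M" "N \<noteq> {\<one>\<^bsub>G\<^esub>}" for N
  proof -
    have 1: "{\<one>\<^bsub>G\<^esub>} \<inter> N = {\<one>\<^bsub>G\<^esub>}"
      using subgroup.one_closed[OF normal_imp_subgroup[OF N(1)]] by simp
    obtain E where E: "E \<lhd> G" "E \<inter> N = {\<one>\<^bsub>G\<^esub>}" "E <#>\<^bsub>G\<^esub> N = M"
      by (rule G.normal_complement_mod_p[OF finG p MN _ PN _ Pidx N(1,2) G.one_is_normal _ 1])
        (use Pcomm MP MD in auto)
    have "E = {\<one>\<^bsub>G\<^esub>}"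
    proof (rule ccontr)
      assume "E \<noteq> {\<one>\<^bsub>G\<^esub>}"
      then have "\<phi> c0 \<in> E \<inter> N" using soc' E N c0 by blast
      then show False using E \<phi>c0 by blast
    qed
    then show ?thesis
      using E G.set_mult_one_left[OF subgroup.subset[OF normal_imp_subgroup[OF N(1)]]] by simp
  qed

  \<comment> \<open>A single coordinate that determines \<open>M\<close>\<close>
  define B where "B J = {a \<in> A. \<epsilon> a \<in> M \<and> (\<forall>f\<in>J. \<pi> f a = \<one>\<^bsub>H\<^esub>)}" for J
  have BI: "a \<in> B J" if "a \<in> A" "\<epsilon> a \<in> M" "\<And>f. f \<in> J \<Longrightarrow> \<pi> f a = \<one>\<^bsub>H\<^esub>" for a J
    using that by (simp add: B_def)
  have BD: "a \<in> A" "\<epsilon> a \<in> M" "\<And>f. f \<in> J \<Longrightarrow> \<pi> f a = \<one>\<^bsub>H\<^esub>" if "a \<in> B J" for a J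
    using that by (simp_all add: B_def)
  have BN: "B J \<lhd> K" if J: "J \<subseteq> F" for J
    unfolding K.normal_inv_iff
  proof (intro conjI ballI)
    have JF: "f \<in> F" if "f \<in> J" for f using J that by auto
    show "subgroup (B J) K"
      by (rule K.subgroupI) (auto simp: B_def \<pi>_simps JF intro!: exI[of _ "\<one>\<^bsub>K\<^esub>"])
    show "k \<otimes>\<^bsub>K\<^esub> a \<otimes>\<^bsub>K\<^esub> inv\<^bsub>K\<^esub> k \<in> B J" if "k \<in> carrier K" "a \<in> B J" for k a
      using that A.inv_op_closed2 M.inv_op_closed2 by (auto simp: B_def \<pi>_simps JF)
  qed
  let ?Q = "\<lambda>J. J \<subseteq> F \<and> \<epsilon> ` B J \<noteq> {\<one>\<^bsub>G\<^esub>}"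
  have "\<phi> c0 \<in> \<epsilon> ` B {}"
  proof -
    have m: "\<phi> c0 \<in> M" using \<phi>M[OF c0(1,3)] .
    then obtain a where a: "a \<in> A" "\<phi> c0 = \<epsilon> a" using MP unfolding P_def by blast
    then have "a \<in> B {}" using m by (intro BI) auto
    then show ?thesis using a(2) by blast
  qed
  then have "?Q {}" using \<phi>c0 by blast
  then obtain J where J: "?Q J" and Jmax: "\<And>J'. ?Q J' \<Longrightarrow> J \<subseteq> J' \<Longrightarrow> J' = J"
    by (rule ex_maximal_superset[where P = ?Q, OF F]) auto
  have "J \<noteq> F"
  proof
    assume "J = F"
    have "\<epsilon> ` B F \<subseteq> {\<one>\<^bsub>G\<^esub>}" using ker BD(1,3) A.mem_carrier by blast
    moreover have "\<one>\<^bsub>G\<^esub> \<in> \<epsilon> ` B F"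
      using normal_image[OF BN[of F]] normal_imp_subgroup subgroup.one_closed by blast
    ultimately show False using J \<open>J = F\<close> by blast
  qed
  then obtain f where f: "f \<in> F" "f \<notin> J" using J by blast
  have "\<not> ?Q (insert f J)" using Jmax[of "insert f J"] f by blast
  then have Bf: "\<epsilon> ` B (insert f J) = {\<one>\<^bsub>G\<^esub>}" using J f by blast
  have BNJ: "B J \<lhd> K" using BN J by blast
  interpret BJ: normal "B J" K by fact
  have BM: "\<epsilon> ` B J = M"
    by (rule Mmin) (use J normal_image[OF BNJ] BD(2) in blast)+
  interpret \<pi>f: group_hom K H "\<pi> f" using \<pi>_hom f by blast
  have BJA: "B J \<subseteq> A" using BD(1) by blast
  have \<pi>B: "\<pi> f a \<in> C" if "a \<in> B J" for a using AD[OF BD(1)[OF that] f(1)] .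
  \<comment> \<open>If the \<open>f\<close>-coordinates of \<open>a\<close> and \<open>b\<close>
    agree, their quotient has trivial coordinates on \<open>insert f J\<close>, hence trivial image
    in \<open>G\<close>.\<close>
  have inj: "\<epsilon> a = \<epsilon> b" if ab: "a \<in> B J" "b \<in> B J" "\<pi> f a = \<pi> f b" for a b
  proof -
    have "a \<otimes>\<^bsub>K\<^esub> inv\<^bsub>K\<^esub> b \<in> B J" using ab by simp
    then have "a \<otimes>\<^bsub>K\<^esub> inv\<^bsub>K\<^esub> b \<in> B (insert f J)"
      by (intro BI) (use BD[of "a \<otimes>\<^bsub>K\<^esub> inv\<^bsub>K\<^esub> b" J] ab in auto)
    then have "\<epsilon> (a \<otimes>\<^bsub>K\<^esub> inv\<^bsub>K\<^esub> b) = \<one>\<^bsub>G\<^esub>" using Bf by blast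
    then have "\<epsilon> a \<otimes>\<^bsub>G\<^esub> inv\<^bsub>G\<^esub> (\<epsilon> b) = \<one>\<^bsub>G\<^esub>" using ab by simp
    then show ?thesis using ab by (metis BJ.mem_carrier G.inv_equality G.inv_inv \<epsilon>.hom_closed G.inv_closed)
  qed

  \<comment> \<open>The order of \<open>M\<close>\<close>
  define U where "U = \<pi> f ` B J"
  have Usub: "subgroup U H" unfolding U_def by (rule \<pi>f.subgroup_img_is_subgroup[OF BJ.subgroup_axioms])
  have UC: "U \<subseteq> C" using \<pi>B by (auto simp: U_def)
  interpret UG: comm_group "H\<lparr>carrier := U\<rparr>"
    by (rule H.subgroup_comm_group[OF Usub]) (use comm UC in auto)
  have "\<forall>u\<in>U. \<exists>a. a \<in> B J \<and> \<pi> f a = u" by (auto simp: U_def)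
  then obtain s where s: "\<And>u. u \<in> U \<Longrightarrow> s u \<in> B J" "\<And>u. u \<in> U \<Longrightarrow> \<pi> f (s u) = u" by metis
  \<comment> \<open>By \<open>inj\<close> the value does not depend on the chosen preimage
    \<open>s u\<close>, so \<open>\<psi>\<close> is the homomorphism from the
    \<open>f\<close>-coordinates onto \<open>M\<close> induced by \<open>\<epsilon>\<close>.\<close>
  define \<psi> where "\<psi> u = \<epsilon> (s u)" for u
  have \<psi>\<pi>: "\<psi> (\<pi> f a) = \<epsilon> a" if "a \<in> B J" for a
    unfolding \<psi>_def by (rule inj) (use that s U_def in auto)
  have \<psi>_hom: "group_hom (H\<lparr>carrier := U\<rparr>) G \<psi>"
  proof
    show "\<psi> \<in> hom (H\<lparr>carrier := U\<rparr>) G"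
    proof (rule homI)
      show "\<psi> u \<in> carrier G" if "u \<in> carrier (H\<lparr>carrier := U\<rparr>)" for u
        using s that by (simp add: \<psi>_def)
      show "\<psi> (u \<otimes>\<^bsub>H\<lparr>carrier := U\<rparr>\<^esub> v) = \<psi> u \<otimes>\<^bsub>G\<^esub> \<psi> v"
        if uv: "u \<in> carrier (H\<lparr>carrier := U\<rparr>)" "v \<in> carrier (H\<lparr>carrier := U\<rparr>)" for u v
      proof -
        have "\<psi> (\<pi> f (s u \<otimes>\<^bsub>K\<^esub> s v)) = \<epsilon> (s u \<otimes>\<^bsub>K\<^esub> s v)" by (rule \<psi>\<pi>) (use s uv in auto)
        then show ?thesis using s uv by (simp add: \<psi>_def)
      qed
    qed
  qed
  have \<psi>U: "\<psi> ` U = M" using \<psi>\<pi> BM unfolding U_def by (force simp: image_iff)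
  have finU: "finite U" using finC UC by (rule rev_finite_subset)
  have powU: "x [^]\<^bsub>H\<lparr>carrier := U\<rparr>\<^esub> (j::nat) = x [^]\<^bsub>H\<^esub> j" for x j
    by (simp add: H.nat_pow_consistent[symmetric])
  \<comment> \<open>As \<open>M\<close> is killed by \<open>p\<close>, its order is at most that of
    the \<open>p\<close>-torsion of \<open>U\<close>, hence at most that of the
    \<open>p\<close>-torsion of \<open>C\<close>.\<close>
  have "card (\<psi> ` carrier (H\<lparr>carrier := U\<rparr>))
      \<le> card {x \<in> carrier (H\<lparr>carrier := U\<rparr>). x [^]\<^bsub>H\<lparr>carrier := U\<rparr>\<^esub> p = \<one>\<^bsub>H\<lparr>carrier := U\<rparr>\<^esub>}"
  proof (rule UG.card_elementary_image[OF _ \<psi>_hom])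
    show "\<psi> (x [^]\<^bsub>H\<lparr>carrier := U\<rparr>\<^esub> p) = \<one>\<^bsub>G\<^esub>" if "x \<in> carrier (H\<lparr>carrier := U\<rparr>)" for x
    proof -
      have "\<psi> (x [^]\<^bsub>H\<lparr>carrier := U\<rparr>\<^esub> p) = \<psi> x [^]\<^bsub>G\<^esub> p"
        using group_hom.hom_nat_pow[OF \<psi>_hom that] .
      moreover have "\<psi> x \<in> M" using \<psi>U that by auto
      ultimately show ?thesis using MD by simp
    qed
  qed (use finU in simp)
  then have "card M \<le> card {x \<in> U. x [^]\<^bsub>H\<^esub> p = \<one>\<^bsub>H\<^esub>}" using \<psi>U by (simp add: powU)
  also have "\<dots> \<le> card {x \<in> C. x [^]\<^bsub>H\<^esub> p = \<one>\<^bsub>H\<^esub>}"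
    by (rule card_mono) (use finC UC in auto)
  also have "\<dots> = card (\<phi> ` {x \<in> C. x [^]\<^bsub>H\<^esub> p = \<one>\<^bsub>H\<^esub>})"
    by (rule card_image[symmetric]) (rule inj_on_subset[OF \<phi>(2)], auto)
  finally have "card M \<le> card (\<phi> ` {x \<in> C. x [^]\<^bsub>H\<^esub> p = \<one>\<^bsub>H\<^esub>})" .
  moreover have "\<phi> ` {x \<in> C. x [^]\<^bsub>H\<^esub> p = \<one>\<^bsub>H\<^esub>} \<subseteq> M" using \<phi>M by auto
  moreover have "finite M" using finG M.subset by (rule rev_finite_subset)
  \<comment> \<open>The \<open>p\<close>-torsion of \<open>C\<close> embeds in \<open>M\<close> and
    is at least as large, so it fills \<open>M\<close>.\<close>
  ultimately have M_eq: "\<phi> ` {x \<in> C. x [^]\<^bsub>H\<^esub> p = \<one>\<^bsub>H\<^esub>} = M" by (metis card_seteq)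

  \<comment> \<open>Equality of \<open>P\<close> with the image of \<open>C\<close>\<close>
  have PC: "P = \<phi> ` C"
  proof -
    interpret PG: comm_group "G\<lparr>carrier := P\<rparr>"
      by (rule G.subgroup_comm_group[OF P.subgroup_axioms]) (use Pcomm in auto)
    have powP: "x [^]\<^bsub>G\<lparr>carrier := P\<rparr>\<^esub> (j::nat) = x [^]\<^bsub>G\<^esub> j" for x j
      by (simp add: G.nat_pow_consistent[symmetric])
    have \<phi>C_sub: "subgroup (\<phi> ` C) G" by (rule \<phi>.subgroup_img_is_subgroup[OF C.subgroup_axioms])
    have \<phi>CP: "\<phi> ` C \<subseteq> P" using CP by auto
    have tors: "x \<in> \<phi> ` {x \<in> C. x [^]\<^bsub>H\<^esub> p = \<one>\<^bsub>H\<^esub>}" if "x \<in> P" "x [^]\<^bsub>G\<^esub> p = \<one>\<^bsub>G\<^esub>" for x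
      using MI[OF that] M_eq by simp
    \<comment> \<open>The complement criterion is applied with trivial \<open>D\<close>: the
      homocyclic image of \<open>C\<close> contains all the \<open>p\<close>-torsion of
      \<open>P\<close>, and the exponent of \<open>P\<close> divides \<open>p ^ Suc m\<close>, so it
      exhausts \<open>P\<close>.\<close>
    have "{\<one>\<^bsub>G\<^esub>} <#>\<^bsub>G\<lparr>carrier := P\<rparr>\<^esub> \<phi> ` C = carrier (G\<lparr>carrier := P\<rparr>)"
    proof (rule PG.homocyclic_complement[of p m])
      show "x [^]\<^bsub>G\<lparr>carrier := P\<rparr>\<^esub> (p ^ Suc m) = \<one>\<^bsub>G\<lparr>carrier := P\<rparr>\<^esub>"
        if "x \<in> carrier (G\<lparr>carrier := P\<rparr>)" for x
        using that Pexp by (simp add: powP)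
      show "subgroup (\<phi> ` C) (G\<lparr>carrier := P\<rparr>)"
        using G.subgroup_incl[OF \<phi>C_sub P.subgroup_axioms \<phi>CP] .
      show "subgroup {\<one>\<^bsub>G\<^esub>} (G\<lparr>carrier := P\<rparr>)" using PG.triv_subgroup by simp
      show "{\<one>\<^bsub>G\<^esub>} \<inter> \<phi> ` C = {\<one>\<^bsub>G\<lparr>carrier := P\<rparr>\<^esub>}"
        using subgroup.one_closed[OF \<phi>C_sub] by auto
      show "\<exists>y\<in>\<phi> ` C. x = y [^]\<^bsub>G\<lparr>carrier := P\<rparr>\<^esub> (p ^ m)"
        if x: "x \<in> \<phi> ` C" "x [^]\<^bsub>G\<lparr>carrier := P\<rparr>\<^esub> p = \<one>\<^bsub>G\<lparr>carrier := P\<rparr>\<^esub>" for x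
      proof -
        obtain c where c: "c \<in> C" "c [^]\<^bsub>H\<^esub> p = \<one>\<^bsub>H\<^esub>" "x = \<phi> c"
          using tors[of x] x \<phi>CP by (auto simp: powP)
        obtain d where d: "d \<in> C" "c = d [^]\<^bsub>H\<^esub> (p ^ m)" using div c by blast
        have "x = \<phi> d [^]\<^bsub>G\<^esub> (p ^ m)" using c d \<phi>.hom_nat_pow by simp
        then show ?thesis using d by (auto simp: powP)
      qed
      show "x \<in> {\<one>\<^bsub>G\<^esub>} <#>\<^bsub>G\<lparr>carrier := P\<rparr>\<^esub> \<phi> ` C"
        if "x \<in> carrier (G\<lparr>carrier := P\<rparr>)" "x [^]\<^bsub>G\<lparr>carrier := P\<rparr>\<^esub> p \<in> {\<one>\<^bsub>G\<^esub>}" for x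
        using tors[of x] that G.set_mult_one_left[OF subgroup.subset[OF \<phi>C_sub]] by (auto simp: powP)
    qed
    then show ?thesis using G.set_mult_one_left[OF subgroup.subset[OF \<phi>C_sub]] by simp
  qed

  \<comment> \<open>The index of \<open>P\<close> in \<open>G\<close>\<close>
  have self_cent: "z \<in> P" if z: "z \<in> carrier G" "\<And>y. y \<in> M \<Longrightarrow> z \<otimes>\<^bsub>G\<^esub> y = y \<otimes>\<^bsub>G\<^esub> z" for z
  proof (rule G.monolithic_self_centralising[OF finG PN Pcomm p npn Pexp Pn _ z(1)])
    show "N = {\<one>\<^bsub>G\<^esub>}" if "N \<lhd> G" "N \<inter> P = {\<one>\<^bsub>G\<^esub>}" for N
      using mono that PC by simp
    show "z \<otimes>\<^bsub>G\<^esub> y = y \<otimes>\<^bsub>G\<^esub> z" if "y \<in> P" "y [^]\<^bsub>G\<^esub> p = \<one>\<^bsub>G\<^esub>" for y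
      using z(2) MI[OF that] by blast
  qed auto
  \<comment> \<open>Conjugating an element of \<open>B J\<close> by \<open>k\<close> leaves its
    \<open>f\<close>-coordinate unchanged, because that coordinate lies in the abelian
    \<open>C\<close> together with \<open>\<pi> f k\<close>. Hence \<open>\<epsilon> k\<close>
    centralises \<open>M\<close>.\<close>
  have \<epsilon>P: "\<epsilon> k \<in> P" if k: "k \<in> carrier K" "\<pi> f k \<in> C" for k
  proof (rule self_cent)
    show "\<epsilon> k \<otimes>\<^bsub>G\<^esub> y = y \<otimes>\<^bsub>G\<^esub> \<epsilon> k" if "y \<in> M" for y
    proof -
      obtain a where a: "a \<in> B J" "y = \<epsilon> a" using BM \<open>y \<in> M\<close> by blast
      define b where "b = k \<otimes>\<^bsub>K\<^esub> a \<otimes>\<^bsub>K\<^esub> inv\<^bsub>K\<^esub> k"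
      have b: "b \<in> B J" using BJ.inv_op_closed2 k a by (simp add: b_def)
      have "\<pi> f b = \<pi> f k \<otimes>\<^bsub>H\<^esub> \<pi> f a \<otimes>\<^bsub>H\<^esub> inv\<^bsub>H\<^esub> (\<pi> f k)" using k a by (simp add: b_def)
      also have "\<pi> f k \<otimes>\<^bsub>H\<^esub> \<pi> f a = \<pi> f a \<otimes>\<^bsub>H\<^esub> \<pi> f k" using comm k \<pi>B a by blast
      finally have "\<pi> f b = \<pi> f a" using k a by (simp add: H.m_assoc)
      then have "\<epsilon> b = \<epsilon> a" using inj a b by blast
      then have "\<epsilon> k \<otimes>\<^bsub>G\<^esub> \<epsilon> a \<otimes>\<^bsub>G\<^esub> inv\<^bsub>G\<^esub> (\<epsilon> k) = \<epsilon> a" using k a by (simp add: b_def)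
      then show ?thesis using k a by (metis BJ.mem_carrier G.inv_solve_right' G.m_closed \<epsilon>.hom_closed)
    qed
  qed (use k in auto)
  have "\<forall>A\<in>rcosets\<^bsub>G\<^esub> P. \<exists>k. k \<in> carrier K \<and> P #>\<^bsub>G\<^esub> \<epsilon> k = A"
  proof
    fix A assume "A \<in> rcosets\<^bsub>G\<^esub> P"
    then obtain g where "g \<in> carrier G" "A = P #>\<^bsub>G\<^esub> g" by (auto simp: RCOSETS_def)
    then show "\<exists>k. k \<in> carrier K \<and> P #>\<^bsub>G\<^esub> \<epsilon> k = A" using \<epsilon>(2) by (metis imageE)
  qed
  then obtain \<kappa> where \<kappa>: "\<And>A. A \<in> rcosets\<^bsub>G\<^esub> P \<Longrightarrow> \<kappa> A \<in> carrier K"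
    "\<And>A. A \<in> rcosets\<^bsub>G\<^esub> P \<Longrightarrow> P #>\<^bsub>G\<^esub> \<epsilon> (\<kappa> A) = A" by metis
  \<comment> \<open>A coset of \<open>P\<close> is sent to the coset of \<open>C\<close> of the
    \<open>f\<close>-coordinate of a lift. By the preceding fact, equal cosets of \<open>C\<close>
    come from equal cosets of \<open>P\<close>.\<close>
  have "inj_on (\<lambda>A. C #>\<^bsub>H\<^esub> \<pi> f (\<kappa> A)) (rcosets\<^bsub>G\<^esub> P)"
  proof (rule inj_onI)
    fix A A' assume A: "A \<in> rcosets\<^bsub>G\<^esub> P" "A' \<in> rcosets\<^bsub>G\<^esub> P"
      and eq: "C #>\<^bsub>H\<^esub> \<pi> f (\<kappa> A) = C #>\<^bsub>H\<^esub> \<pi> f (\<kappa> A')"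
    have k: "\<kappa> A \<in> carrier K" "\<kappa> A' \<in> carrier K" using \<kappa> A by auto
    have "\<pi> f (\<kappa> A) \<in> C #>\<^bsub>H\<^esub> \<pi> f (\<kappa> A')"
      using eq H.rcos_self[OF _ C.subgroup_axioms, of "\<pi> f (\<kappa> A)"] k by simp
    then have "\<pi> f (\<kappa> A \<otimes>\<^bsub>K\<^esub> inv\<^bsub>K\<^esub> \<kappa> A') \<in> C"
      using C.rcos_module_imp[OF H, of "\<pi> f (\<kappa> A')"] k by simp
    then have "\<epsilon> (\<kappa> A \<otimes>\<^bsub>K\<^esub> inv\<^bsub>K\<^esub> \<kappa> A') \<in> P" using k by (intro \<epsilon>P) simp_all
    then have "\<epsilon> (\<kappa> A) \<otimes>\<^bsub>G\<^esub> inv\<^bsub>G\<^esub> \<epsilon> (\<kappa> A') \<in> P" using k by simp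
    then have "\<epsilon> (\<kappa> A) \<in> P #>\<^bsub>G\<^esub> \<epsilon> (\<kappa> A')" using P.rcos_module_rev[OF G] k by simp
    then have "P #>\<^bsub>G\<^esub> \<epsilon> (\<kappa> A') = P #>\<^bsub>G\<^esub> \<epsilon> (\<kappa> A)"
      using G.repr_independence[OF _ _ P.subgroup_axioms] k by simp
    then show "A = A'" using \<kappa>(2) A by simp
  qed
  moreover have "(\<lambda>A. C #>\<^bsub>H\<^esub> \<pi> f (\<kappa> A)) ` (rcosets\<^bsub>G\<^esub> P) \<subseteq> rcosets\<^bsub>H\<^esub> C"
    using \<kappa> C.subset by (auto intro!: H.rcosetsI)
  moreover have "finite (rcosets\<^bsub>H\<^esub> C)" using finH by (simp add: RCOSETS_def)
  ultimately have idx: "card (rcosets\<^bsub>G\<^esub> P) \<le> card (rcosets\<^bsub>H\<^esub> C)" by (rule card_inj_on_le)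
  have "card P = card C" unfolding PC
    by (rule card_image) (rule inj_on_subset[OF \<phi>(2)], auto)
  then show ?thesis
    using idx G.lagrange[OF P.subgroup_axioms] H.lagrange[OF C.subgroup_axioms]
    by (metis mult_le_mono1 order_def)
qed

section \<open>Retractions\<close>

text \<open>Factoring out a normal \<open>N\<close> maximal with trivial intersection with the image
  of \<open>C\<close> produces a quotient to which the cardinality bound applies. As
  \<open>H\<close> still embeds there, the embedding is an isomorphism, and its inverse after the
  quotient map is the retraction.\<close>

lemma retraction_of_subquotient_of_power:
  fixes H :: "('a, 'b) monoid_scheme" and G :: "('g, 'e) monoid_scheme" and K :: "('k, 'l) monoid_scheme"
    and \<pi> :: "'f \<Rightarrow> 'k \<Rightarrow> 'a"
  assumes H: "group H" and finH: "finite (carrier H)" and C: "C \<lhd> H"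
    and cent: "centraliser H C = C" and indec: "\<not> H_normal_decomposable H C"
    and cop: "coprime (card C) (order (H Mod C))"
    and G: "group G" and finG: "finite (carrier G)"
    and \<phi>: "\<phi> \<in> hom H G" "inj_on \<phi> (carrier H)"
    and K: "group K" and \<epsilon>: "\<epsilon> \<in> hom K G" "\<epsilon> ` carrier K = carrier G"
    and F: "finite F" and \<pi>: "\<And>f. f \<in> F \<Longrightarrow> \<pi> f \<in> hom K H"
    and ker: "\<And>k. k \<in> carrier K \<Longrightarrow> (\<And>f. f \<in> F \<Longrightarrow> \<pi> f k = \<one>\<^bsub>H\<^esub>) \<Longrightarrow> \<epsilon> k = \<one>\<^bsub>G\<^esub>"
  obtains \<rho> where "\<rho> \<in> hom G H" "\<And>h. h \<in> carrier H \<Longrightarrow> \<rho> (\<phi> h) = h"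
proof (cases "C = {\<one>\<^bsub>H\<^esub>}")
  case True
  interpret H: group H by fact
  \<comment> \<open>A trivial subgroup is centralised by everything, so a trivial self-centralising
    \<open>C\<close> forces \<open>H\<close> to be trivial.\<close>
  have "carrier H \<subseteq> centraliser H C" by (auto simp: centraliser_def True)
  then have "carrier H = {\<one>\<^bsub>H\<^esub>}" using cent True H.one_closed by blast
  then have "\<one>\<^bsub>H\<^esub> = h" if "h \<in> carrier H" for h using that by auto
  moreover have "(\<lambda>_. \<one>\<^bsub>H\<^esub>) \<in> hom G H" by (simp add: hom_def)
  ultimately show ?thesis by (intro that) blast+
next
  case C1: False
  interpret H: group H by fact
  interpret G: group G by fact
  interpret C: normal C H by fact
  interpret \<phi>: group_hom H G \<phi> using \<phi> by unfold_locales
  have comm: "x \<otimes>\<^bsub>H\<^esub> y = y \<otimes>\<^bsub>H\<^esub> x" if "x \<in> C" "y \<in> C" for x y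
    using that cent unfolding centraliser_def by blast
  have cop': "coprime (card C) (card (rcosets\<^bsub>H\<^esub> C))"
    using cop by (simp add: order_def FactGroup_def)
  obtain p m where p: "Factorial_Ring.prime (p::nat)" "\<not> p dvd card (rcosets\<^bsub>H\<^esub> C)"
    and exp: "\<And>x. x \<in> C \<Longrightarrow> x [^]\<^bsub>H\<^esub> (p ^ Suc m) = \<one>\<^bsub>H\<^esub>"
    and div: "\<And>x. x \<in> C \<Longrightarrow> x [^]\<^bsub>H\<^esub> p = \<one>\<^bsub>H\<^esub> \<Longrightarrow> \<exists>y\<in>C. x = y [^]\<^bsub>H\<^esub> (p ^ m)"
    and soc: "\<And>A x. A \<lhd> H \<Longrightarrow> A \<subseteq> C \<Longrightarrow> A \<noteq> {\<one>\<^bsub>H\<^esub>} \<Longrightarrow> x \<in> C \<Longrightarrow> x [^]\<^bsub>H\<^esub> p = \<one>\<^bsub>H\<^esub> \<Longrightarrow> x \<in> A"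
    by (rule H.indecomposable_socle[OF finH C _ indec cop' C1], erule (1) comm, (rule that; assumption))
  let ?Q = "\<lambda>N. N \<lhd> G \<and> N \<inter> \<phi> ` C = {\<one>\<^bsub>G\<^esub>}"
  have "\<one>\<^bsub>G\<^esub> \<in> \<phi> ` C" using imageI[OF C.one_closed, of \<phi>] by simp
  have sub: "B \<subseteq> carrier G" if "?Q B" for B
    using that normal_imp_subgroup[of B G] subgroup.subset[of B G] by blast
  have "?Q {\<one>\<^bsub>G\<^esub>}" using G.one_is_normal \<open>\<one>\<^bsub>G\<^esub> \<in> \<phi> ` C\<close> by blast
  then obtain N where N0: "?Q N" and Nmax: "\<And>B. ?Q B \<Longrightarrow> N \<subseteq> B \<Longrightarrow> B = N"
    by (rule ex_maximal_superset[where P = ?Q, OF finG _ sub]) (assumption | (rule that; assumption))+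
  have N: "N \<lhd> G" "N \<inter> \<phi> ` C = {\<one>\<^bsub>G\<^esub>}" using N0 by auto
  interpret N: normal N G by fact
  interpret Q: group "G Mod N" by (rule N.factorgroup_is_group)
  define r where "r = (\<lambda>g. N #>\<^bsub>G\<^esub> g)"
  have r_hom: "r \<in> hom G (G Mod N)" unfolding r_def by (rule N.r_coset_hom_Mod)
  interpret r: group_hom G "G Mod N" r using r_hom by unfold_locales
  have r_one: "r g = \<one>\<^bsub>G Mod N\<^esub> \<longleftrightarrow> g \<in> N" if "g \<in> carrier G" for g
    using that G.coset_join1[OF _ _ N.subgroup_axioms, of g] G.coset_join2[OF _ N.subgroup_axioms, of g]
    by (auto simp: r_def)
  \<comment> \<open>For \<open>h\<close> with image in \<open>N\<close>, each commutator
    \<open>d\<close> of \<open>h\<close> with an element of \<open>C\<close> lies in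
    \<open>C\<close> and maps into \<open>N\<close>, hence is trivial. So \<open>h\<close>
    centralises \<open>C\<close>, lies in \<open>C\<close>, and is trivial as well.\<close>
  have \<phi>N: "h = \<one>\<^bsub>H\<^esub>" if h: "h \<in> carrier H" "\<phi> h \<in> N" for h
  proof -
    have NC: "c = \<one>\<^bsub>H\<^esub>" if c: "c \<in> C" "\<phi> c \<in> N" for c
    proof -
      have "\<phi> c = \<phi> \<one>\<^bsub>H\<^esub>" using c N(2) by auto
      then show ?thesis using \<phi>(2) c by (meson C.mem_carrier H.one_closed inj_onD)
    qed
    have "h \<otimes>\<^bsub>H\<^esub> c = c \<otimes>\<^bsub>H\<^esub> h" if c: "c \<in> C" for c
    proof -
      have cc: "c \<in> carrier H" using c by simp
      define d where "d = h \<otimes>\<^bsub>H\<^esub> c \<otimes>\<^bsub>H\<^esub> inv\<^bsub>H\<^esub> h \<otimes>\<^bsub>H\<^esub> inv\<^bsub>H\<^esub> c"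
      have "d \<in> C" using C.inv_op_closed2[OF h(1) c] c by (simp add: d_def)
      moreover have "\<phi> d \<in> N"
      proof -
        have "\<phi> c \<otimes>\<^bsub>G\<^esub> inv\<^bsub>G\<^esub> (\<phi> h) \<otimes>\<^bsub>G\<^esub> inv\<^bsub>G\<^esub> (\<phi> c) \<in> N"
          using N.inv_op_closed2[of "\<phi> c" "inv\<^bsub>G\<^esub> (\<phi> h)"] h cc by simp
        then have "\<phi> h \<otimes>\<^bsub>G\<^esub> (\<phi> c \<otimes>\<^bsub>G\<^esub> inv\<^bsub>G\<^esub> (\<phi> h) \<otimes>\<^bsub>G\<^esub> inv\<^bsub>G\<^esub> (\<phi> c)) \<in> N" using h by simp
        then show ?thesis using h cc by (simp add: d_def G.m_assoc)
      qed
      ultimately have "d = \<one>\<^bsub>H\<^esub>" by (rule NC)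
      then have "h \<otimes>\<^bsub>H\<^esub> c \<otimes>\<^bsub>H\<^esub> inv\<^bsub>H\<^esub> h = c"
        unfolding d_def using h cc by (metis H.inv_closed H.inv_equality H.inv_inv H.m_closed)
      then show ?thesis using h cc by (metis H.inv_solve_right' H.m_closed)
    qed
    then have "h \<in> C" using h cent unfolding centraliser_def by blast
    then show ?thesis using NC h by blast
  qed
  define \<phi>' where "\<phi>' = (\<lambda>h. r (\<phi> h))"
  have \<phi>'_hom: "\<phi>' \<in> hom H (G Mod N)" by (auto simp: \<phi>'_def hom_def)
  interpret \<phi>': group_hom H "G Mod N" \<phi>' using \<phi>'_hom by unfold_locales
  have \<phi>'_one: "h = \<one>\<^bsub>H\<^esub>" if "h \<in> carrier H" "\<phi>' h = \<one>\<^bsub>G Mod N\<^esub>" for h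
    using that r_one[of "\<phi> h"] \<phi>N unfolding \<phi>'_def by simp
  have \<phi>'_inj: "inj_on \<phi>' (carrier H)" using \<phi>'.inj_on_one_iff \<phi>'_one by blast
  have finQ: "finite (carrier (G Mod N))" using finG by (simp add: carrier_FactGroup)
  have r_surj: "r ` carrier G = carrier (G Mod N)" by (simp add: carrier_FactGroup r_def)
  have "card (carrier (G Mod N)) \<le> card (carrier H)"
  proof (rule monolithic_card_le[OF H finH C comm C1 p exp div soc Q.is_group finQ \<phi>'_hom \<phi>'_inj _ K _ _ F \<pi>])
    \<comment> \<open>The preimage \<open>T\<close> of \<open>L\<close> is normal in
      \<open>G\<close>, contains \<open>N\<close> and meets the image of \<open>C\<close> trivially,
      so maximality gives \<open>T = N\<close>.\<close>
    show "L = {\<one>\<^bsub>G Mod N\<^esub>}" if L: "L \<lhd> G Mod N" "L \<inter> \<phi>' ` C = {\<one>\<^bsub>G Mod N\<^esub>}" for L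
    proof -
      interpret L: normal L "G Mod N" by fact
      define T where "T = {g \<in> carrier G. r g \<in> L}"
      have "T \<lhd> G"
        unfolding G.normal_inv_iff
      proof (intro conjI ballI)
        show "subgroup T G"
          by (rule G.subgroupI) (use L.one_closed L.m_closed L.m_inv_closed in
              \<open>auto simp: T_def simp del: mult_FactGroup one_FactGroup intro!: exI[of _ "\<one>\<^bsub>G\<^esub>"]\<close>)
        show "g \<otimes>\<^bsub>G\<^esub> x \<otimes>\<^bsub>G\<^esub> inv\<^bsub>G\<^esub> g \<in> T" if "g \<in> carrier G" "x \<in> T" for g x
          using that L.inv_op_closed2[of "r g" "r x"] by (auto simp: T_def simp del: mult_FactGroup one_FactGroup)
      qed
      moreover have "T \<inter> \<phi> ` C = {\<one>\<^bsub>G\<^esub>}"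
      proof -
        have "x = \<one>\<^bsub>G\<^esub>" if x: "x \<in> T" "x \<in> \<phi> ` C" for x
        proof -
          obtain c where c: "c \<in> C" "x = \<phi> c" using x by blast
          have "\<phi>' c \<in> L \<inter> \<phi>' ` C" using x c by (simp add: T_def \<phi>'_def)
          then have "\<phi>' c = \<one>\<^bsub>G Mod N\<^esub>" unfolding L(2) by (rule singletonD)
          then have "c = \<one>\<^bsub>H\<^esub>" by (rule \<phi>'_one[OF C.mem_carrier[OF c(1)]])
          then show ?thesis using c by simp
        qed
        moreover have "\<one>\<^bsub>G\<^esub> \<in> T"
          using normal_imp_subgroup[OF \<open>T \<lhd> G\<close>] by (rule subgroup.one_closed)
        ultimately show ?thesis using \<open>\<one>\<^bsub>G\<^esub> \<in> \<phi> ` C\<close> by blast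
      qed
      moreover have "N \<subseteq> T"
      proof
        fix x assume "x \<in> N"
        then have "r x = \<one>\<^bsub>G Mod N\<^esub>" using r_one[OF N.mem_carrier] by blast
        then show "x \<in> T" using N.mem_carrier[OF \<open>x \<in> N\<close>] L.one_closed unfolding T_def by auto
      qed
      ultimately have TN: "T = N" using Nmax[of T] by blast
      have "x = \<one>\<^bsub>G Mod N\<^esub>" if x: "x \<in> L" for x
      proof -
        obtain g where g: "g \<in> carrier G" "x = r g" using r_surj L.mem_carrier[OF x] by blast
        then have "g \<in> N" using x TN unfolding T_def by blast
        then show ?thesis using g r_one[OF g(1)] by blast
      qed
      then show ?thesis using L.one_closed by blast
    qed
    show "(\<lambda>k. r (\<epsilon> k)) \<in> hom K (G Mod N)"
      using \<epsilon>(1) r_hom unfolding hom_def by (auto simp: Pi_iff)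
    show "(\<lambda>k. r (\<epsilon> k)) ` carrier K = carrier (G Mod N)"
      using \<epsilon>(2) r_surj by (metis image_image)
    show "r (\<epsilon> k) = \<one>\<^bsub>G Mod N\<^esub>" if "k \<in> carrier K" "\<And>f. f \<in> F \<Longrightarrow> \<pi> f k = \<one>\<^bsub>H\<^esub>" for k
      using ker[OF that] r.hom_one by simp
  qed auto
  then have "card (carrier (G Mod N)) \<le> card (\<phi>' ` carrier H)" using \<phi>'_inj by (simp add: card_image)
  moreover have "\<phi>' ` carrier H \<subseteq> carrier (G Mod N)" by auto
  ultimately have surj: "\<phi>' ` carrier H = carrier (G Mod N)" using finQ by (metis card_seteq)
  then have iso: "\<phi>' \<in> iso H (G Mod N)" using \<phi>'_hom \<phi>'_inj by (simp add: iso_def bij_betw_def)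
  define \<rho> where "\<rho> = (\<lambda>g. inv_into (carrier H) \<phi>' (r g))"
  have inv_hom: "inv_into (carrier H) \<phi>' \<in> hom (G Mod N) H"
    using H.iso_set_sym[OF iso] by (simp add: iso_def)
  have "\<rho> \<in> hom G H"
    using r_hom inv_hom unfolding \<rho>_def hom_def by (auto simp: Pi_iff)
  moreover have "\<rho> (\<phi> h) = h" if "h \<in> carrier H" for h
    using that \<phi>'_inj by (simp add: \<rho>_def \<phi>'_def[symmetric] inv_into_f_f)
      (metis \<phi>'_def \<phi>'_inj inv_into_f_f)
  ultimately show ?thesis using that by blast
qed

section \<open>Values of words and relatively free quotients\<close>

lemma (in group) eval_fword_closed:
  assumes "f \<in> UNIV \<rightarrow> carrier G"
  shows "eval_fword G f w \<in> carrier G"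
  using assms by (induct w) (auto simp: Pi_iff)

lemma (in group) eval_fword_append:
  assumes "f \<in> UNIV \<rightarrow> carrier G"
  shows "eval_fword G f (u @ v) = eval_fword G f u \<otimes> eval_fword G f v"
  using assms eval_fword_closed[OF assms] by (induct u) (auto simp: Pi_iff m_assoc)

definition inv_fword :: "fword \<Rightarrow> fword" where
  "inv_fword w = rev (map (\<lambda>(i, e). (i, \<not> e)) w)"

lemma (in group) eval_inv_fword:
  assumes "f \<in> UNIV \<rightarrow> carrier G"
  shows "eval_fword G f (inv_fword w) = inv (eval_fword G f w)"
proof (induct w)
  case Nil
  then show ?case by (simp add: inv_fword_def)
next
  case (Cons a w)
  obtain i e where a: "a = (i, e)" by fastforce
  have fi: "f i \<in> carrier G" using assms by auto
  have "inv_fword (a # w) = inv_fword w @ [(i, \<not> e)]" by (simp add: inv_fword_def a)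
  then have "eval_fword G f (inv_fword (a # w)) = inv (eval_fword G f w) \<otimes> eval_fword G f [(i, \<not> e)]"
    using Cons eval_fword_append[OF assms] by simp
  then show ?case
    using a fi eval_fword_closed[OF assms, of w] by (simp add: inv_mult_group)
qed

lemma (in group_hom) hom_eval_fword:
  assumes "f \<in> UNIV \<rightarrow> carrier G"
  shows "h (eval_fword G f w) = eval_fword H (h \<circ> f) w"
  using assms G.eval_fword_closed[OF assms] by (induct w) (auto simp: Pi_iff)

lemma eval_fword_rename:
  "eval_fword G f (map (\<lambda>(i, e). (\<sigma> i, e)) w) = eval_fword G (f \<circ> \<sigma>) w"
  by (induct w) auto

lemma finite_range_of_determined:
  assumes "finite (range g)" "\<And>x y. g x = g y \<Longrightarrow> h x = h y"
  shows "finite (range h)"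
proof -
  have "h x = h (inv_into UNIV g (g x))" for x
    using assms(2) by (metis f_inv_into_f rangeI)
  then have "range h \<subseteq> (\<lambda>t. h (inv_into UNIV g t)) ` range g" by auto
  then show ?thesis using assms(1) by (meson finite_imageI finite_subset)
qed

text \<open>The subgroup \<open>L\<close> generated by \<open>S\<close> is divided by the values
  \<open>V\<close> of the words that are trivial on \<open>H\<close>. The quotient is finite and is
  a quotient of a group of tuples over \<open>H\<close>, while \<open>verbal\<close> keeps
  \<open>H\<close> embedded in it. Restricting \<open>verbal\<close> to values in the image of
  \<open>H\<close> lets the lemma serve both a group satisfying the identities of \<open>H\<close>
  and a group containing \<open>H\<close> as a verbally closed subgroup.\<close>

lemma word_retraction:
  fixes H :: "('a, 'b) monoid_scheme" and G :: "('g, 'e) monoid_scheme"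
  assumes H: "group H" and finH: "finite (carrier H)" and C: "C \<lhd> H"
    and cent: "centraliser H C = C" and indec: "\<not> H_normal_decomposable H C"
    and cop: "coprime (card C) (order (H Mod C))"
    and G: "group G" and \<phi>: "\<phi> \<in> hom H G" "inj_on \<phi> (carrier H)"
    and S: "finite S" "S \<subseteq> carrier G" "\<phi> ` carrier H \<subseteq> S"
    and verbal: "\<And>w f. (\<And>e. e \<in> UNIV \<rightarrow> carrier H \<Longrightarrow> eval_fword H e w = \<one>\<^bsub>H\<^esub>) \<Longrightarrow>
      f \<in> UNIV \<rightarrow> carrier G \<Longrightarrow> eval_fword G f w \<in> \<phi> ` carrier H \<Longrightarrow> eval_fword G f w = \<one>\<^bsub>G\<^esub>"
  obtains L \<rho> where "subgroup L G" "S \<subseteq> L" "\<rho> \<in> hom (G\<lparr>carrier := L\<rparr>) H"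
    "\<And>h. h \<in> carrier H \<Longrightarrow> \<rho> (\<phi> h) = h"
proof -
  interpret H: group H by fact
  interpret G: group G by fact
  interpret \<phi>: group_hom H G \<phi> using \<phi> by unfold_locales
  have S_ne: "S \<noteq> {}" using S(3) H.one_closed by blast
  define n where "n = card S"
  have n: "n > 0" using S S_ne by (simp add: n_def card_gt_0_iff)
  obtain b where b: "bij_betw b {0..<n} S" using ex_bij_betw_nat_finite[OF S(1)] n_def by blast
  \<comment> \<open>Words involve infinitely many variables, so the enumeration of the
    \<open>n\<close> generators is repeated periodically.\<close>
  define \<iota> where "\<iota> = (\<lambda>i. b (i mod n))"
  have \<iota>S: "\<iota> i \<in> S" for i using b n by (auto simp: \<iota>_def bij_betw_def)
  have \<iota>: "\<iota> \<in> UNIV \<rightarrow> carrier G" using \<iota>S S by auto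
  have \<iota>_mod: "\<iota> \<circ> (\<lambda>i. i mod n) = \<iota>" by (auto simp: \<iota>_def)
  \<comment> \<open>The periodic assignments encode the assignments of \<open>n\<close> variables in
    \<open>H\<close>; there are only finitely many of them.\<close>
  define F where "F = {f \<in> UNIV \<rightarrow> carrier H. f \<circ> (\<lambda>i. i mod n) = f}"
  have FH: "f \<in> UNIV \<rightarrow> carrier H" if "f \<in> F" for f using that by (simp add: F_def)
  have finF: "finite F"
  proof (rule finite_subset)
    show "F \<subseteq> (\<lambda>g i. g (i mod n)) ` ({0..<n} \<rightarrow>\<^sub>E carrier H)"
    proof
      fix f assume f: "f \<in> F"
      have "f i = restrict f {0..<n} (i mod n)" for i
        using f n by (auto simp: F_def fun_eq_iff)
      then have "f = (\<lambda>i. restrict f {0..<n} (i mod n))" by auto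
      moreover have "restrict f {0..<n} \<in> {0..<n} \<rightarrow>\<^sub>E carrier H" using FH[OF f] by auto
      ultimately show "f \<in> (\<lambda>g i. g (i mod n)) ` ({0..<n} \<rightarrow>\<^sub>E carrier H)" by (rule image_eqI)
    qed
    show "finite ((\<lambda>g i. g (i mod n)) ` ({0..<n} \<rightarrow>\<^sub>E carrier H))"
      using finH by (intro finite_imageI finite_PiE) auto
  qed
  let ?ev = "eval_fword G \<iota>"
  \<comment> \<open>Reducing the variable indices modulo \<open>n\<close> turns a word trivial under
    all of \<open>F\<close> into an identity of \<open>H\<close>, and does not change its value at
    \<open>\<iota>\<close>.\<close>
  have verb: "?ev w = \<one>\<^bsub>G\<^esub>" if w: "\<And>f. f \<in> F \<Longrightarrow> eval_fword H f w = \<one>\<^bsub>H\<^esub>" "?ev w \<in> \<phi> ` carrier H" for w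
  proof -
    let ?w = "map (\<lambda>(i, e). (i mod n, e)) w"
    have "eval_fword H f ?w = \<one>\<^bsub>H\<^esub>" if "f \<in> UNIV \<rightarrow> carrier H" for f
    proof -
      have "f \<circ> (\<lambda>i. i mod n) \<in> F" using that by (auto simp: F_def)
      then show ?thesis using w(1) by (simp add: eval_fword_rename)
    qed
    moreover have "eval_fword G \<iota> ?w = ?ev w" by (simp add: eval_fword_rename \<iota>_mod)
    ultimately show ?thesis using verbal[of ?w \<iota>] \<iota> w(2) by simp
  qed
  define L where "L = range ?ev"
  have Lsub: "subgroup L G"
  proof (rule G.subgroupI)
    show "L \<subseteq> carrier G" using G.eval_fword_closed[OF \<iota>] by (auto simp: L_def)
    show "L \<noteq> {}" by (simp add: L_def)
    show "inv\<^bsub>G\<^esub> a \<in> L" if "a \<in> L" for a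
      using that G.eval_inv_fword[OF \<iota>, symmetric] by (auto simp: L_def)
    show "a \<otimes>\<^bsub>G\<^esub> c \<in> L" if "a \<in> L" "c \<in> L" for a c
      using that G.eval_fword_append[OF \<iota>, symmetric] by (auto simp: L_def)
  qed
  have SL: "S \<subseteq> L"
  proof
    fix x assume "x \<in> S"
    then obtain i where "i < n" "x = b i" using b by (auto simp: bij_betw_def)
    then have "?ev [(i, True)] = x" using \<open>x \<in> S\<close> S by (auto simp: \<iota>_def)
    then show "x \<in> L" unfolding L_def by blast
  qed
  interpret L: group "G\<lparr>carrier := L\<rparr>" using G.subgroup_imp_group[OF Lsub] .
  define V where "V = ?ev ` {w. \<forall>f\<in>F. eval_fword H f w = \<one>\<^bsub>H\<^esub>}"
  have VI: "?ev w \<in> V" if "\<And>f. f \<in> F \<Longrightarrow> eval_fword H f w = \<one>\<^bsub>H\<^esub>" for w using that by (auto simp: V_def)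
  have VL: "V \<subseteq> L" by (auto simp: V_def L_def)
  have Vsub: "subgroup V G"
  proof (rule G.subgroupI)
    show "V \<subseteq> carrier G" using VL Lsub subgroup.subset by blast
    show "V \<noteq> {}" by (auto simp: V_def intro!: exI[of _ "[]"])
    show "inv\<^bsub>G\<^esub> a \<in> V" if "a \<in> V" for a
    proof -
      obtain w where w: "a = ?ev w" "\<And>f. f \<in> F \<Longrightarrow> eval_fword H f w = \<one>\<^bsub>H\<^esub>"
        using \<open>a \<in> V\<close> by (auto simp: V_def)
      have "?ev (inv_fword w) \<in> V" by (rule VI) (use w FH in \<open>simp add: H.eval_inv_fword\<close>)
      then show ?thesis using w G.eval_inv_fword[OF \<iota>] by simp
    qed
    show "a \<otimes>\<^bsub>G\<^esub> c \<in> V" if "a \<in> V" "c \<in> V" for a c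
    proof -
      obtain w v where w: "a = ?ev w" "\<And>f. f \<in> F \<Longrightarrow> eval_fword H f w = \<one>\<^bsub>H\<^esub>"
        "c = ?ev v" "\<And>f. f \<in> F \<Longrightarrow> eval_fword H f v = \<one>\<^bsub>H\<^esub>"
        using \<open>a \<in> V\<close> \<open>c \<in> V\<close> by (auto simp: V_def)
      have "?ev (w @ v) \<in> V" by (rule VI) (use w FH in \<open>simp add: H.eval_fword_append\<close>)
      then show ?thesis using w G.eval_fword_append[OF \<iota>] by simp
    qed
  qed
  have VN: "V \<lhd> G\<lparr>carrier := L\<rparr>"
    unfolding L.normal_inv_iff
  proof (intro conjI ballI)
    show "subgroup V (G\<lparr>carrier := L\<rparr>)" using G.subgroup_incl[OF Vsub Lsub VL] .
    show "g \<otimes>\<^bsub>G\<lparr>carrier := L\<rparr>\<^esub> a \<otimes>\<^bsub>G\<lparr>carrier := L\<rparr>\<^esub> inv\<^bsub>G\<lparr>carrier := L\<rparr>\<^esub> g \<in> V"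
      if g: "g \<in> carrier (G\<lparr>carrier := L\<rparr>)" and a: "a \<in> V" for g a
    proof -
      obtain v where v: "g = ?ev v" using g by (auto simp: L_def)
      obtain w where w: "a = ?ev w" "\<And>f. f \<in> F \<Longrightarrow> eval_fword H f w = \<one>\<^bsub>H\<^esub>" using a by (auto simp: V_def)
      have "?ev ((v @ w) @ inv_fword v) \<in> V"
        by (rule VI) (use w FH H.eval_fword_closed in \<open>simp add: H.eval_fword_append H.eval_inv_fword\<close>)
      then show ?thesis
        using v w g G.eval_fword_append[OF \<iota>] G.eval_inv_fword[OF \<iota>] G.m_inv_consistent[OF Lsub]
        by (simp add: G.m_assoc G.eval_fword_closed[OF \<iota>])
    qed
  qed
  interpret V: normal V "G\<lparr>carrier := L\<rparr>" by fact
  let ?Q = "G\<lparr>carrier := L\<rparr> Mod V"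
  interpret Q: group ?Q by (rule V.factorgroup_is_group)
  define r where "r = (\<lambda>g. V #>\<^bsub>G\<lparr>carrier := L\<rparr>\<^esub> g)"
  have r_hom: "r \<in> hom (G\<lparr>carrier := L\<rparr>) ?Q" unfolding r_def by (rule V.r_coset_hom_Mod)
  interpret r: group_hom "G\<lparr>carrier := L\<rparr>" ?Q r using r_hom by unfold_locales
  have r_one: "r g = \<one>\<^bsub>?Q\<^esub> \<longleftrightarrow> g \<in> V" if "g \<in> L" for g
    using that L.coset_join1[OF _ _ V.subgroup_axioms, of g] L.coset_join2[OF _ V.subgroup_axioms, of g]
    by (auto simp: r_def)
  have r_surj: "r ` L = carrier ?Q" by (simp add: carrier_FactGroup r_def)
  have \<phi>L: "\<phi> h \<in> L" if "h \<in> carrier H" for h using S SL that by auto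
  define \<phi>' where "\<phi>' = (\<lambda>h. r (\<phi> h))"
  have \<phi>'_hom: "\<phi>' \<in> hom H ?Q"
    using r.hom_mult \<phi>L r.hom_closed by (simp add: \<phi>'_def hom_def)
  interpret \<phi>': group_hom H ?Q \<phi>' using \<phi>'_hom by unfold_locales
  \<comment> \<open>An element of the image of \<open>H\<close> lying in \<open>V\<close> is the
    value of an identity of \<open>H\<close>, hence trivial by \<open>verb\<close>.\<close>
  have \<phi>'_inj: "inj_on \<phi>' (carrier H)"
    unfolding \<phi>'.inj_on_one_iff
  proof (intro allI impI)
    fix h assume h: "h \<in> carrier H" "\<phi>' h = \<one>\<^bsub>?Q\<^esub>"
    then have "\<phi> h \<in> V" using r_one[OF \<phi>L] unfolding \<phi>'_def by blast
    then obtain w where w: "\<phi> h = ?ev w" "\<And>f. f \<in> F \<Longrightarrow> eval_fword H f w = \<one>\<^bsub>H\<^esub>" by (auto simp: V_def)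
    have "?ev w \<in> \<phi> ` carrier H" using imageI[OF h(1), of \<phi>] w(1) by simp
    with w(2) have "?ev w = \<one>\<^bsub>G\<^esub>" by (rule verb)
    then show "h = \<one>\<^bsub>H\<^esub>" using w h \<phi>.inj_on_one_iff \<phi>(2) by simp
  qed
  define tup where "tup = (\<lambda>w. \<lambda>f\<in>F. eval_fword H f w)"
  have tup: "tup w \<in> F \<rightarrow>\<^sub>E carrier H" for w
    using H.eval_fword_closed FH by (auto simp: tup_def)
  \<comment> \<open>Each element records the values of one word both in the power of
    \<open>H\<close> and in \<open>G\<close>. Keeping the second component lets the map onto
    \<open>?Q\<close> be read off without choosing a word; it kills every pair with trivial tuple,
    as the value then lies in \<open>V\<close>.\<close>
  define K where "K = (product_group F (\<lambda>_. H) \<times>\<times> G)\<lparr>carrier := range (\<lambda>w. (tup w, ?ev w))\<rparr>"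
  interpret K0: group "product_group F (\<lambda>_. H) \<times>\<times> G"
    by (intro DirProd_group product_group H G)
  have "subgroup (range (\<lambda>w. (tup w, ?ev w))) (product_group F (\<lambda>_. H) \<times>\<times> G)"
  proof (rule K0.subgroupI)
    show "range (\<lambda>w. (tup w, ?ev w)) \<subseteq> carrier (product_group F (\<lambda>_. H) \<times>\<times> G)"
      using tup G.eval_fword_closed[OF \<iota>] by auto
    show "inv\<^bsub>product_group F (\<lambda>_. H) \<times>\<times> G\<^esub> a \<in> range (\<lambda>w. (tup w, ?ev w))"
      if "a \<in> range (\<lambda>w. (tup w, ?ev w))" for a
    proof -
      obtain w where w: "a = (tup w, ?ev w)" using \<open>a \<in> range _\<close> by auto
      have "inv\<^bsub>product_group F (\<lambda>_. H) \<times>\<times> G\<^esub> a = (inv\<^bsub>product_group F (\<lambda>_. H)\<^esub> tup w, inv\<^bsub>G\<^esub> ?ev w)"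
        unfolding w by (rule inv_DirProd) (use H G tup G.eval_fword_closed[OF \<iota>] in auto)
      also have "\<dots> = (tup (inv_fword w), ?ev (inv_fword w))"
        using tup[of w] H FH G.eval_inv_fword[OF \<iota>] H.eval_inv_fword
        by (auto simp: tup_def intro!: restrict_ext)
      finally show ?thesis by blast
    qed
    show "a \<otimes>\<^bsub>product_group F (\<lambda>_. H) \<times>\<times> G\<^esub> c \<in> range (\<lambda>w. (tup w, ?ev w))"
      if "a \<in> range (\<lambda>w. (tup w, ?ev w))" "c \<in> range (\<lambda>w. (tup w, ?ev w))" for a c
    proof -
      obtain w v where w: "a = (tup w, ?ev w)" "c = (tup v, ?ev v)"
        using \<open>a \<in> range _\<close> \<open>c \<in> range _\<close> by auto
      have "a \<otimes>\<^bsub>product_group F (\<lambda>_. H) \<times>\<times> G\<^esub> c = (tup (w @ v), ?ev (w @ v))"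
        using w FH G.eval_fword_append[OF \<iota>] H.eval_fword_append
        by (auto simp: tup_def intro!: restrict_ext)
      then show ?thesis by blast
    qed
  qed auto
  then have K: "group K" unfolding K_def by (rule K0.subgroup_imp_group)
  have finQ: "finite (carrier ?Q)"
  proof -
    \<comment> \<open>Words with the same tuple differ by a word that is trivial under
      \<open>F\<close>, so their values lie in the same coset of \<open>V\<close>; there are
      finitely many tuples.\<close>
    have "finite (range (\<lambda>w. r (?ev w)))"
    proof (rule finite_range_of_determined)
      show "finite (range tup)"
        by (rule finite_subset[of _ "F \<rightarrow>\<^sub>E carrier H"]) (use tup finF finH in \<open>auto intro: finite_PiE\<close>)
      show "r (?ev u) = r (?ev v)" if eq: "tup u = tup v" for u v
      proof -
        have "eval_fword H f (u @ inv_fword v) = \<one>\<^bsub>H\<^esub>" if f: "f \<in> F" for f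
        proof -
          have "eval_fword H f u = eval_fword H f v" using fun_cong[OF eq, of f] f by (simp add: tup_def)
          then show ?thesis
            using FH[OF f] H.eval_fword_closed by (simp add: H.eval_fword_append H.eval_inv_fword)
        qed
        then have "?ev (u @ inv_fword v) \<in> V" by (rule VI)
        then have "?ev u \<otimes>\<^bsub>G\<^esub> inv\<^bsub>G\<^esub> ?ev v \<in> V"
          by (simp add: G.eval_fword_append[OF \<iota>] G.eval_inv_fword[OF \<iota>])
        then have "?ev u \<in> V #>\<^bsub>G\<lparr>carrier := L\<rparr>\<^esub> ?ev v"
          using V.rcos_module_rev[OF L.is_group, of "?ev v" "?ev u"] G.m_inv_consistent[OF Lsub]
          by (simp add: L_def)
        then show ?thesis
          using L.repr_independence[OF _ _ V.subgroup_axioms, of "?ev u" "?ev v"] by (simp add: r_def L_def)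
      qed
    qed
    then show ?thesis using r_surj by (simp add: L_def image_image)
  qed
  obtain \<rho> where \<rho>: "\<rho> \<in> hom ?Q H" "\<And>h. h \<in> carrier H \<Longrightarrow> \<rho> (\<phi>' h) = h"
  proof (rule retraction_of_subquotient_of_power[OF H finH C cent indec cop Q.is_group finQ \<phi>'_hom \<phi>'_inj K _ _ finF])
    show "(\<lambda>k. r (snd k)) \<in> hom K ?Q"
    proof (rule homI)
      show "r (snd k) \<in> carrier ?Q" if "k \<in> carrier K" for k
        using that r_surj by (auto simp: K_def L_def)
      show "r (snd (k \<otimes>\<^bsub>K\<^esub> l)) = r (snd k) \<otimes>\<^bsub>?Q\<^esub> r (snd l)" if "k \<in> carrier K" "l \<in> carrier K" for k l
        using that r.hom_mult[of "snd k" "snd l"] by (auto simp: K_def L_def mult_DirProd' simp del: mult_FactGroup)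
    qed
    show "(\<lambda>k. r (snd k)) ` carrier K = carrier ?Q"
      using r_surj by (simp add: K_def L_def image_image)
    show "(\<lambda>k. fst k f) \<in> hom K H" if f: "f \<in> F" for f
    proof (rule homI)
      show "fst k f \<in> carrier H" if "k \<in> carrier K" for k
        using that f tup by (auto simp: K_def PiE_iff)
      show "fst (k \<otimes>\<^bsub>K\<^esub> l) f = fst k f \<otimes>\<^bsub>H\<^esub> fst l f" for k l
        using f by (simp add: K_def mult_DirProd')
    qed
    show "r (snd k) = \<one>\<^bsub>?Q\<^esub>" if k: "k \<in> carrier K" "\<And>f. f \<in> F \<Longrightarrow> fst k f = \<one>\<^bsub>H\<^esub>" for k
    proof -
      obtain w where w: "k = (tup w, ?ev w)" using k(1) by (auto simp: K_def)
      have "?ev w \<in> V" by (rule VI) (use k(2) w in \<open>auto simp: tup_def\<close>)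
      then show ?thesis using r_one[of "?ev w"] w by (simp add: L_def)
    qed
  qed (rule that; assumption)
  have "(\<lambda>g. \<rho> (r g)) \<in> hom (G\<lparr>carrier := L\<rparr>) H"
    using \<rho>(1) r_hom unfolding hom_def by (auto simp: Pi_iff)
  then show ?thesis using that[OF Lsub SL] \<rho>(2) unfolding \<phi>'_def by blast
qed

section \<open>Systems of equations\<close>

text \<open>The conditions concern only letters occurring in \<open>u\<close>: a solution may take
  values outside \<open>L\<close> at other variables, where \<open>\<theta>\<close> is not
  controlled.\<close>

lemma hom_eval_cword:
  assumes G: "group G" and L: "subgroup L G" and \<theta>: "\<theta> \<in> hom (G\<lparr>carrier := L\<rparr>) G"
    and vars: "\<And>i e. Var i e \<in> set u \<Longrightarrow> f i \<in> L \<and> g i = \<theta> (f i)"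
    and coeffs: "\<And>c. Const c \<in> set u \<Longrightarrow> c \<in> L \<and> \<theta> c = c"
  shows "eval_cword G id f u \<in> L \<and> eval_cword G id g u = \<theta> (eval_cword G id f u)"
proof -
  interpret G: group G by fact
  interpret L: subgroup L G by fact
  interpret LG: group "G\<lparr>carrier := L\<rparr>" using G.subgroup_imp_group[OF L] .
  interpret \<theta>: group_hom "G\<lparr>carrier := L\<rparr>" G \<theta> using \<theta> by unfold_locales
  have \<theta>_mult: "\<theta> (x \<otimes>\<^bsub>G\<^esub> y) = \<theta> x \<otimes>\<^bsub>G\<^esub> \<theta> y" if "x \<in> L" "y \<in> L" for x y
    using \<theta>.hom_mult[of x y] that by simp
  have \<theta>_inv: "\<theta> (inv\<^bsub>G\<^esub> x) = inv\<^bsub>G\<^esub> (\<theta> x)" if "x \<in> L" for x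
    using \<theta>.hom_inv[of x] that G.m_inv_consistent[OF L that] by simp
  have \<theta>_one: "\<theta> \<one>\<^bsub>G\<^esub> = \<one>\<^bsub>G\<^esub>" using \<theta>.hom_one by simp
  show ?thesis
    using vars coeffs
  proof (induct u)
    case Nil
    then show ?case using \<theta>_one by simp
  next
    case (Cons a u)
    have IH: "eval_cword G id f u \<in> L \<and> eval_cword G id g u = \<theta> (eval_cword G id f u)"
    proof (rule Cons.hyps)
      show "f i \<in> L \<and> g i = \<theta> (f i)" if "Var i e \<in> set u" for i e
        by (rule Cons.prems(1)[of i e]) (use that in simp)
      show "c \<in> L \<and> \<theta> c = c" if "Const c \<in> set u" for c
        by (rule Cons.prems(2)[of c]) (use that in simp)
    qed
    show ?case
    proof (cases a)
      case (Var i e)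
      have "f i \<in> L" "g i = \<theta> (f i)" using Cons(2)[of i e] Var by auto
      then show ?thesis using Var IH by (simp add: \<theta>_mult \<theta>_inv id_def)
    next
      case (Const c)
      have "c \<in> L" "\<theta> c = c" using Cons(3)[of c] Const by auto
      then show ?thesis using Const IH by (simp add: \<theta>_mult id_def)
    qed
  qed
qed

lemma verbally_closed_imp_identity_values_trivial:
  assumes H: "group H" and G: "group G" and \<phi>: "\<phi> \<in> hom H G"
    and vc: "verbally_closed (\<phi> ` carrier H) G"
    and id: "\<And>e. e \<in> UNIV \<rightarrow> carrier H \<Longrightarrow> eval_fword H e w = \<one>\<^bsub>H\<^esub>"
    and f: "f \<in> UNIV \<rightarrow> carrier G" "eval_fword G f w \<in> \<phi> ` carrier H"
  shows "eval_fword G f w = \<one>\<^bsub>G\<^esub>"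
proof -
  interpret \<phi>: group_hom H G \<phi> using H G \<phi> by (simp add: group_hom_def group_hom_axioms_def)
  obtain g where g: "g \<in> UNIV \<rightarrow> \<phi> ` carrier H" "eval_fword G g w = eval_fword G f w"
    using vc f unfolding verbally_closed_def by blast
  have "g i \<in> \<phi> ` carrier H" for i using g(1) by auto
  then have "\<forall>i. \<exists>h. h \<in> carrier H \<and> \<phi> h = g i" by (metis imageE)
  then obtain e where e: "\<And>i. e i \<in> carrier H" "\<And>i. \<phi> (e i) = g i" by metis
  have e': "e \<in> UNIV \<rightarrow> carrier H" using e by auto
  have "\<phi> \<circ> e = g" using e by auto
  then have "eval_fword G g w = \<phi> (eval_fword H e w)" using \<phi>.hom_eval_fword[OF e'] by simp
  then show ?thesis using id[OF e'] g by simp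
qed

theorem theorem2:
  fixes H :: "('a, 'b) monoid_scheme" and C :: "'a set"
  assumes "group H" and "finite (carrier H)"
    and "C \<lhd> H"
    and "centraliser H C = C"
    and "\<not> H_normal_decomposable H C"
    and "coprime (card C) (order (H Mod C))"
  shows "(\<forall>(G :: ('g, 'e) monoid_scheme) \<phi>.
            group G \<and> finite (carrier G) \<and> \<phi> \<in> hom H G \<and> inj_on \<phi> (carrier H)
            \<and> satisfies_identities_of G H
            \<longrightarrow> retract (\<phi> ` carrier H) G)
       \<and> (\<forall>(G :: ('k, 'm) monoid_scheme) \<phi>.
            group G \<and> \<phi> \<in> hom H G \<and> inj_on \<phi> (carrier H)
            \<and> verbally_closed (\<phi> ` carrier H) G
            \<longrightarrow> algebraically_closed (\<phi> ` carrier H) G)"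
proof (intro conjI allI impI; elim conjE)
  fix G :: "('g, 'e) monoid_scheme" and \<phi>
  assume G: "group G" "finite (carrier G)" and \<phi>: "\<phi> \<in> hom H G" "inj_on \<phi> (carrier H)"
    and sat: "satisfies_identities_of G H"
  have img: "\<phi> ` carrier H \<subseteq> carrier G" using \<phi>(1) by (rule hom_carrier)
  have verbal: "eval_fword G f w = \<one>\<^bsub>G\<^esub>"
    if "\<And>e. e \<in> UNIV \<rightarrow> carrier H \<Longrightarrow> eval_fword H e w = \<one>\<^bsub>H\<^esub>" "f \<in> UNIV \<rightarrow> carrier G" for w f
    using sat that unfolding satisfies_identities_of_def by blast
  \<comment> \<open>The finite set handed over is the whole of \<open>carrier G\<close>, so the
    subgroup \<open>L\<close> obtained is \<open>G\<close> itself.\<close>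
  obtain L \<rho> where L: "subgroup L G" "carrier G \<subseteq> L" and \<rho>: "\<rho> \<in> hom (G\<lparr>carrier := L\<rparr>) H"
    "\<And>h. h \<in> carrier H \<Longrightarrow> \<rho> (\<phi> h) = h"
    by (rule word_retraction[OF assms G(1) \<phi> G(2) subset_refl img]) (erule (1) verbal, (rule that; assumption))
  have "L = carrier G" using L subgroup.subset by blast
  then have \<rho>_hom: "\<rho> \<in> hom G H" using \<rho>(1) by (simp add: hom_def)
  show "retract (\<phi> ` carrier H) G"
    unfolding retract_def
  proof (intro bexI conjI ballI)
    show "(\<lambda>g. \<phi> (\<rho> g)) \<in> hom G G"
      using \<rho>_hom \<phi>(1) unfolding hom_def by (auto simp: Pi_iff)
    show "\<phi> (\<rho> (\<phi> (\<rho> g))) = \<phi> (\<rho> g)" if "g \<in> carrier G" for g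
      using \<rho>(2) hom_in_carrier[OF \<rho>_hom that] by simp
    show "(\<lambda>g. \<phi> (\<rho> g)) ` carrier G = \<phi> ` carrier H"
    proof (intro subset_antisym subsetI)
      show "x \<in> \<phi> ` carrier H" if "x \<in> (\<lambda>g. \<phi> (\<rho> g)) ` carrier G" for x
        using that hom_in_carrier[OF \<rho>_hom] by blast
      show "x \<in> (\<lambda>g. \<phi> (\<rho> g)) ` carrier G" if x: "x \<in> \<phi> ` carrier H" for x
      proof (rule image_eqI)
        show "x = \<phi> (\<rho> x)" using x \<rho>(2) by auto
        show "x \<in> carrier G" using x img by blast
      qed
    qed
  qed
next
  fix G :: "('k, 'm) monoid_scheme" and \<phi>
  assume G: "group G" and \<phi>: "\<phi> \<in> hom H G" "inj_on \<phi> (carrier H)"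
    and vc: "verbally_closed (\<phi> ` carrier H) G"
  have img: "\<phi> ` carrier H \<subseteq> carrier G" using \<phi>(1) by (rule hom_carrier)
  have verbal: "eval_fword G f w = \<one>\<^bsub>G\<^esub>"
    if "\<And>e. e \<in> UNIV \<rightarrow> carrier H \<Longrightarrow> eval_fword H e w = \<one>\<^bsub>H\<^esub>" "f \<in> UNIV \<rightarrow> carrier G"
      "eval_fword G f w \<in> \<phi> ` carrier H" for w f
    using that by (rule verbally_closed_imp_identity_values_trivial[OF assms(1) G \<phi>(1) vc])
  show "algebraically_closed (\<phi> ` carrier H) G"
    unfolding algebraically_closed_def
  proof (intro allI impI; elim exE conjE)
    fix S :: "'k cword list" and f
    assume coeffs: "\<forall>u\<in>set S. set u \<inter> range Const \<subseteq> Const ` \<phi> ` carrier H"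
      and f: "f \<in> UNIV \<rightarrow> carrier G" and sol: "\<forall>u\<in>set S. eval_cword G id f u = \<one>\<^bsub>G\<^esub>"
    \<comment> \<open>Only the finitely many variables occurring in the system matter; their values,
      together with the finite image of \<open>H\<close>, form the finite set
      \<open>?T\<close>.\<close>
    define I where "I = {i. \<exists>u\<in>set S. \<exists>e. Var i e \<in> set u}"
    have "I \<subseteq> (\<lambda>a. case a of Var i e \<Rightarrow> i | Const c \<Rightarrow> 0) ` (\<Union>u\<in>set S. set u)"
      by (force simp: I_def image_iff)
    then have finI: "finite I" by (rule finite_subset) auto
    let ?T = "\<phi> ` carrier H \<union> f ` I"
    have T: "finite ?T" "?T \<subseteq> carrier G" "\<phi> ` carrier H \<subseteq> ?T"
      using assms(2) finI img f by auto
    obtain L \<rho> where L: "subgroup L G" "?T \<subseteq> L" and \<rho>: "\<rho> \<in> hom (G\<lparr>carrier := L\<rparr>) H"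
      "\<And>h. h \<in> carrier H \<Longrightarrow> \<rho> (\<phi> h) = h"
      by (rule word_retraction[OF assms G \<phi> T]) (erule (2) verbal, (rule that; assumption))
    define \<theta> where "\<theta> = (\<lambda>x. \<phi> (\<rho> x))"
    have \<theta>: "\<theta> \<in> hom (G\<lparr>carrier := L\<rparr>) G"
      using \<rho>(1) \<phi>(1) unfolding hom_def \<theta>_def by (auto simp: Pi_iff)
    \<comment> \<open>The retraction is applied to the solution at the occurring variables.
      Elsewhere any element of the image of \<open>H\<close> would do, and the identity is
      taken.\<close>
    define g where "g = (\<lambda>i. if i \<in> I then \<theta> (f i) else \<phi> \<one>\<^bsub>H\<^esub>)"
    have "g \<in> UNIV \<rightarrow> \<phi> ` carrier H"
    proof
      fix i
      have "\<rho> (f i) \<in> carrier H" if "i \<in> I"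
        using hom_in_carrier[OF \<rho>(1), of "f i"] L(2) that by auto
      moreover have "\<one>\<^bsub>H\<^esub> \<in> carrier H" using assms(1) by (simp add: group.is_monoid)
      ultimately show "g i \<in> \<phi> ` carrier H" by (simp add: g_def \<theta>_def)
    qed
    moreover have "eval_cword G id g u = \<one>\<^bsub>G\<^esub>" if u: "u \<in> set S" for u
    proof -
      have "eval_cword G id f u \<in> L \<and> eval_cword G id g u = \<theta> (eval_cword G id f u)"
      proof (rule hom_eval_cword[OF G L(1) \<theta>])
        show "f i \<in> L \<and> g i = \<theta> (f i)" if "Var i e \<in> set u" for i e
        proof -
          have "i \<in> I" using that u by (auto simp: I_def)
          then show ?thesis using L(2) by (auto simp: g_def)
        qed
        show "c \<in> L \<and> \<theta> c = c" if "Const c \<in> set u" for c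
        proof -
          have "c \<in> \<phi> ` carrier H" using coeffs u that by blast
          then show ?thesis using L(2) \<rho>(2) by (auto simp: \<theta>_def)
        qed
      qed
      then have "eval_cword G id g u = \<theta> \<one>\<^bsub>G\<^esub>" using sol u by simp
      also have "\<dots> = \<one>\<^bsub>G\<^esub>"
        using hom_one[OF \<theta> group.subgroup_imp_group[OF G L(1)] G] by simp
      finally show ?thesis .
    qed
    ultimately show "\<exists>f. f \<in> UNIV \<rightarrow> \<phi> ` carrier H \<and> (\<forall>u\<in>set S. eval_cword G id f u = \<one>\<^bsub>G\<^esub>)"
      by blast
  qed
qed

end
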